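(* Let $\mathcal G$ be of one of the types B0, C0, D0, CI, DIII, BI(a), BI(b), CII, DI(a) for $\mathfrak g_N$, and let $V$ be a non-trivial highest weight $X(\mathfrak g_N,\mathcal G)^{tw}$-module. Let $$V^J=\{\eta\in V:\ s_{-i,j}(u)\eta=s_{0j}(u)\eta=0\ \text{ for all }1\le i,j\le n\}$$ (the condition on $s_{0j}(u)$ being omitted when $N=2n$). Then $V^J$ is stable under the action of all operators $s_{ij}(u)$ with $1\le i,j\le n$. Moreover, the assignment $\tilde b_{ij}(u)\mapsto[\pm]\,s_{ij}(u)$ $(1\le i,j\le n)$ defines a representation of the extended reflection algebra $\widetilde{\mathcal B}(n,\boldsymbol\ell)$ in $V^J$, where $[\pm]$ is $-$ if $\mathcal G$ is of type BI(b) and $+$ otherwise.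
   Context: Let $N=2n$ or $N=2n+1$; $\mathfrak g_N=\mathfrak{so}_N$ ($N\ge3$) or $\mathfrak g_N=\mathfrak{sp}_N$ ($N=2n\ge2$). Rows and columns of $N\times N$ matrices are indexed by $-n,\ldots,-1,(0),1,\ldots,n$ ($0$ occurring only if $N$ is odd); $E_{ij}$ are the matrix units. Set $\theta_{ij}=1$ in the orthogonal case, $\theta_{ij}=\mathrm{sign}(i)\,\mathrm{sign}(j)$ in the symplectic case, $(E_{ij})^t=\theta_{ij}E_{-j,-i}$, $P=\sum_{i,j}E_{ij}\otimes E_{ji}$, $Q=\sum_{i,j}\theta_{ij}E_{ij}\otimes E_{-i,-j}$, $\kappa=N/2-1$ for $\mathfrak{so}_N$, $\kappa=N/2+1$ for $\mathfrak{sp}_N$, $R(u)=I-\frac{P}{u}+\frac{Q}{u-\kappa}$. Extended Yangian $X(\mathfrak g_N)$: the unital associative $\mathbb C$-algebra generated by $t_{ij}^{(r)}$ ($r\ge 0$, $t_{ij}^{(0)}=\delta_{ij}$) subject to $R(u-v)T_1(u)T_2(v)=T_2(v)T_1(u)R(u-v)$, where $t_{ij}(u)=\sum_{r\ge0}t_{ij}^{(r)}u^{-r}$, $T(u)=\sum E_{ij}\otimes t_{ij}(u)$ and $T_1,T_2$ denote $T$ placed in the first, resp. second, copy of $\mathrm{End}(\mathbb C^N)$. Put $T^t(u)=\sum(E_{ij})^t\otimes t_{ij}(u)$. The diagonal matrix $\mathcal G=\sum g_{ii}E_{ii}$ (with $p\ge q>0$, $p+q=N$ where $p,q$ occur): B0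 ($\mathfrak{so}_{2n+1}$), C0 ($\mathfrak{sp}_{2n}$), D0 ($\mathfrak{so}_{2n}$): $\mathcal G=I$. CI ($\mathfrak{sp}_{2n}$), DIII ($\mathfrak{so}_{2n}$): $\mathcal G=\sum_{i=1}^n(E_{ii}-E_{-i,-i})$. BI(a) ($\mathfrak{so}_{2n+1}$, $p$ odd, $q$ even): $g_{ii}=1$ for $|i|\le\frac{p-1}2$, $g_{ii}=-1$ for $|i|\ge\frac{p+1}2$. BI(b) ($\mathfrak{so}_{2n+1}$, $p$ even, $q$ odd): $g_{ii}=-1$ for $|i|\le\frac{q-1}2$, $g_{ii}=1$ for $|i|\ge\frac{q+1}2$. CII ($\mathfrak{sp}_{2n}$) and DI(a) ($\mathfrak{so}_{2n}$), $p,q$ even: $g_{ii}=1$ for $1\le|i|\le\frac p2$, $g_{ii}=-1$ for $|i|>\frac p2$. Define $\mathcal G(u)=\mathcal G$ for types B0, C0, D0, CI, DIII, and for CII, DI(a) with $p=q$; otherwise $\mathcal G(u)=(I-c\,u\,\mathcal G)(1-cu)^{-1}$ with $c=\frac4{p-q}$ (expanded in $u^{-1}$). Extended twisted Yangian $X(\mathfrak g_N,\mathcal G)^{tw}$: the subalgebra of $X(\mathfrak g_N)$ generated by the coefficients of the entries $s_{ij}(u)$ of $S(u)=T(u-\kappa/2)\,\mathcal G(u)\,T^t(-u+\kappa/2)$. Let $\mathcal I_N=\{0,\ldots,n\}$ if $N=2n+1$, $\mathcal I_N=\{1,\ldots,n\}$ if $N=2n$. A representation $V$ is a highest weight representation if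 there is a nonzero $\eta\in V$ with $V=X(\mathfrak g_N,\mathcal G)^{tw}\eta$, $s_{ij}(u)\eta=0$ for $i<j$, and $s_{ii}(u)\eta=\mu_i(u)\eta$ for $i\in\mathcal I_N$, for some $\mu_i(u)\in g_{ii}+u^{-1}\mathbb C[[u^{-1}]]$. The integer $\boldsymbol\ell$: if $g_{ii}=1$ for all $i\in\mathcal I_N$ put $\mathbf k=n$; otherwise $\mathbf k$ is the unique element of $\mathcal I_N\setminus\{n\}$ with $g_{\mathbf k\mathbf k}\ne g_{\mathbf k+1,\mathbf k+1}$. Put $\boldsymbol\ell=n-\mathbf k$. The extended reflection algebra $\widetilde{\mathcal B}(n,\boldsymbol\ell)$ is the unital associative $\mathbb C$-algebra generated by $\tilde b_{ij}^{(r)}$, $1\le i,j\le n$, $r\ge0$, with $\tilde b_{ij}^{(0)}=\delta_{ij}\varepsilon_i$, $\varepsilon_i=1$ for $1\le i\le n-\boldsymbol\ell$ and $\varepsilon_i=-1$ for $n-\boldsymbol\ell<i\le n$, subject to $R^\circ(u-v)\tilde B_1(u)R^\circ(u+v)\tilde B_2(v)=\tilde B_2(v)R^\circ(u+v)\tilde B_1(u)R^\circ(u-v)$, where $\tilde B(u)=\sum_{i,j=1}^nE_{ij}\otimes\tilde b_{ij}(u)$, $\tilde b_{ij}(u)=\sum_{r\ge0}\tilde b_{ij}^{(r)}u^{-r}$, and $R^\circ(u)=I-u^{-1}P$ on $\mathbb C^n\otimes\mathbb C^n$. *)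

theory Defs
  imports
    "HOL-Library.Poly_Mapping"
    "HOL-Computational_Algebra.Formal_Laurent_Series"
    "HOL-Algebra.QuotRing"
    "HOL-Algebra.Generated_Rings"
begin

section \<open>Algebras given by generators and relations\<close>

text \<open>
  The free associative unital algebra on generators of type \<open>'g\<close> is the monoid algebra over the
  complex numbers of the free monoid of words, i.e. the convolution algebra of
  \<^theory>\<open>HOL-Library.Poly_Mapping\<close>. Words are a copy of lists, because convolution
  needs concatenation to be the addition of the type class \<^class>\<open>monoid_add\<close>.
\<close>

datatype 'g free_word = Word (letters: "'g list")

instantiation free_word :: (type) monoid_add
begin
definition zero_free_word :: "'a free_word" where "0 = Word []"
definition plus_free_word :: "'a free_word \<Rightarrow> 'a free_word \<Rightarrow> 'a free_word"
  where "v + w = Word (letters v @ letters w)"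
instance by standard (simp_all add: zero_free_word_def plus_free_word_def)
end

type_synonym 'g free_alg = "'g free_word \<Rightarrow>\<^sub>0 complex"

definition gen :: "'g \<Rightarrow> 'g free_alg"
  where "gen g = Poly_Mapping.single (Word [g]) 1"

definition scalar :: "complex \<Rightarrow> 'g free_alg"
  where "scalar c = Poly_Mapping.single 0 c"

definition free_algebra :: "'g set \<Rightarrow> 'g free_alg ring"
  where "free_algebra G =
    \<lparr>carrier = {f. \<forall>w \<in> Poly_Mapping.keys f. set (letters w) \<subseteq> G},
     mult = (*), one = 1, zero = 0, add = (+)\<rparr>"

definition presented_algebra :: "'g set \<Rightarrow> 'g free_alg set \<Rightarrow> 'g free_alg set ring"
  where "presented_algebra G Rels = free_algebra G Quot genideal (free_algebra G) Rels"

text \<open>The canonical projection from the free algebra to the presented one.\<close>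

definition pclass :: "'g set \<Rightarrow> 'g free_alg set \<Rightarrow> 'g free_alg \<Rightarrow> 'g free_alg set"
  where "pclass G Rels f = genideal (free_algebra G) Rels +>\<^bsub>free_algebra G\<^esub> f"

lemma fa_carrier:
  "f \<in> carrier (free_algebra G) \<longleftrightarrow> (\<forall>w \<in> Poly_Mapping.keys f. set (letters w) \<subseteq> G)"
  by (simp add: free_algebra_def)

lemma fa_neg: "f \<in> carrier (free_algebra G) \<Longrightarrow> - f \<in> carrier (free_algebra G)"
  by (simp add: fa_carrier)

lemma fa_add:
  "f \<in> carrier (free_algebra G) \<Longrightarrow> g \<in> carrier (free_algebra G)
    \<Longrightarrow> f + g \<in> carrier (free_algebra G)"
  using Poly_Mapping.keys_add[of f g] unfolding fa_carrier by blast

lemma fa_mult: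
  assumes f: "f \<in> carrier (free_algebra G)" and g: "g \<in> carrier (free_algebra G)"
  shows "f * g \<in> carrier (free_algebra G)"
  unfolding fa_carrier
proof
  fix w assume "w \<in> Poly_Mapping.keys (f * g)"
  then obtain a b where "w = a + b" "a \<in> Poly_Mapping.keys f" "b \<in> Poly_Mapping.keys g"
    using keys_mult[of f g] by blast
  then show "set (letters w) \<subseteq> G"
    using f g unfolding fa_carrier by (simp add: plus_free_word_def)
qed

lemma fa_scalar: "scalar c \<in> carrier (free_algebra G)"
  by (simp add: fa_carrier scalar_def zero_free_word_def)

lemma fa_one: "1 \<in> carrier (free_algebra G)"
  using fa_scalar[of 1 G] by (simp add: scalar_def)

lemma fa_sel:
  "mult (free_algebra G) = (*)" "add (free_algebra G) = (+)"
  "one (free_algebra G) = 1" "zero (free_algebra G) = 0"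
  by (simp_all add: free_algebra_def)

lemma free_algebra_ring: "ring (free_algebra G)"
proof (rule ringI)
  show "abelian_group (free_algebra G)"
  proof (rule abelian_groupI)
    show "\<exists>g\<in>carrier (free_algebra G). g \<oplus>\<^bsub>free_algebra G\<^esub> f = \<zero>\<^bsub>free_algebra G\<^esub>"
      if "f \<in> carrier (free_algebra G)" for f
      using fa_neg[OF that] by (intro bexI[of _ "- f"]) (simp_all add: fa_sel)
  next
    show "\<zero>\<^bsub>free_algebra G\<^esub> \<in> carrier (free_algebra G)" by (simp add: fa_carrier fa_sel)
  qed (simp_all add: fa_sel fa_add add.assoc add.commute)
  show "Group.monoid (free_algebra G)"
    by (rule monoidI) (simp_all add: fa_sel fa_mult fa_one mult.assoc)
qed (simp_all add: fa_sel distrib_left distrib_right)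

text \<open>
  A representation on the subspace \<open>W\<close> of a complex vector space (scalar action \<open>scale\<close>) of the
  complex algebra whose underlying ring is \<open>A\<close> and whose scalars are embedded by \<open>emb\<close>. Only the
  values \<open>\<rho> a w\<close> with \<open>a\<close> in \<open>A\<close> and \<open>w\<close> in \<open>W\<close> matter.
\<close>

definition algebra_representation ::
  "('a, 'm) ring_scheme \<Rightarrow> (complex \<Rightarrow> 'a) \<Rightarrow> (complex \<Rightarrow> 'v \<Rightarrow> 'v) \<Rightarrow> 'v set
    \<Rightarrow> ('a \<Rightarrow> 'v \<Rightarrow> 'v::ab_group_add) \<Rightarrow> bool"
  where "algebra_representation A emb scale W \<rho> \<longleftrightarrow>
    vector_space scale \<and> module.subspace scale W \<and>
    (\<forall>a\<in>carrier A. \<forall>w\<in>W. \<rho> a w \<in> W) \<and>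
    (\<forall>a\<in>carrier A. \<forall>v\<in>W. \<forall>w\<in>W. \<rho> a (v + w) = \<rho> a v + \<rho> a w) \<and>
    (\<forall>a\<in>carrier A. \<forall>c. \<forall>w\<in>W. \<rho> a (scale c w) = scale c (\<rho> a w)) \<and>
    (\<forall>a\<in>carrier A. \<forall>b\<in>carrier A. \<forall>w\<in>W. \<rho> (a \<oplus>\<^bsub>A\<^esub> b) w = \<rho> a w + \<rho> b w) \<and>
    (\<forall>a\<in>carrier A. \<forall>b\<in>carrier A. \<forall>w\<in>W. \<rho> (a \<otimes>\<^bsub>A\<^esub> b) w = \<rho> a (\<rho> b w)) \<and>
    (\<forall>w\<in>W. \<rho> \<one>\<^bsub>A\<^esub> w = w) \<and>
    (\<forall>c. \<forall>w\<in>W. \<rho> (emb c) w = scale c w)"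


section \<open>Matrices and formal series\<close>

text \<open>
  A matrix is a function of two indices; the finite index set \<open>I\<close> enters through the sums.
  On \<open>\<complex>\<^sup>N \<otimes> \<complex>\<^sup>N\<close> the indices are pairs: the coefficient of \<open>E\<^sub>i\<^sub>j \<otimes> E\<^sub>k\<^sub>l\<close> is the
  entry at \<open>(i, k)\<close>, \<open>(j, l)\<close>.
\<close>

type_synonym ('i, 'a) mtx = "'i \<Rightarrow> 'i \<Rightarrow> 'a"

definition mmul :: "'i set \<Rightarrow> ('i, 'a::semiring_0) mtx \<Rightarrow> ('i, 'a) mtx \<Rightarrow> ('i, 'a) mtx"
  where "mmul I A B = (\<lambda>i j. \<Sum>k\<in>I. A i k * B k j)"

definition mone :: "('i, 'a::zero_neq_one) mtx"
  where "mone = (\<lambda>i j. if i = j then 1 else 0)"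

definition munit :: "'i \<Rightarrow> 'i \<Rightarrow> ('i, 'a::zero_neq_one) mtx"
  where "munit a b = (\<lambda>i j. if i = a \<and> j = b then 1 else 0)"

definition kron :: "('i, 'a::times) mtx \<Rightarrow> ('i, 'a) mtx \<Rightarrow> ('i \<times> 'i, 'a) mtx"
  where "kron A B = (\<lambda>(i, k) (j, l). A i j * B k l)"

definition perm_P :: "'i set \<Rightarrow> ('i \<times> 'i, 'a::semiring_1) mtx"
  where "perm_P I = (\<lambda>x y. \<Sum>i\<in>I. \<Sum>j\<in>I. kron (munit i j) (munit j i) x y)"

text \<open>
  Series in \<open>u\<^sup>-\<^sup>1\<close> are Laurent series in the variable \<open>u\<^sup>-\<^sup>1\<close>, so that
  \<^const>\<open>fls_X_inv\<close> is \<open>u\<close>. Two spectral parameters: Laurent series in \<open>u\<^sup>-\<^sup>1\<close> whose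
  coefficients are Laurent series in \<open>v\<^sup>-\<^sup>1\<close>. Over \<open>\<complex>\<close> these form a field, in
  which the rational functions \<open>(u - v)\<^sup>-\<^sup>1\<close>, \<open>(u + v)\<^sup>-\<^sup>1\<close>, \<open>(u - v - \<kappa>)\<^sup>-\<^sup>1\<close>
  are expanded in nonnegative powers of \<open>v\<close>. (The common denominator being an invertible central
  scalar, the relations below are equivalent to those obtained by clearing denominators.)
\<close>

definition u_ser :: "complex fls"
  where "u_ser = fls_X_inv"

definition U_ser :: "complex fls fls"
  where "U_ser = fls_X_inv"

definition V_ser :: "complex fls fls"
  where "V_ser = fls_const fls_X_inv"

definition const2 :: "complex \<Rightarrow> complex fls fls"
  where "const2 c = fls_const (fls_const c)"

text \<open>Scalar-valued series viewed as series with coefficients in the free algebra.\<close>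

definition lift1 :: "complex fls \<Rightarrow> 'g free_alg fls"
  where "lift1 f = Abs_fls (\<lambda>r. scalar (fls_nth f r))"

definition lift2 :: "complex fls fls \<Rightarrow> 'g free_alg fls fls"
  where "lift2 f = Abs_fls (\<lambda>r. lift1 (fls_nth f r))"

text \<open>
  For coefficients \<open>a\<close>, the series \<open>\<Sum>\<^sub>r a\<^sub>r w\<^sup>-\<^sup>r\<close>: for \<open>w\<close> an invertible Laurent series
  whose inverse has no constant term, and with each of the two spectral parameters as argument.
\<close>

definition ser_at :: "complex fls \<Rightarrow> (nat \<Rightarrow> 'g free_alg) \<Rightarrow> 'g free_alg fls"
  where "ser_at w a = fps_to_fls (fps_compose (Abs_fps a) (fls_regpart (lift1 (inverse w))))"

definition ser_U :: "(nat \<Rightarrow> 'g free_alg) \<Rightarrow> 'g free_alg fls fls"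
  where "ser_U a = fps_to_fls (Abs_fps (\<lambda>r. fls_const (a r)))"

definition ser_V :: "(nat \<Rightarrow> 'g free_alg) \<Rightarrow> 'g free_alg fls fls"
  where "ser_V a = fls_const (fps_to_fls (Abs_fps a))"

text \<open>The coefficients of all entries of a matrix identity \<open>L = R\<close>, as relators.\<close>

definition coeff_relators ::
  "'i set \<Rightarrow> ('i, 'g free_alg fls fls) mtx \<Rightarrow> ('i, 'g free_alg fls fls) mtx \<Rightarrow> 'g free_alg set"
  where "coeff_relators I L R = {fls_nth (fls_nth (L x y - R x y) r) s | x y r s. x \<in> I \<and> y \<in> I}"

type_synonym yindex = "int \<times> int \<times> nat"


section \<open>Symmetric pairs of types B, C, D\<close>

datatype pair_type =
    B0 | C0 | D0 | CI | DIII
  | BIa (par_p: nat) (par_q: nat) | BIb (par_p: nat) (par_q: nat)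
  | CII (par_p: nat) (par_q: nat) | DIa (par_p: nat) (par_q: nat)

fun admissible :: "pair_type \<Rightarrow> nat \<Rightarrow> bool" where
  "admissible B0 n \<longleftrightarrow> 2*n + 1 \<ge> 3"
| "admissible C0 n \<longleftrightarrow> 2*n \<ge> 2"
| "admissible D0 n \<longleftrightarrow> 2*n \<ge> 3"
| "admissible CI n \<longleftrightarrow> 2*n \<ge> 2"
| "admissible DIII n \<longleftrightarrow> 2*n \<ge> 3"
| "admissible (BIa p q) n \<longleftrightarrow> 2*n + 1 \<ge> 3 \<and> p \<ge> q \<and> q > 0 \<and> p + q = 2*n + 1 \<and> odd p \<and> even q"
| "admissible (BIb p q) n \<longleftrightarrow> 2*n + 1 \<ge> 3 \<and> p \<ge> q \<and> q > 0 \<and> p + q = 2*n + 1 \<and> even p \<and> odd q"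
| "admissible (CII p q) n \<longleftrightarrow> 2*n \<ge> 2 \<and> p \<ge> q \<and> q > 0 \<and> p + q = 2*n \<and> even p \<and> even q"
| "admissible (DIa p q) n \<longleftrightarrow> 2*n \<ge> 3 \<and> p \<ge> q \<and> q > 0 \<and> p + q = 2*n \<and> even p \<and> even q"

definition symplectic :: "pair_type \<Rightarrow> bool"
  where "symplectic ty \<longleftrightarrow> ty = C0 \<or> ty = CI \<or> (\<exists>p q. ty = CII p q)"

definition odd_N :: "pair_type \<Rightarrow> bool"
  where "odd_N ty \<longleftrightarrow> ty = B0 \<or> (\<exists>p q. ty = BIa p q) \<or> (\<exists>p q. ty = BIb p q)"

definition dim_N :: "pair_type \<Rightarrow> nat \<Rightarrow> nat"
  where "dim_N ty n = (if odd_N ty then 2*n + 1 else 2*n)"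

definition idx :: "pair_type \<Rightarrow> nat \<Rightarrow> int set"
  where "idx ty n = (if odd_N ty then {- int n..int n} else {- int n..int n} - {0})"

definition half_idx :: "pair_type \<Rightarrow> nat \<Rightarrow> int set"
  where "half_idx ty n = (if odd_N ty then {0..int n} else {1..int n})"

definition theta :: "pair_type \<Rightarrow> int \<Rightarrow> int \<Rightarrow> int"
  where "theta ty i j = (if symplectic ty then sgn i * sgn j else 1)"

definition kappa :: "pair_type \<Rightarrow> nat \<Rightarrow> complex"
  where "kappa ty n =
    (if symplectic ty then of_nat (dim_N ty n) / 2 + 1 else of_nat (dim_N ty n) / 2 - 1)"

fun gdiag :: "pair_type \<Rightarrow> int \<Rightarrow> complex" where
  "gdiag B0 i = 1"
| "gdiag C0 i = 1"
| "gdiag D0 i = 1"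
| "gdiag CI i = of_int (sgn i)"
| "gdiag DIII i = of_int (sgn i)"
| "gdiag (BIa p q) i = (if \<bar>i\<bar> \<le> (int p - 1) div 2 then 1 else - 1)"
| "gdiag (BIb p q) i = (if \<bar>i\<bar> \<le> (int q - 1) div 2 then - 1 else 1)"
| "gdiag (CII p q) i = (if \<bar>i\<bar> \<le> int p div 2 then 1 else - 1)"
| "gdiag (DIa p q) i = (if \<bar>i\<bar> \<le> int p div 2 then 1 else - 1)"

definition G_mat :: "pair_type \<Rightarrow> (int, complex) mtx"
  where "G_mat ty = (\<lambda>i j. if i = j then gdiag ty i else 0)"

definition constant_G :: "pair_type \<Rightarrow> bool"
  where "constant_G ty \<longleftrightarrow>
    ty \<in> {B0, C0, D0, CI, DIII} \<or> (\<exists>p. ty = CII p p) \<or> (\<exists>p. ty = DIa p p)"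

definition G_ser :: "pair_type \<Rightarrow> (int, complex fls) mtx"
  where "G_ser ty = (\<lambda>i j.
    if constant_G ty then fls_const (G_mat ty i j)
    else let c = fls_const (4 / (of_nat (par_p ty) - of_nat (par_q ty))) in
      (mone i j - c * u_ser * fls_const (G_mat ty i j)) / (1 - c * u_ser))"


section \<open>The extended Yangian\<close>

definition Q_mat :: "pair_type \<Rightarrow> nat \<Rightarrow> (int \<times> int, complex fls fls) mtx"
  where "Q_mat ty n = (\<lambda>x y. \<Sum>i\<in>idx ty n. \<Sum>j\<in>idx ty n.
    of_int (theta ty i j) * kron (munit i j) (munit (- i) (- j)) x y)"

definition R_mat :: "pair_type \<Rightarrow> nat \<Rightarrow> complex fls fls \<Rightarrow> (int \<times> int, complex fls fls) mtx"
  where "R_mat ty n z = (\<lambda>x y.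
    mone x y - perm_P (idx ty n) x y / z + Q_mat ty n x y / (z - const2 (kappa ty n)))"

text \<open>The generators \<open>t\<^sub>i\<^sub>j\<^sup>(\<^sup>r\<^sup>)\<close> before passing to the quotient.\<close>

definition t_gen :: "int \<Rightarrow> int \<Rightarrow> nat \<Rightarrow> yindex free_alg"
  where "t_gen i j r = gen (i, j, r)"

definition X_gens :: "pair_type \<Rightarrow> nat \<Rightarrow> yindex set"
  where "X_gens ty n = idx ty n \<times> idx ty n \<times> UNIV"

definition X_rels :: "pair_type \<Rightarrow> nat \<Rightarrow> yindex free_alg set"
  where "X_rels ty n =
    {t_gen i j 0 - mone i j | i j. i \<in> idx ty n \<and> j \<in> idx ty n} \<union>
    (let I2 = idx ty n \<times> idx ty n;
         R = (\<lambda>x y. lift2 (R_mat ty n (U_ser - V_ser) x y));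
         T1 = kron (\<lambda>i j. ser_U (t_gen i j)) mone;
         T2 = kron mone (\<lambda>i j. ser_V (t_gen i j))
     in coeff_relators I2 (mmul I2 (mmul I2 R T1) T2) (mmul I2 (mmul I2 T2 T1) R))"

definition X_alg :: "pair_type \<Rightarrow> nat \<Rightarrow> yindex free_alg set ring"
  where "X_alg ty n = presented_algebra (X_gens ty n) (X_rels ty n)"

definition X_class :: "pair_type \<Rightarrow> nat \<Rightarrow> yindex free_alg \<Rightarrow> yindex free_alg set"
  where "X_class ty n = pclass (X_gens ty n) (X_rels ty n)"

definition X_scalar :: "pair_type \<Rightarrow> nat \<Rightarrow> complex \<Rightarrow> yindex free_alg set"
  where "X_scalar ty n c = X_class ty n (scalar c)"


section \<open>The extended twisted Yangian\<close>

definition T_at :: "complex fls \<Rightarrow> (int, yindex free_alg fls) mtx"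
  where "T_at w = (\<lambda>i j. ser_at w (t_gen i j))"

definition Tt_at :: "pair_type \<Rightarrow> nat \<Rightarrow> complex fls \<Rightarrow> (int, yindex free_alg fls) mtx"
  where "Tt_at ty n w = (\<lambda>a b. \<Sum>i\<in>idx ty n. \<Sum>j\<in>idx ty n.
    of_int (theta ty i j) * munit (- j) (- i) a b * ser_at w (t_gen i j))"

definition S_mat :: "pair_type \<Rightarrow> nat \<Rightarrow> (int, yindex free_alg fls) mtx"
  where "S_mat ty n =
    (let I = idx ty n; h = fls_const (kappa ty n / 2) in
     mmul I (mmul I (T_at (u_ser - h)) (\<lambda>i j. lift1 (G_ser ty i j))) (Tt_at ty n (- u_ser + h)))"

text \<open>
  The coefficient of \<open>u\<^sup>-\<^sup>r\<close> in \<open>s\<^sub>i\<^sub>j(u)\<close>, as an element of the extended Yangian. Here \<open>r\<close>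
  ranges over all integers; the coefficients with \<open>r < 0\<close> vanish.
\<close>

definition s_coeff :: "pair_type \<Rightarrow> nat \<Rightarrow> int \<Rightarrow> int \<Rightarrow> int \<Rightarrow> yindex free_alg set"
  where "s_coeff ty n i j r = X_class ty n (fls_nth (S_mat ty n i j) r)"

definition Xtw_alg :: "pair_type \<Rightarrow> nat \<Rightarrow> yindex free_alg set ring"
  where "Xtw_alg ty n = (X_alg ty n)\<lparr>carrier := generate_ring (X_alg ty n)
    (range (X_scalar ty n) \<union> {s_coeff ty n i j r | i j r. i \<in> idx ty n \<and> j \<in> idx ty n})\<rparr>"

definition Xtw_rep ::
  "pair_type \<Rightarrow> nat \<Rightarrow> (complex \<Rightarrow> 'v \<Rightarrow> 'v) \<Rightarrow> (yindex free_alg set \<Rightarrow> 'v \<Rightarrow> 'v::ab_group_add) \<Rightarrow> bool"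
  where "Xtw_rep ty n scale \<rho> \<longleftrightarrow>
    algebra_representation (Xtw_alg ty n) (X_scalar ty n) scale UNIV \<rho>"

definition highest_weight_rep ::
  "pair_type \<Rightarrow> nat \<Rightarrow> (complex \<Rightarrow> 'v \<Rightarrow> 'v) \<Rightarrow> (yindex free_alg set \<Rightarrow> 'v \<Rightarrow> 'v::ab_group_add) \<Rightarrow> bool"
  where "highest_weight_rep ty n scale \<rho> \<longleftrightarrow> Xtw_rep ty n scale \<rho> \<and>
    (\<exists>\<eta> \<mu>. \<eta> \<noteq> 0 \<and> UNIV = {\<rho> a \<eta> | a. a \<in> carrier (Xtw_alg ty n)} \<and>
      (\<forall>i\<in>idx ty n. \<forall>j\<in>idx ty n. i < j \<longrightarrow> (\<forall>r. \<rho> (s_coeff ty n i j r) \<eta> = 0)) \<and>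
      (\<forall>i\<in>half_idx ty n. fps_nth (\<mu> i) 0 = gdiag ty i \<and>
        (\<forall>r. \<rho> (s_coeff ty n i i r) \<eta> = scale (fls_nth (fps_to_fls (\<mu> i)) r) \<eta>)))"

definition V_J :: "pair_type \<Rightarrow> nat \<Rightarrow> (yindex free_alg set \<Rightarrow> 'v \<Rightarrow> 'v::ab_group_add) \<Rightarrow> 'v set"
  where "V_J ty n \<rho> = {\<eta>. \<forall>i\<in>{1..int n}. \<forall>j\<in>{1..int n}. \<forall>r.
    \<rho> (s_coeff ty n (- i) j r) \<eta> = 0 \<and> (odd_N ty \<longrightarrow> \<rho> (s_coeff ty n 0 j r) \<eta> = 0)}"

definition bold_k :: "pair_type \<Rightarrow> nat \<Rightarrow> nat"
  where "bold_k ty n = (if \<forall>i\<in>half_idx ty n. gdiag ty i = 1 then n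
    else THE k. int k \<in> half_idx ty n - {int n} \<and> gdiag ty (int k) \<noteq> gdiag ty (int k + 1))"

definition bold_l :: "pair_type \<Rightarrow> nat \<Rightarrow> nat"
  where "bold_l ty n = n - bold_k ty n"

text \<open>The sign written \<open>[\<plusminus>]\<close>.\<close>

definition pm_sign :: "pair_type \<Rightarrow> complex"
  where "pm_sign ty = (if \<exists>p q. ty = BIb p q then - 1 else 1)"


section \<open>The extended reflection algebra\<close>

definition R0_mat :: "nat \<Rightarrow> complex fls fls \<Rightarrow> (int \<times> int, complex fls fls) mtx"
  where "R0_mat n z = (\<lambda>x y. mone x y - inverse z * perm_P {1..int n} x y)"

definition b_gen :: "int \<Rightarrow> int \<Rightarrow> nat \<Rightarrow> yindex free_alg"
  where "b_gen i j r = gen (i, j, r)"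

definition B_gens :: "nat \<Rightarrow> yindex set"
  where "B_gens n = {1..int n} \<times> {1..int n} \<times> UNIV"

definition eps :: "nat \<Rightarrow> nat \<Rightarrow> int \<Rightarrow> complex"
  where "eps n l i = (if i \<le> int n - int l then 1 else - 1)"

definition B_rels :: "nat \<Rightarrow> nat \<Rightarrow> yindex free_alg set"
  where "B_rels n l =
    {b_gen i j 0 - mone i j * scalar (eps n l i) | i j. i \<in> {1..int n} \<and> j \<in> {1..int n}} \<union>
    (let I2 = {1..int n} \<times> {1..int n};
         Rm = (\<lambda>x y. lift2 (R0_mat n (U_ser - V_ser) x y));
         Rp = (\<lambda>x y. lift2 (R0_mat n (U_ser + V_ser) x y));
         B1 = kron (\<lambda>i j. ser_U (b_gen i j)) mone;
         B2 = kron mone (\<lambda>i j. ser_V (b_gen i j))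
     in coeff_relators I2
          (mmul I2 (mmul I2 (mmul I2 Rm B1) Rp) B2) (mmul I2 (mmul I2 (mmul I2 B2 Rp) B1) Rm))"

definition B_alg :: "nat \<Rightarrow> nat \<Rightarrow> yindex free_alg set ring"
  where "B_alg n l = presented_algebra (B_gens n) (B_rels n l)"

definition B_class :: "nat \<Rightarrow> nat \<Rightarrow> yindex free_alg \<Rightarrow> yindex free_alg set"
  where "B_class n l = pclass (B_gens n) (B_rels n l)"

definition B_scalar :: "nat \<Rightarrow> nat \<Rightarrow> complex \<Rightarrow> yindex free_alg set"
  where "B_scalar n l c = B_class n l (scalar c)"

definition b_coeff :: "nat \<Rightarrow> nat \<Rightarrow> int \<Rightarrow> int \<Rightarrow> nat \<Rightarrow> yindex free_alg set"
  where "b_coeff n l i j r = B_class n l (b_gen i j r)"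

definition B_rep ::
  "nat \<Rightarrow> nat \<Rightarrow> (complex \<Rightarrow> 'v \<Rightarrow> 'v) \<Rightarrow> 'v set \<Rightarrow> (yindex free_alg set \<Rightarrow> 'v \<Rightarrow> 'v::ab_group_add) \<Rightarrow> bool"
  where "B_rep n l scale W \<sigma> \<longleftrightarrow> algebra_representation (B_alg n l) (B_scalar n l) scale W \<sigma>"


section \<open>The relators lie in the free algebra on the given generators\<close>

text \<open>
  \<^const>\<open>genideal\<close> returns an ideal containing the relators only if they belong to the carrier.
\<close>

definition closed_set :: "'a::ring_1 set \<Rightarrow> bool"
  where "closed_set C \<longleftrightarrow> 0 \<in> C \<and> 1 \<in> C \<and>
    (\<forall>a\<in>C. - a \<in> C) \<and> (\<forall>a\<in>C. \<forall>b\<in>C. a + b \<in> C \<and> a * b \<in> C)"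

definition fls_over :: "'a::zero set \<Rightarrow> 'a fls set"
  where "fls_over C = {f. \<forall>r. fls_nth f r \<in> C}"

lemma closed_set_sum: "closed_set C \<Longrightarrow> (\<And>i. i \<in> I \<Longrightarrow> f i \<in> C) \<Longrightarrow> sum f I \<in> C"
  by (induction I rule: infinite_finite_induct) (auto simp: closed_set_def)

lemma closed_set_fls_over:
  assumes C: "closed_set C" shows "closed_set (fls_over C)"
proof -
  have "fls_nth (f * g) r \<in> C" if "f \<in> fls_over C" "g \<in> fls_over C" for f g r
    unfolding fls_times_nth(2)[of f g r]
    by (rule closed_set_sum[OF C]) (use that C in \<open>auto simp: closed_set_def fls_over_def\<close>)
  then show ?thesis
    using C by (auto simp: closed_set_def fls_over_def)
qed

definition mtx_over :: "'i set \<Rightarrow> 'a set \<Rightarrow> ('i, 'a) mtx set"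
  where "mtx_over I C = {A. \<forall>i\<in>I. \<forall>j\<in>I. A i j \<in> C}"

lemma mmul_over:
  assumes "closed_set C" "A \<in> mtx_over I C" "B \<in> mtx_over I C"
  shows "mmul I A B \<in> mtx_over I C"
  using assms unfolding mmul_def mtx_over_def
  by (auto intro!: closed_set_sum simp: closed_set_def)

lemma kron_over:
  assumes "closed_set C" "A \<in> mtx_over I C" "B \<in> mtx_over I C"
  shows "kron A B \<in> mtx_over (I \<times> I) C"
  using assms by (auto simp: kron_def closed_set_def mtx_over_def)

lemma mone_over: "closed_set C \<Longrightarrow> mone \<in> mtx_over I C"
  by (auto simp: mone_def closed_set_def mtx_over_def)

lemma fa_closed_set: "closed_set (carrier (free_algebra G))"
  using fa_scalar[of 0 G] by (auto simp: closed_set_def fa_neg fa_add fa_mult fa_one scalar_def)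

lemma scalar_0 [simp]: "scalar 0 = 0"
  by (simp add: scalar_def)

lemma lift1_nth [simp]: "fls_nth (lift1 f) r = scalar (fls_nth f r)"
  unfolding lift1_def by (rule nth_Abs_fls_ex_lower_bound) (auto intro!: exI[of _ "fls_subdegree f"])

lemma lift2_nth [simp]: "fls_nth (lift2 f) r = lift1 (fls_nth f r)"
  unfolding lift2_def
proof (rule nth_Abs_fls_ex_lower_bound)
  have "lift1 0 = 0" by (rule fls_eqI) simp
  then show "\<exists>N. \<forall>r<N. lift1 (fls_nth f r) = 0"
    by (auto intro!: exI[of _ "fls_subdegree f"])
qed

lemma lift2_over: "lift2 f \<in> fls_over (fls_over (carrier (free_algebra G)))"
  by (simp add: fls_over_def fa_scalar)

lemma ser_over:
  assumes "\<And>r. a r \<in> carrier (free_algebra G)"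
  shows "ser_U a \<in> fls_over (fls_over (carrier (free_algebra G)))"
    and "ser_V a \<in> fls_over (fls_over (carrier (free_algebra G)))"
  using assms fa_scalar[of 0 G] by (auto simp: ser_U_def ser_V_def fls_over_def)

lemma coeff_relators_over:
  assumes "closed_set C" "L \<in> mtx_over I (fls_over (fls_over C))" "R \<in> mtx_over I (fls_over (fls_over C))"
  shows "coeff_relators I L R \<subseteq> C"
proof -
  have "fls_nth (fls_nth (L x y) r) s + - fls_nth (fls_nth (R x y) r) s \<in> C"
    if "x \<in> I" "y \<in> I" for x y r s
    using assms that unfolding mtx_over_def fls_over_def closed_set_def by blast
  then show ?thesis
    by (auto simp: coeff_relators_def)
qed

lemma gen_over: "g \<in> G \<Longrightarrow> gen g \<in> carrier (free_algebra G)"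
  by (simp add: fa_carrier gen_def)

lemma fa_diff:
  "f \<in> carrier (free_algebra G) \<Longrightarrow> g \<in> carrier (free_algebra G)
    \<Longrightarrow> f - g \<in> carrier (free_algebra G)"
  using fa_add[of f G "- g"] fa_neg[of g G] by simp

lemma X_rels_carrier: "X_rels ty n \<subseteq> carrier (free_algebra (X_gens ty n))"
proof -
  let ?C = "carrier (free_algebra (X_gens ty n))"
  let ?D = "fls_over (fls_over ?C)"
  note C = fa_closed_set[of "X_gens ty n"]
  note D = closed_set_fls_over[OF closed_set_fls_over[OF C]]
  have t: "t_gen i j r \<in> ?C" if "i \<in> idx ty n" "j \<in> idx ty n" for i j r
    using that by (auto simp: t_gen_def X_gens_def intro: gen_over)
  have T: "(\<lambda>i j. ser_U (t_gen i j)) \<in> mtx_over (idx ty n) ?D"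
      "(\<lambda>i j. ser_V (t_gen i j)) \<in> mtx_over (idx ty n) ?D"
    using t by (auto simp: mtx_over_def intro: ser_over)
  have R: "(\<lambda>x y. lift2 (f x y)) \<in> mtx_over (idx ty n \<times> idx ty n) ?D" for f
    by (simp add: mtx_over_def lift2_over)
  have base: "t_gen i j 0 - mone i j \<in> ?C" if "i \<in> idx ty n" "j \<in> idx ty n" for i j
    using t[OF that, of 0] C by (auto intro!: fa_diff simp: mone_def closed_set_def)
  show ?thesis
    unfolding X_rels_def Let_def
    by (intro Un_least coeff_relators_over mmul_over kron_over mone_over C D T R) (use base in auto)
qed

lemma B_rels_carrier: "B_rels n l \<subseteq> carrier (free_algebra (B_gens n))"
proof -
  let ?C = "carrier (free_algebra (B_gens n))"
  let ?D = "fls_over (fls_over ?C)"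
  note C = fa_closed_set[of "B_gens n"]
  note D = closed_set_fls_over[OF closed_set_fls_over[OF C]]
  have b: "b_gen i j r \<in> ?C" if "i \<in> {1..int n}" "j \<in> {1..int n}" for i j r
    using that by (auto simp: b_gen_def B_gens_def intro: gen_over)
  have B: "(\<lambda>i j. ser_U (b_gen i j)) \<in> mtx_over {1..int n} ?D"
      "(\<lambda>i j. ser_V (b_gen i j)) \<in> mtx_over {1..int n} ?D"
    using b by (auto simp: mtx_over_def intro: ser_over)
  have R: "(\<lambda>x y. lift2 (f x y)) \<in> mtx_over ({1..int n} \<times> {1..int n}) ?D" for f
    by (simp add: mtx_over_def lift2_over)
  have base: "b_gen i j 0 - mone i j * scalar (eps n l i) \<in> ?C"
    if "i \<in> {1..int n}" "j \<in> {1..int n}" for i j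
    using b[OF that, of 0] C fa_scalar[of 0 "B_gens n"]
    by (auto intro!: fa_diff fa_mult fa_scalar simp: mone_def closed_set_def)
  show ?thesis
    unfolding B_rels_def Let_def
    by (intro Un_least coeff_relators_over mmul_over kron_over mone_over C D B R) (use base in auto)
qed

end

theory Submission
  imports Defs
begin

text \<open>
  Everything rests on the reflection equation
  \<open>R(u - v) S\<^sub>1(u) R(u + v) S\<^sub>2(v) = S\<^sub>2(v) R(u + v) S\<^sub>1(u) R(u - v)\<close> for the matrix \<open>S(u)\<close> in the extended Yangian
  (lemma \<open>reflection_equation\<close>). It follows from three facts. The matrices \<open>A(u) = T(u - \<kappa>/2)\<close> and
  \<open>B(u) = T\<^sup>t(- u + \<kappa>/2)\<close> satisfy exchange relations with \<open>R(u - v)\<close>, respectively \<open>R(u + v)\<close> in the mixed case: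
  they are the RTT relation with shifted arguments (\<open>RTT_at\<close>, \<open>RTT_swapped\<close>), transposed in one or both tensor
  factors, since transposition in one factor turns \<open>R(x)\<close> into \<open>R(\<kappa> - x)\<close>. The scalar matrix \<open>G(u)\<close> solves the
  reflection equation (\<open>G_reflection\<close>), which is an identity between rational functions. And a solution
  dressed by exchange relations is again a solution (\<open>reflection_of_exchange\<close>).

  Now apply both sides to a vector annihilated by all \<open>s\<^sub>m\<^sub>j(u)\<close> with \<open>m \<le> 0 < j\<close> and look at columns with positive
  indices. The summand \<open>Q\<close> of the R-matrices, which couples an index with its negative, drops out of all
  places but the leftmost one. In a row \<open>(k, i)\<close> with \<open>k \<le> 0 < i\<close> the right side vanishes, and taking a trace
  in the remaining equations gives linear equations with invertible coefficients \<open>1 + n/(u - v - \<kappa>)\<close> and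
  \<open>1 - n/(u + v)\<close>, whence \<open>s\<^sub>k\<^sub>l(u) s\<^sub>i\<^sub>j(v)\<close> annihilates the vector: this is stability. In rows with positive indices
  also the leftmost \<open>Q\<close> drops out, and there remains the reflection equation of the reflection
  algebra (\<open>restricted_reflection\<close>). The constant terms \<open>g\<^sub>i\<^sub>i\<close> of the \<open>s\<^sub>i\<^sub>i(u)\<close> are \<open>\<epsilon>\<^sub>i\<close> up to the sign \<open>[\<plusminus>]\<close>.

  The computations take place in Laurent series over the free algebra, with the scalar rational functions
  acting as central elements. An identity in the Yangian is a congruence modulo the ideal of relations,
  and the vanishing of \<open>f v\<close> is membership of \<open>f\<close> in a left ideal that contains it (\<open>left_ideal_annihilator\<close>).
\<close>

section \<open>Substitution in Laurent series over noncommutative rings\<close>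

definition ring_map :: "('a::ring_1 \<Rightarrow> 'b::ring_1) \<Rightarrow> bool"
  where "ring_map h \<longleftrightarrow> h 1 = 1 \<and> (\<forall>x y. h (x + y) = h x + h y) \<and> (\<forall>x y. h (x * y) = h x * h y)"

lemma ring_map_simps:
  assumes "ring_map h"
  shows "h 0 = 0" "h 1 = 1" "h (x + y) = h x + h y" "h (x * y) = h x * h y"
    "h (- x) = - h x" "h (x - y) = h x - h y" "h (sum f I) = (\<Sum>i\<in>I. h (f i))"
proof -
  show add: "h (x + y) = h x + h y" and "h 1 = 1" "h (x * y) = h x * h y" for x y
    using assms by (auto simp: ring_map_def)
  show zero: "h 0 = 0"
    using add[of 0 0] by simp
  show uminus: "h (- x) = - h x" for x
    using add[of x "- x"] zero by (simp add: eq_neg_iff_add_eq_0 add.commute)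
  show "h (x - y) = h x - h y"
    using add[of x "- y"] uminus by simp
  show "h (sum f I) = (\<Sum>i\<in>I. h (f i))"
    by (induction I rule: infinite_finite_induct) (simp_all add: zero add)
qed

lemma ring_map_comp: "ring_map g \<Longrightarrow> ring_map h \<Longrightarrow> ring_map (\<lambda>x. g (h x))"
  by (auto simp: ring_map_def)

lemma fls_times_nth_bounds:
  fixes f g :: "'a::semiring_0 fls"
  assumes "\<And>r. r < a \<Longrightarrow> fls_nth f r = 0" "\<And>r. r < b \<Longrightarrow> fls_nth g r = 0"
  shows "fls_nth (f * g) n = (\<Sum>i=a..n - b. fls_nth f i * fls_nth g (n - i))"
  unfolding fls_times_nth(2)[of f g n]
  by (rule sum.mono_neutral_cong) (force simp: assms)+

definition fls_map :: "('a::zero \<Rightarrow> 'b::zero) \<Rightarrow> 'a fls \<Rightarrow> 'b fls"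
  where "fls_map h f = Abs_fls (\<lambda>r. h (fls_nth f r))"

lemma fls_map_nth: "h 0 = 0 \<Longrightarrow> fls_nth (fls_map h f) r = h (fls_nth f r)"
  unfolding fls_map_def
  by (rule nth_Abs_fls_ex_lower_bound) (auto intro!: exI[of _ "fls_subdegree f"])

lemma ring_map_fls_map:
  assumes h: "ring_map h"
  shows "ring_map (fls_map h)"
proof -
  note s = ring_map_simps[OF h] fls_map_nth[of h, OF ring_map_simps(1)[OF h]]
  have "fls_map h (f * g) = fls_map h f * fls_map h g" for f g
  proof (rule fls_eqI)
    fix n
    show "fls_nth (fls_map h (f * g)) n = fls_nth (fls_map h f * fls_map h g) n"
      by (subst fls_times_nth_bounds[of "fls_subdegree f" _ "fls_subdegree g"])
        (simp_all add: s fls_times_nth(2))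
  qed
  then show ?thesis
    by (auto simp: ring_map_def s intro!: fls_eqI)
qed

lemma ring_map_fls_const: "ring_map (fls_const :: 'a::ring_1 \<Rightarrow> 'a fls)"
  by (simp add: ring_map_def fls_plus_const)

lemma fls_commute:
  fixes f g :: "'a::semiring_0 fls"
  assumes "\<And>r s. fls_nth f r * fls_nth g s = fls_nth g s * fls_nth f r"
  shows "f * g = g * f"
proof (rule fls_eqI)
  fix n
  let ?a = "fls_subdegree f" and ?b = "fls_subdegree g"
  have "fls_nth (f * g) n = (\<Sum>i=?a..n - ?b. fls_nth f i * fls_nth g (n - i))"
    by (rule fls_times_nth)
  also have "\<dots> = (\<Sum>j=?b..n - ?a. fls_nth g j * fls_nth f (n - j))"
    by (rule sum.reindex_bij_witness[of _ "\<lambda>j. n - j" "\<lambda>i. n - i"]) (auto simp: assms)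
  also have "\<dots> = fls_nth (g * f) n"
    by (rule fls_times_nth(2)[symmetric])
  finally show "fls_nth (f * g) n = fls_nth (g * f) n" .
qed

text \<open>
  The powers \<open>z\<^sup>r\<close>, for all integers \<open>r\<close>, of a central invertible series \<open>z\<close> of positive order. Carrying
  the whole family makes the substitution \<open>x := z\<close> available for Laurent series over a noncommutative
  ring, where inverses of series are not at hand.
\<close>

definition power_family :: "(int \<Rightarrow> 'a::ring_1 fls) \<Rightarrow> bool"
  where "power_family Z \<longleftrightarrow> Z 0 = 1 \<and> (\<forall>r s. Z (r + s) = Z r * Z s) \<and>
    (\<forall>r n. n < r \<longrightarrow> fls_nth (Z r) n = 0) \<and>
    (\<forall>r n a. fls_nth (Z r) n * a = a * fls_nth (Z r) n)"

text \<open>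
  The substitution \<open>\<Sum>\<^sub>r f\<^sub>r x\<^sup>r \<mapsto> \<Sum>\<^sub>r f\<^sub>r z\<^sup>r\<close>. Since \<open>z\<^sup>r\<close> starts in degree at least \<open>r\<close>, each coefficient is a
  finite sum.
\<close>

definition fls_subst :: "(int \<Rightarrow> 'a::ring_1 fls) \<Rightarrow> 'a fls \<Rightarrow> 'a fls"
  where "fls_subst Z f = Abs_fls (\<lambda>n. \<Sum>r=fls_subdegree f..n. fls_nth f r * fls_nth (Z r) n)"

lemma fls_subst_nth:
  assumes "\<And>r. r < a \<Longrightarrow> fls_nth f r = 0"
  shows "fls_nth (fls_subst Z f) n = (\<Sum>r=a..n. fls_nth f r * fls_nth (Z r) n)"
proof -
  have "fls_nth (fls_subst Z f) n = (\<Sum>r=fls_subdegree f..n. fls_nth f r * fls_nth (Z r) n)"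
    unfolding fls_subst_def
    by (rule nth_Abs_fls_lower_bound[of "fls_subdegree f"]) simp
  also have "\<dots> = (\<Sum>r=a..n. fls_nth f r * fls_nth (Z r) n)"
    by (rule sum.mono_neutral_cong) (use assms in force)+
  finally show ?thesis .
qed

lemma power_family_D:
  assumes "power_family Z"
  shows "Z 0 = 1" "Z (r + s) = Z r * Z s" "n < r \<Longrightarrow> fls_nth (Z r) n = 0"
    "fls_nth (Z r) n * a = a * fls_nth (Z r) n"
  using assms unfolding power_family_def by auto

text \<open>
  Both sides are the sum of \<open>f\<^sub>i g\<^sub>j (z\<^sup>i)\<^sub>m (z\<^sup>j)\<^sub>n\<^sub>-\<^sub>m\<close> over the finite set of triples with \<open>a \<le> i\<close>, \<open>b \<le> j\<close>
  and \<open>i \<le> m \<le> n - j\<close>, in two orders of summation; the coefficients of \<open>z\<^sup>i\<close> are moved past \<open>g\<^sub>j\<close> because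
  they are central.
\<close>

lemma fls_subst_times:
  assumes Z: "power_family Z"
  shows "fls_subst Z (f * g) = fls_subst Z f * fls_subst Z g"
proof (rule fls_eqI)
  fix n
  define a b where "a = fls_subdegree f" and "b = fls_subdegree g"
  have f0: "fls_nth f r = 0" if "r < a" for r using that by (simp add: a_def)
  have g0: "fls_nth g r = 0" if "r < b" for r using that by (simp add: b_def)
  have sf: "fls_nth (fls_subst Z f) r = 0" if "r < a" for r
    using that by (simp add: fls_subst_nth[of a, OF f0])
  have sg: "fls_nth (fls_subst Z g) r = 0" if "r < b" for r
    using that by (simp add: fls_subst_nth[of b, OF g0])
  have fg: "fls_nth (f * g) r = 0" if "r < a + b" for r
    using that by (simp add: fls_times_nth_bounds[of a f b g, OF f0 g0])
  let ?F = "\<lambda>i j m. fls_nth f i * fls_nth g j * (fls_nth (Z i) m * fls_nth (Z j) (n - m))"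
  have "fls_nth (fls_subst Z (f * g)) n =
      (\<Sum>k=a+b..n. fls_nth (f * g) k * fls_nth (Z k) n)"
    by (rule fls_subst_nth[OF fg])
  also have "\<dots> = (\<Sum>k=a+b..n. \<Sum>i=a..k-b. fls_nth f i * fls_nth g (k - i) * fls_nth (Z k) n)"
    by (simp add: fls_times_nth_bounds[of a f b g, OF f0 g0] sum_distrib_right)
  also have "\<dots> = (\<Sum>(k, i)\<in>(SIGMA k:{a+b..n}. {a..k-b}).
      fls_nth f i * fls_nth g (k - i) * fls_nth (Z k) n)"
    by (rule sum.Sigma) auto
  also have "\<dots> = (\<Sum>(i, j)\<in>(SIGMA i:{a..n-b}. {b..n-i}).
      fls_nth f i * fls_nth g j * fls_nth (Z (i + j)) n)"
    by (rule sum.reindex_bij_witness[of _ "\<lambda>(i, j). (i + j, i)" "\<lambda>(k, i). (i, k - i)"]) auto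
  also have "\<dots> = (\<Sum>i=a..n-b. \<Sum>j=b..n-i. fls_nth f i * fls_nth g j * fls_nth (Z (i + j)) n)"
    by (rule sum.Sigma[symmetric]) auto
  also have "\<dots> = (\<Sum>i=a..n-b. \<Sum>j=b..n-i. \<Sum>m=i..n-j. ?F i j m)"
  proof (intro sum.cong refl)
    fix i j
    have "fls_nth (Z (i + j)) n = (\<Sum>m=i..n-j. fls_nth (Z i) m * fls_nth (Z j) (n - m))"
      unfolding power_family_D(2)[OF Z]
      by (rule fls_times_nth_bounds) (auto intro: power_family_D(3)[OF Z])
    then show "fls_nth f i * fls_nth g j * fls_nth (Z (i + j)) n = (\<Sum>m=i..n-j. ?F i j m)"
      by (simp add: sum_distrib_left)
  qed
  also have "\<dots> = (\<Sum>(i, j)\<in>(SIGMA i:{a..n-b}. {b..n-i}). \<Sum>m=i..n-j. ?F i j m)"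
    by (rule sum.Sigma) auto
  also have "\<dots> = (\<Sum>((i, j), m)\<in>(SIGMA p:(SIGMA i:{a..n-b}. {b..n-i}). {fst p..n - snd p}). ?F i j m)"
    by (subst sum.Sigma[symmetric]) (auto simp: case_prod_beta)
  also have "\<dots> = (\<Sum>((m, i), j)\<in>(SIGMA p:(SIGMA m:{a..n-b}. {a..m}). {b..n - fst p}). ?F i j m)"
    by (rule sum.reindex_bij_witness[of _ "\<lambda>((m, i), j). ((i, j), m)" "\<lambda>((i, j), m). ((m, i), j)"]) auto
  also have "\<dots> = (\<Sum>(m, i)\<in>(SIGMA m:{a..n-b}. {a..m}). \<Sum>j=b..n-m. ?F i j m)"
    by (subst sum.Sigma[symmetric]) (auto simp: case_prod_beta)
  also have "\<dots> = (\<Sum>m=a..n-b. \<Sum>i=a..m. \<Sum>j=b..n-m. ?F i j m)"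
    by (rule sum.Sigma[symmetric]) auto
  also have "\<dots> = (\<Sum>m=a..n-b. fls_nth (fls_subst Z f) m * fls_nth (fls_subst Z g) (n - m))"
  proof (intro sum.cong refl)
    fix m
    have "?F i j m = fls_nth f i * fls_nth (Z i) m * (fls_nth g j * fls_nth (Z j) (n - m))" for i j
      by (metis mult.assoc power_family_D(4)[OF Z])
    then show "(\<Sum>i=a..m. \<Sum>j=b..n-m. ?F i j m) =
        fls_nth (fls_subst Z f) m * fls_nth (fls_subst Z g) (n - m)"
      by (simp add: fls_subst_nth[of a, OF f0] fls_subst_nth[of b, OF g0] sum_product)
  qed
  also have "\<dots> = fls_nth (fls_subst Z f * fls_subst Z g) n"
    by (rule fls_times_nth_bounds[symmetric, OF sf sg])
  finally show "fls_nth (fls_subst Z (f * g)) n = fls_nth (fls_subst Z f * fls_subst Z g) n" .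
qed

lemma fls_subst_const:
  assumes Z: "power_family Z"
  shows "fls_subst Z (fls_const a) = fls_const a"
proof (rule fls_eqI)
  fix n
  have "fls_nth (fls_subst Z (fls_const a)) n =
      (\<Sum>r=0..n. fls_nth (fls_const a) r * fls_nth (Z r) n)"
    by (rule fls_subst_nth) simp
  also have "\<dots> = (\<Sum>r=0..n. if r = 0 then a * fls_nth 1 n else 0)"
    by (rule sum.cong) (simp_all add: power_family_D(1)[OF Z])
  also have "\<dots> = fls_nth (fls_const a) n"
    by auto
  finally show "fls_nth (fls_subst Z (fls_const a)) n = fls_nth (fls_const a) n" .
qed

lemma ring_map_fls_subst:
  assumes Z: "power_family Z"
  shows "ring_map (fls_subst Z)"
proof -
  have "fls_subst Z (f + g) = fls_subst Z f + fls_subst Z g" for f g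
  proof (rule fls_eqI)
    fix n
    let ?a = "min (fls_subdegree f) (fls_subdegree g)"
    show "fls_nth (fls_subst Z (f + g)) n = fls_nth (fls_subst Z f + fls_subst Z g) n"
      by (subst fls_plus_nth, (subst fls_subst_nth[of ?a], simp)+)
        (simp add: distrib_right sum.distrib)
  qed
  then show ?thesis
    using fls_subst_const[OF Z, of 1] by (simp add: ring_map_def fls_subst_times[OF Z])
qed

lemma fls_subst_X_inv:
  assumes Z: "power_family Z"
  shows "fls_subst Z fls_X_inv = Z (- 1)"
proof (rule fls_eqI)
  fix n
  have "fls_nth (fls_subst Z fls_X_inv) n =
      (\<Sum>r=-1..n. fls_nth fls_X_inv r * fls_nth (Z r) n)"
    by (rule fls_subst_nth) simp
  also have "\<dots> = (\<Sum>r=-1..n. if r = -1 then fls_nth (Z (-1)) n else 0)"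
    by (rule sum.cong) simp_all
  also have "\<dots> = fls_nth (Z (- 1)) n"
    by (auto simp: power_family_D(3)[OF Z])
  finally show "fls_nth (fls_subst Z fls_X_inv) n = fls_nth (Z (- 1)) n" .
qed

text \<open>
  The families in use come from a scalar series, where all integer powers exist, through a homomorphism
  with central image.
\<close>

lemma power_family_powi:
  fixes w :: "'a::field fls"
  assumes h: "ring_map h" and comm: "\<And>c a. h c * a = a * h c" and w: "w \<noteq> 0" "fls_subdegree w = 1"
  shows "power_family (\<lambda>r. fls_map h (w powi r))"
proof -
  note s = ring_map_simps[OF ring_map_fls_map[OF h]] ring_map_simps[OF h]
    fls_map_nth[of h, OF ring_map_simps(1)[OF h]]
  have "fls_nth (w powi r) n = 0" if "n < r" for r n
    using that w by simp
  then show ?thesis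
    using w unfolding power_family_def by (simp add: s power_int_add comm)
qed

section \<open>Matrices modulo an ideal\<close>

text \<open>
  The relations hold modulo ideals of a subring \<open>C\<close>, such as the free algebra on the generators with
  admissible indices, and not of the whole type. Hence the subring is a parameter.
\<close>

definition left_ideal_in :: "'a::ring_1 set \<Rightarrow> 'a set \<Rightarrow> bool"
  where "left_ideal_in C L \<longleftrightarrow> closed_set C \<and> L \<subseteq> C \<and> 0 \<in> L \<and>
    (\<forall>a\<in>L. \<forall>b\<in>L. a + b \<in> L) \<and> (\<forall>c\<in>C. \<forall>a\<in>L. c * a \<in> L)"

definition ideal_in :: "'a::ring_1 set \<Rightarrow> 'a set \<Rightarrow> bool"
  where "ideal_in C J \<longleftrightarrow> left_ideal_in C J \<and> (\<forall>a\<in>J. \<forall>c\<in>C. a * c \<in> J)"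

lemma closed_setD:
  assumes "closed_set C"
  shows "0 \<in> C" "1 \<in> C" "a \<in> C \<Longrightarrow> - a \<in> C" "a \<in> C \<Longrightarrow> b \<in> C \<Longrightarrow> a + b \<in> C"
    "a \<in> C \<Longrightarrow> b \<in> C \<Longrightarrow> a * b \<in> C" "a \<in> C \<Longrightarrow> b \<in> C \<Longrightarrow> a - b \<in> C"
proof -
  show "a \<in> C \<Longrightarrow> b \<in> C \<Longrightarrow> a - b \<in> C"
    using assms unfolding closed_set_def by (metis diff_conv_add_uminus)
qed (use assms in \<open>auto simp: closed_set_def\<close>)

lemma left_ideal_inD:
  assumes "left_ideal_in C L"
  shows "closed_set C" "a \<in> L \<Longrightarrow> a \<in> C" "0 \<in> L" "a \<in> L \<Longrightarrow> b \<in> L \<Longrightarrow> a + b \<in> L"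
    "c \<in> C \<Longrightarrow> a \<in> L \<Longrightarrow> c * a \<in> L" "a \<in> L \<Longrightarrow> - a \<in> L" "a \<in> L \<Longrightarrow> b \<in> L \<Longrightarrow> a - b \<in> L"
proof -
  show add: "a \<in> L \<Longrightarrow> b \<in> L \<Longrightarrow> a + b \<in> L" for a b
    using assms by (auto simp: left_ideal_in_def)
  show "a \<in> L \<Longrightarrow> a \<in> C" "0 \<in> L" "c \<in> C \<Longrightarrow> a \<in> L \<Longrightarrow> c * a \<in> L" "closed_set C"
    using assms by (auto simp: left_ideal_in_def)
  have "- 1 \<in> C"
    using assms by (auto simp: left_ideal_in_def closed_set_def)
  then have "- 1 * a \<in> L" if "a \<in> L" for a
    using assms that unfolding left_ideal_in_def by blast
  then show neg: "a \<in> L \<Longrightarrow> - a \<in> L" for a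
    by simp
  show "a \<in> L \<Longrightarrow> b \<in> L \<Longrightarrow> a - b \<in> L"
    using add[of a "- b"] neg[of b] by simp
qed

lemma ideal_inD:
  assumes "ideal_in C J"
  shows "left_ideal_in C J" "a \<in> J \<Longrightarrow> c \<in> C \<Longrightarrow> a * c \<in> J"
  using assms by (auto simp: ideal_in_def)

lemma left_ideal_sum: "left_ideal_in C L \<Longrightarrow> (\<And>i. i \<in> I \<Longrightarrow> f i \<in> L) \<Longrightarrow> sum f I \<in> L"
  by (induction I rule: infinite_finite_induct) (auto intro: left_ideal_inD)

lemma left_ideal_in_fls_over:
  assumes L: "left_ideal_in C L"
  shows "left_ideal_in (fls_over C) (fls_over L)"
proof -
  have "fls_nth (f * g) r \<in> L" if "f \<in> fls_over C" "g \<in> fls_over L" for f g r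
    unfolding fls_times_nth(2)[of f g r]
    by (rule left_ideal_sum[OF L]) (use that in \<open>auto simp: fls_over_def intro: left_ideal_inD[OF L]\<close>)
  then show ?thesis
    unfolding left_ideal_in_def
    by (auto simp: fls_over_def closed_set_fls_over[OF left_ideal_inD(1)[OF L], unfolded fls_over_def]
      intro: left_ideal_inD[OF L])
qed

lemma ideal_in_fls_over:
  assumes J: "ideal_in C J"
  shows "ideal_in (fls_over C) (fls_over J)"
proof -
  have "fls_nth (f * g) r \<in> J" if "f \<in> fls_over J" "g \<in> fls_over C" for f g r
    unfolding fls_times_nth(2)[of f g r]
    by (rule left_ideal_sum[OF ideal_inD(1)[OF J]])
      (use that in \<open>auto simp: fls_over_def intro: ideal_inD[OF J]\<close>)
  then show ?thesis
    using left_ideal_in_fls_over[OF ideal_inD(1)[OF J]]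
    unfolding ideal_in_def by (auto simp: fls_over_def)
qed

lemma fls_map_over:
  assumes "h 0 = 0" "\<And>a. a \<in> A \<Longrightarrow> h a \<in> B" "f \<in> fls_over A"
  shows "fls_map h f \<in> fls_over B"
  using assms by (simp add: fls_over_def fls_map_nth)

lemma fls_const_over: "0 \<in> A \<Longrightarrow> a \<in> A \<Longrightarrow> fls_const a \<in> fls_over A"
  by (simp add: fls_over_def)

lemma fls_subst_over:
  assumes J: "ideal_in C J" and Z: "\<And>r. Z r \<in> fls_over C" and f: "f \<in> fls_over J"
  shows "fls_subst Z f \<in> fls_over J"
proof -
  have "(\<Sum>r=fls_subdegree f..n. fls_nth f r * fls_nth (Z r) n) \<in> J" for n
    by (rule left_ideal_sum[OF ideal_inD(1)[OF J]])
      (use Z f in \<open>auto simp: fls_over_def intro: ideal_inD[OF J]\<close>)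
  then show ?thesis
    by (simp add: fls_over_def fls_subst_nth[of "fls_subdegree f"])
qed

lemma ideal_in_self: "closed_set C \<Longrightarrow> ideal_in C C"
  by (auto simp: ideal_in_def left_ideal_in_def closed_set_def)

text \<open>
  Membership of the entries in \<open>C\<close> is part of the congruence: an ideal of \<open>C\<close> absorbs only elements of \<open>C\<close>,
  so this is what makes the relation compatible with products. It is reflexive exactly on matrices
  over \<open>C\<close>.
\<close>

definition cong_mtx ::
  "'i set \<Rightarrow> 'a set \<Rightarrow> 'a set \<Rightarrow> ('i, 'a::ring_1) mtx \<Rightarrow> ('i, 'a) mtx \<Rightarrow> bool"
  where "cong_mtx I C J A B \<longleftrightarrow>
    (\<forall>x\<in>I. \<forall>y\<in>I. A x y \<in> C \<and> B x y \<in> C \<and> A x y - B x y \<in> J)"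

lemma cong_mtx_refl:
  "left_ideal_in C J \<Longrightarrow> A \<in> mtx_over I C \<Longrightarrow> cong_mtx I C J A A"
  by (auto simp: cong_mtx_def mtx_over_def left_ideal_inD)

lemma cong_mtx_eqI:
  assumes "left_ideal_in C J" "A \<in> mtx_over I C" "\<And>x y. x \<in> I \<Longrightarrow> y \<in> I \<Longrightarrow> A x y = B x y"
  shows "cong_mtx I C J A B"
  using assms by (auto simp: cong_mtx_def mtx_over_def left_ideal_inD)

lemma cong_mtx_sym: "left_ideal_in C J \<Longrightarrow> cong_mtx I C J A B \<Longrightarrow> cong_mtx I C J B A"
  unfolding cong_mtx_def by (metis left_ideal_inD(6) minus_diff_eq)

lemma cong_mtx_trans:
  assumes "left_ideal_in C J" "cong_mtx I C J A B" "cong_mtx I C J B D"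
  shows "cong_mtx I C J A D"
proof -
  have "A x y - D x y \<in> J" if "x \<in> I" "y \<in> I" for x y
  proof -
    have "(A x y - B x y) + (B x y - D x y) \<in> J"
      using assms that unfolding cong_mtx_def by (blast intro: left_ideal_inD(4))
    then show ?thesis by simp
  qed
  then show ?thesis
    using assms unfolding cong_mtx_def by blast
qed

lemma cong_mtx_mmul:
  assumes J: "ideal_in C J" and A: "cong_mtx I C J A A'" and B: "cong_mtx I C J B B'"
  shows "cong_mtx I C J (mmul I A B) (mmul I A' B')"
proof -
  note L = ideal_inD(1)[OF J] and C = left_ideal_inD(1)[OF ideal_inD(1)[OF J]]
  have "mmul I A B x y - mmul I A' B' x y \<in> J" if xy: "x \<in> I" "y \<in> I" for x y
  proof -
    have "mmul I A B x y - mmul I A' B' x y =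
        (\<Sum>k\<in>I. (A x k - A' x k) * B k y + A' x k * (B k y - B' k y))"
      by (simp add: mmul_def sum_subtractf[symmetric] algebra_simps)
    also have "\<dots> \<in> J"
    proof (intro left_ideal_sum[OF L] left_ideal_inD(4)[OF L])
      fix k assume k: "k \<in> I"
      show "(A x k - A' x k) * B k y \<in> J"
        using A B xy k by (intro ideal_inD(2)[OF J]) (auto simp: cong_mtx_def)
      show "A' x k * (B k y - B' k y) \<in> J"
        using A B xy k by (intro left_ideal_inD(5)[OF L]) (auto simp: cong_mtx_def)
    qed
    finally show ?thesis .
  qed
  moreover have "mmul I A B \<in> mtx_over I C" "mmul I A' B' \<in> mtx_over I C"
    by (rule mmul_over[OF C]; use A B in \<open>simp add: cong_mtx_def mtx_over_def\<close>)+
  ultimately show ?thesis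
    by (auto simp: cong_mtx_def mtx_over_def)
qed

lemma mmul_cong:
  assumes "\<And>x y. x \<in> I \<Longrightarrow> y \<in> I \<Longrightarrow> A x y = A' x y" "\<And>x y. x \<in> I \<Longrightarrow> y \<in> I \<Longrightarrow> B x y = B' x y"
    and "x \<in> I" "y \<in> I"
  shows "mmul I A B x y = mmul I A' B' x y"
  unfolding mmul_def by (intro sum.cong refl arg_cong2[where f="(*)"]) (use assms in auto)

lemma mmul_assoc:
  assumes "finite I"
  shows "mmul I (mmul I A B) D = mmul I A (mmul I B D)"
proof (intro ext)
  fix x y
  have "mmul I (mmul I A B) D x y = (\<Sum>k\<in>I. \<Sum>m\<in>I. A x m * B m k * D k y)"
    by (simp add: mmul_def sum_distrib_right)
  also have "\<dots> = (\<Sum>m\<in>I. \<Sum>k\<in>I. A x m * B m k * D k y)"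
    by (rule sum.swap)
  also have "\<dots> = mmul I A (mmul I B D) x y"
    by (simp add: mmul_def sum_distrib_left mult.assoc)
  finally show "mmul I (mmul I A B) D x y = mmul I A (mmul I B D) x y" .
qed

lemma kron_mone_mmul:
  fixes A B :: "('i, 'a::semiring_1) mtx"
  assumes "finite I" "i \<in> I" "k \<in> I" "j \<in> I" "l \<in> I"
  shows "mmul (I \<times> I) (kron A mone) (kron mone B) (i, k) (j, l) = A i j * B k l"
    and "mmul (I \<times> I) (kron mone B) (kron A mone) (i, k) (j, l) = B k l * A i j"
proof -
  have "mmul (I \<times> I) (kron A mone) (kron mone B) (i, k) (j, l) =
      (\<Sum>a\<in>I. \<Sum>b\<in>I. if b = k then if a = j then A i a * B b l else 0 else 0)"
    unfolding mmul_def sum.cartesian_product' kron_def mone_def by (intro sum.cong) auto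
  then show "mmul (I \<times> I) (kron A mone) (kron mone B) (i, k) (j, l) = A i j * B k l"
    using assms by simp
  have "mmul (I \<times> I) (kron mone B) (kron A mone) (i, k) (j, l) =
      (\<Sum>a\<in>I. \<Sum>b\<in>I. if b = l then if a = i then B k b * A a j else 0 else 0)"
    unfolding mmul_def sum.cartesian_product' kron_def mone_def by (intro sum.cong) auto
  then show "mmul (I \<times> I) (kron mone B) (kron A mone) (i, k) (j, l) = B k l * A i j"
    using assms by simp
qed

lemma kron_mmul_mone:
  fixes A B :: "('i, 'a::semiring_1) mtx"
  assumes "finite I" "i \<in> I" "k \<in> I" "j \<in> I" "l \<in> I"
  shows "mmul (I \<times> I) (kron A mone) (kron B mone) (i, k) (j, l) = kron (mmul I A B) mone (i, k) (j, l)"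
    and "mmul (I \<times> I) (kron mone A) (kron mone B) (i, k) (j, l) = kron mone (mmul I A B) (i, k) (j, l)"
proof -
  have "mmul (I \<times> I) (kron A mone) (kron B mone) (i, k) (j, l) =
      (\<Sum>a\<in>I. \<Sum>b\<in>I. if b = k then if b = l then A i a * B a j else 0 else 0)"
    unfolding mmul_def sum.cartesian_product' kron_def mone_def by (intro sum.cong) auto
  then show "mmul (I \<times> I) (kron A mone) (kron B mone) (i, k) (j, l) = kron (mmul I A B) mone (i, k) (j, l)"
    using assms by (simp add: kron_def mone_def mmul_def)
  have "mmul (I \<times> I) (kron mone A) (kron mone B) (i, k) (j, l) =
      (\<Sum>a\<in>I. if a = i then if a = j then (\<Sum>b\<in>I. A k b * B b l) else 0 else 0)"
    unfolding mmul_def sum.cartesian_product' kron_def mone_def by (intro sum.cong) auto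
  then show "mmul (I \<times> I) (kron mone A) (kron mone B) (i, k) (j, l) = kron mone (mmul I A B) (i, k) (j, l)"
    using assms by (simp add: kron_def mone_def mmul_def)
qed

lemma ring_map_mmul: "ring_map h \<Longrightarrow> h (mmul I A B x y) = mmul I (\<lambda>x y. h (A x y)) (\<lambda>x y. h (B x y)) x y"
  by (simp add: mmul_def ring_map_simps)

lemma ring_map_kron_mone:
  assumes "ring_map h"
  shows "h (kron A mone x y) = kron (\<lambda>x y. h (A x y)) mone x y"
    and "h (kron mone A x y) = kron mone (\<lambda>x y. h (A x y)) x y"
  by (cases x; cases y; simp add: kron_def mone_def ring_map_simps[OF assms])+

text \<open>
  The classical argument that dresses a solution \<open>G\<close> of the reflection equation by a solution of the
  exchange relations. In \<open>R A\<^sub>1 G\<^sub>1 B\<^sub>1 R\<^sub>p A\<^sub>2 G\<^sub>2 B\<^sub>2\<close> the factor \<open>A\<^sub>2\<close> is carried to the left through \<open>R\<^sub>p\<close> and \<open>B\<^sub>1\<close>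
  to the right, which leaves \<open>R A\<^sub>1 A\<^sub>2 (G\<^sub>1 R\<^sub>p G\<^sub>2) B\<^sub>1 B\<^sub>2\<close>; now \<open>R\<close> passes through the three groups in turn,
  and the first moves are undone in reverse.
\<close>

lemma reflection_of_exchange:
  fixes mul :: "'m \<Rightarrow> 'm \<Rightarrow> 'm" (infixl "\<odot>" 70) and eq :: "'m \<Rightarrow> 'm \<Rightarrow> bool" (infix "\<approx>" 50)
  assumes assoc: "\<And>a b c. a \<odot> b \<odot> c = a \<odot> (b \<odot> c)"
    and trans: "\<And>a b c. a \<approx> b \<Longrightarrow> b \<approx> c \<Longrightarrow> a \<approx> c"
    and cong: "\<And>a a' b b'. a \<approx> a' \<Longrightarrow> b \<approx> b' \<Longrightarrow> a \<odot> b \<approx> a' \<odot> b'"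
    and refl: "R \<approx> R" "Rp \<approx> Rp" "A1 \<approx> A1" "A2 \<approx> A2" "B1 \<approx> B1" "B2 \<approx> B2" "G1 \<approx> G1" "G2 \<approx> G2"
    and RAA: "R \<odot> A1 \<odot> A2 \<approx> A2 \<odot> A1 \<odot> R" and RBB: "R \<odot> B1 \<odot> B2 \<approx> B2 \<odot> B1 \<odot> R"
    and BRA: "B1 \<odot> Rp \<odot> A2 \<approx> A2 \<odot> Rp \<odot> B1" and ARB: "A1 \<odot> Rp \<odot> B2 \<approx> B2 \<odot> Rp \<odot> A1"
    and GA: "G1 \<odot> A2 \<approx> A2 \<odot> G1" "A1 \<odot> G2 \<approx> G2 \<odot> A1"
    and GB: "B1 \<odot> G2 \<approx> G2 \<odot> B1" "G1 \<odot> B2 \<approx> B2 \<odot> G1"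
    and RGG: "R \<odot> G1 \<odot> Rp \<odot> G2 \<approx> G2 \<odot> Rp \<odot> G1 \<odot> R"
  shows "R \<odot> (A1 \<odot> G1 \<odot> B1) \<odot> Rp \<odot> (A2 \<odot> G2 \<odot> B2) \<approx> (A2 \<odot> G2 \<odot> B2) \<odot> Rp \<odot> (A1 \<odot> G1 \<odot> B1) \<odot> R"
proof -
  have ctx: "p \<odot> x \<odot> q \<approx> p \<odot> y \<odot> q" if "x \<approx> y" "p \<approx> p" "q \<approx> q" for x y p q
    using that by (intro cong)
  note [trans] = trans
  have "R \<odot> (A1 \<odot> G1 \<odot> B1) \<odot> Rp \<odot> (A2 \<odot> G2 \<odot> B2) \<approx> R \<odot> A1 \<odot> G1 \<odot> (A2 \<odot> Rp \<odot> B1) \<odot> (G2 \<odot> B2)"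
    using ctx[OF BRA, of "R \<odot> A1 \<odot> G1" "G2 \<odot> B2"] by (simp add: assoc cong refl)
  also have "\<dots> \<approx> R \<odot> A1 \<odot> (A2 \<odot> G1) \<odot> (Rp \<odot> B1 \<odot> G2 \<odot> B2)"
    using ctx[OF GA(1), of "R \<odot> A1" "Rp \<odot> B1 \<odot> G2 \<odot> B2"] by (simp add: assoc cong refl)
  also have "\<dots> \<approx> (R \<odot> A1 \<odot> A2 \<odot> G1 \<odot> Rp) \<odot> (G2 \<odot> B1) \<odot> B2"
    using ctx[OF GB(1), of "R \<odot> A1 \<odot> A2 \<odot> G1 \<odot> Rp" B2] by (simp add: assoc cong refl)
  also have "\<dots> \<approx> (A2 \<odot> A1 \<odot> R) \<odot> (G1 \<odot> Rp \<odot> G2 \<odot> B1 \<odot> B2)"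
    using cong[OF RAA, of "G1 \<odot> Rp \<odot> G2 \<odot> B1 \<odot> B2"] by (simp add: assoc cong refl)
  also have "\<dots> \<approx> A2 \<odot> A1 \<odot> (G2 \<odot> Rp \<odot> G1 \<odot> R) \<odot> (B1 \<odot> B2)"
    using ctx[OF RGG, of "A2 \<odot> A1" "B1 \<odot> B2"] by (simp add: assoc cong refl)
  also have "\<dots> \<approx> A2 \<odot> (A1 \<odot> G2) \<odot> (Rp \<odot> G1 \<odot> (B2 \<odot> B1 \<odot> R))"
    using cong[OF _ RBB, of "A2 \<odot> A1 \<odot> G2 \<odot> Rp \<odot> G1" "A2 \<odot> A1 \<odot> G2 \<odot> Rp \<odot> G1"]
    by (simp add: assoc cong refl)
  also have "\<dots> \<approx> A2 \<odot> (G2 \<odot> A1) \<odot> (Rp \<odot> G1 \<odot> (B2 \<odot> B1 \<odot> R))"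
    using ctx[OF GA(2), of A2 "Rp \<odot> G1 \<odot> (B2 \<odot> B1 \<odot> R)"] by (simp add: assoc cong refl)
  also have "\<dots> \<approx> (A2 \<odot> G2 \<odot> A1 \<odot> Rp) \<odot> (B2 \<odot> G1) \<odot> (B1 \<odot> R)"
    using ctx[OF GB(2), of "A2 \<odot> G2 \<odot> A1 \<odot> Rp" "B1 \<odot> R"] by (simp add: assoc cong refl)
  also have "\<dots> \<approx> A2 \<odot> G2 \<odot> (B2 \<odot> Rp \<odot> A1) \<odot> (G1 \<odot> B1 \<odot> R)"
    using ctx[OF ARB, of "A2 \<odot> G2" "G1 \<odot> B1 \<odot> R"] by (simp add: assoc cong refl)
  finally show ?thesis
    by (simp add: assoc)
qed

section \<open>Series in two parameters over the free algebra\<close>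

lemma ring_map_scalar: "ring_map scalar"
  by (simp add: ring_map_def scalar_def single_add mult_single)

lemma poly_mapping_single_induct:
  assumes "P 0" and step: "\<And>f k c. k \<notin> Poly_Mapping.keys f \<Longrightarrow> P f \<Longrightarrow> P (Poly_Mapping.single k c + f)"
  shows "P (f :: 'k \<Rightarrow>\<^sub>0 'c::monoid_add)"
proof (induction f rule: update_induct)
  case (update f k c)
  have "Poly_Mapping.update k c f = Poly_Mapping.single k c + f"
    using update(1)
    by (intro poly_mapping_eqI) (auto simp: lookup_update lookup_add lookup_single when_def in_keys_iff)
  then show ?case
    using step[OF update(1,3)] by simp
qed (rule assms(1))

lemma scalar_commute: "scalar c * f = f * scalar c"
proof (induction f rule: poly_mapping_single_induct)
  case (2 f k d)
  then show ?case by (simp add: scalar_def mult_single mult.commute distrib_left distrib_right)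
qed simp

lemma lift1_eq: "lift1 = fls_map scalar"
  by (intro ext fls_eqI) (simp add: fls_map_nth)

lemma ring_map_lift1: "ring_map lift1"
  unfolding lift1_eq by (intro ring_map_fls_map ring_map_scalar)

lemma lift2_eq: "lift2 = fls_map lift1"
  by (intro ext fls_eqI) (simp add: fls_map_nth ring_map_simps[OF ring_map_lift1])

lemma ring_map_lift2: "ring_map lift2"
  unfolding lift2_eq by (intro ring_map_fls_map ring_map_lift1)

lemma lift1_commute: "lift1 q * f = f * lift1 q"
  by (rule fls_commute) (simp add: scalar_commute)

lemma lift2_commute: "lift2 q * f = f * lift2 q"
  by (rule fls_commute) (simp add: lift1_commute)

text \<open>
  A series in one parameter becomes a series in \<open>u\<close> with constant coefficients by \<open>in_u\<close>, and a series in
  \<open>v\<close> by \<^const>\<open>fls_const\<close>.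
\<close>

abbreviation in_u :: "'a::zero fls \<Rightarrow> 'a fls fls"
  where "in_u \<equiv> fls_map fls_const"

lemma in_u_nth: "fls_nth (in_u f) r = fls_const (fls_nth f r)"
  by (simp add: fls_map_nth)

lemma ring_map_in_u: "ring_map in_u"
  by (intro ring_map_fls_map ring_map_fls_const)

lemma lift1_const: "lift1 (fls_const c) = fls_const (scalar c)"
  by (rule fls_eqI) simp

lemma lift2_in_u: "lift2 (in_u f) = in_u (lift1 f)"
  by (rule fls_eqI) (simp add: in_u_nth lift1_const)

lemma lift2_in_v: "lift2 (fls_const f) = fls_const (lift1 f)"
  by (rule fls_eqI) (simp add: ring_map_simps[OF ring_map_lift1])

text \<open>
  The substitution \<open>u := w\<close> for series in \<open>u\<^sup>-\<^sup>1\<close>; it makes sense when \<open>w\<close> has degree one in \<open>u\<close>, that is,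
  subdegree \<open>- 1\<close> as a Laurent series in \<open>u\<^sup>-\<^sup>1\<close>.
\<close>

definition subst_at :: "complex fls \<Rightarrow> 'g free_alg fls \<Rightarrow> 'g free_alg fls"
  where "subst_at w = fls_subst (\<lambda>r. lift1 (inverse w powi r))"

lemma fls_subdegree_minus_1D:
  assumes "fls_subdegree (w :: complex fls) = - 1"
  shows "w \<noteq> 0" "inverse w \<noteq> 0" "fls_subdegree (inverse w) = 1"
  using assms by auto

lemma power_family_lift1:
  assumes "fls_subdegree w = - 1"
  shows "power_family (\<lambda>r. lift1 (inverse w powi r) :: 'g free_alg fls)"
  unfolding lift1_eq
  by (rule power_family_powi)
    (use fls_subdegree_minus_1D[OF assms] in \<open>simp_all add: ring_map_scalar scalar_commute\<close>)

lemma power_family_in_u: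
  assumes "fls_subdegree w = - 1"
  shows "power_family (\<lambda>r. in_u (lift1 (inverse w powi r)) :: 'g free_alg fls fls)"
proof -
  have "(\<lambda>r. in_u (lift1 (inverse w powi r))) =
      (\<lambda>r. fls_map (\<lambda>c. fls_const (scalar c) :: 'g free_alg fls) (inverse w powi r))"
    by (intro ext fls_eqI) (simp add: fls_map_nth)
  moreover have "fls_const (scalar c) * f = f * fls_const (scalar c)" for c and f :: "'g free_alg fls"
    by (simp add: lift1_const[symmetric] lift1_commute)
  ultimately show ?thesis
    using power_family_powi[of "\<lambda>c. fls_const (scalar c) :: 'g free_alg fls" "inverse w"]
      fls_subdegree_minus_1D[OF assms]
    by (simp add: ring_map_comp[OF ring_map_fls_const ring_map_scalar])
qed

lemma lift1_over: "lift1 f \<in> fls_over (carrier (free_algebra G))"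
  by (simp add: fls_over_def fa_scalar)

text \<open>
  Composition of power series, through which \<^const>\<open>ser_at\<close> is defined, is the restriction of the Laurent
  substitution. This makes \<^const>\<open>ser_at\<close> part of a ring homomorphism, which can be applied to the RTT
  relation as a whole, rational functions of \<open>u\<close> and \<open>v\<close> included.
\<close>

lemma ser_at_eq_subst_at:
  fixes a :: "nat \<Rightarrow> 'g free_alg"
  assumes w: "fls_subdegree w = - 1"
  shows "ser_at w a = subst_at w (fps_to_fls (Abs_fps a))"
proof (rule fls_eqI)
  fix n
  have sub: "fls_nth (subst_at w (fps_to_fls (Abs_fps a))) n =
      (\<Sum>r=0..n. fls_nth (fps_to_fls (Abs_fps a)) r * fls_nth (lift1 (inverse w powi r)) n)"
    unfolding subst_at_def by (rule fls_subst_nth) simp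
  show "fls_nth (ser_at w a) n = fls_nth (subst_at w (fps_to_fls (Abs_fps a))) n"
  proof (cases "n < 0")
    case True
    then show ?thesis unfolding sub by (simp add: ser_at_def)
  next
    case False
    have reg: "fps_to_fls (fls_regpart (lift1 (inverse w))) = (lift1 (inverse w) :: 'g free_alg fls)"
      by (rule fls_eqI) (use w in simp)
    have "fps_nth (fls_regpart (lift1 (inverse w)) ^ i) (nat n) =
        fls_nth (lift1 (inverse w powi int i) :: 'g free_alg fls) n" for i
    proof -
      have pow: "lift1 (x ^ i) = (lift1 x ^ i :: 'g free_alg fls)" for x
        by (induction i) (simp_all only: power_0 power_Suc ring_map_simps[OF ring_map_lift1])
      have "fps_nth (fls_regpart (lift1 (inverse w)) ^ i) (nat n) =
          fls_nth (fps_to_fls (fls_regpart (lift1 (inverse w) :: 'g free_alg fls) ^ i)) n"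
        using False by simp
      also have "\<dots> = fls_nth (lift1 (inverse w) ^ i) n"
        by (simp add: fps_to_fls_power reg)
      finally show ?thesis
        by (simp only: pow power_int_of_nat)
    qed
    then have "fls_nth (ser_at w a) n = (\<Sum>i=0..nat n. a i * fls_nth (lift1 (inverse w powi int i)) n)"
      using False by (simp add: ser_at_def fps_compose_nth)
    also have "\<dots> = (\<Sum>r=0..n. a (nat r) * fls_nth (lift1 (inverse w powi r)) n)"
      by (rule sum.reindex_bij_witness[of _ nat int]) (use False in auto)
    finally show ?thesis
      unfolding sub by simp
  qed
qed

text \<open>
  Simultaneous substitution \<open>u := w\<close>, \<open>v := z\<close>: first in the coefficients, which are series in \<open>v\<^sup>-\<^sup>1\<close>, then
  in the outer variable.
\<close>

definition subst2 :: "complex fls \<Rightarrow> complex fls \<Rightarrow> 'g free_alg fls fls \<Rightarrow> 'g free_alg fls fls"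
  where "subst2 w z f = fls_subst (\<lambda>r. in_u (lift1 (inverse w powi r))) (fls_map (subst_at z) f)"

lemma ring_map_subst_at: "fls_subdegree w = - 1 \<Longrightarrow> ring_map (subst_at w)"
  unfolding subst_at_def by (intro ring_map_fls_subst power_family_lift1)

lemma ring_map_subst2:
  "fls_subdegree w = - 1 \<Longrightarrow> fls_subdegree z = - 1 \<Longrightarrow> ring_map (subst2 w z)"
  unfolding subst2_def
  by (intro ring_map_comp[OF ring_map_fls_subst] ring_map_fls_map ring_map_subst_at power_family_in_u)

lemma subst2_in_v:
  assumes "fls_subdegree w = - 1" "fls_subdegree z = - 1"
  shows "subst2 w z (fls_const f) = fls_const (subst_at z f)"
proof -
  have "fls_map (subst_at z) (fls_const f) = fls_const (subst_at z f)"
    by (rule fls_eqI) (simp add: fls_map_nth ring_map_simps[OF ring_map_subst_at[OF assms(2)]])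
  then show ?thesis
    by (simp add: subst2_def fls_subst_const[OF power_family_in_u[OF assms(1)]])
qed

lemma subst2_in_u:
  fixes f :: "'g free_alg fls"
  assumes "fls_subdegree w = - 1" "fls_subdegree z = - 1"
  shows "subst2 w z (in_u f) = in_u (subst_at w f)"
proof -
  note s = ring_map_simps(1)[OF ring_map_subst_at[OF assms(2)]]
  have const: "subst_at z (fls_const c) = (fls_const c :: 'g free_alg fls)" for c
    by (simp add: subst_at_def fls_subst_const[OF power_family_lift1[OF assms(2)]])
  have "fls_map (subst_at z) (in_u f) = in_u f"
    by (rule fls_eqI)
      (simp only: fls_map_nth s fls_const_0 const)
  moreover have "fls_subst (\<lambda>r. in_u (lift1 (inverse w powi r))) (in_u f) = in_u (subst_at w f)"
  proof (rule fls_eqI)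
    fix n
    let ?a = "fls_subdegree f"
    have "fls_nth (fls_subst (\<lambda>r. in_u (lift1 (inverse w powi r))) (in_u f)) n =
       (\<Sum>r=?a..n. fls_nth (in_u f) r * fls_nth (in_u (lift1 (inverse w powi r))) n)"
      by (rule fls_subst_nth) (simp add: in_u_nth)
    also have "\<dots> = fls_const (\<Sum>r=?a..n. fls_nth f r * fls_nth (lift1 (inverse w powi r)) n)"
      by (simp add: in_u_nth ring_map_simps(7)[OF ring_map_fls_const])
    also have "\<dots> = fls_nth (in_u (subst_at w f)) n"
      by (simp add: in_u_nth subst_at_def fls_subst_nth[of ?a])
    finally show "fls_nth (fls_subst (\<lambda>r. in_u (lift1 (inverse w powi r))) (in_u f)) n =
        fls_nth (in_u (subst_at w f)) n" .
  qed
  ultimately show ?thesis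
    by (simp add: subst2_def)
qed

lemma subst_at_X_inv:
  assumes "fls_subdegree w = - 1"
  shows "subst_at w (lift1 fls_X_inv) = (lift1 w :: 'g free_alg fls)"
proof -
  have "lift1 fls_X_inv = (fls_X_inv :: 'g free_alg fls)"
    by (rule fls_eqI) (simp add: ring_map_simps[OF ring_map_scalar])
  then show ?thesis
    using fls_subst_X_inv[OF power_family_lift1[OF assms]] by (simp add: subst_at_def power_int_minus)
qed

lemma subst2_U_V:
  assumes "fls_subdegree w = - 1" "fls_subdegree z = - 1"
  shows "subst2 w z (lift2 U_ser) = lift2 (in_u w)" "subst2 w z (lift2 V_ser) = lift2 (fls_const z)"
    "subst2 w z (lift2 (const2 c)) = lift2 (const2 c)"
proof -
  have U: "U_ser = in_u fls_X_inv"
    by (rule fls_eqI) (simp add: U_ser_def in_u_nth)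
  show "subst2 w z (lift2 U_ser) = lift2 (in_u w)"
    unfolding U by (simp add: lift2_in_u subst2_in_u[OF assms] subst_at_X_inv[OF assms(1)])
  show "subst2 w z (lift2 V_ser) = lift2 (fls_const z)"
    by (simp add: V_ser_def lift2_in_v subst2_in_v[OF assms] subst_at_X_inv[OF assms(2)])
  show "subst2 w z (lift2 (const2 c)) = lift2 (const2 c)"
    by (simp add: const2_def lift2_in_v lift1_const subst2_in_v[OF assms] subst_at_def
        fls_subst_const[OF power_family_lift1[OF assms(2)]])
qed

text \<open>
  The expansion of \<open>1/q(u, v)\<close> is sent to that of \<open>1/q'\<close> because both are the inverse of \<open>q'\<close> in the same
  ring; no expansion has to be computed.
\<close>

lemma ring_map_inverse_lift2:
  fixes h :: "'g free_alg fls fls \<Rightarrow> 'g free_alg fls fls"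
  assumes h: "ring_map h" and q: "h (lift2 q) = lift2 q'" and "q \<noteq> 0"
  shows "h (lift2 (inverse q)) = lift2 (inverse q')"
proof -
  have "lift2 q * lift2 (inverse q) = (1 :: 'g free_alg fls fls)"
    using \<open>q \<noteq> 0\<close> by (simp add: ring_map_simps[OF ring_map_lift2, symmetric])
  then have "h (lift2 q * lift2 (inverse q)) = 1"
    using ring_map_simps[OF h] by simp
  then have inv: "lift2 q' * h (lift2 (inverse q)) = 1"
    by (simp add: ring_map_simps[OF h] q)
  then have "q' \<noteq> 0"
    by (auto simp: ring_map_simps[OF ring_map_lift2])
  then have "lift2 (inverse q') * lift2 q' = (1 :: 'g free_alg fls fls)"
    by (simp add: ring_map_simps[OF ring_map_lift2, symmetric])
  then have "h (lift2 (inverse q)) = lift2 (inverse q') * (lift2 q' * h (lift2 (inverse q)))"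
    by (simp add: mult.assoc[symmetric])
  then show ?thesis
    by (simp add: inv)
qed

lemma U_minus_V_nonzero:
  "U_ser - V_ser \<noteq> 0" "U_ser - V_ser - const2 c \<noteq> 0" "U_ser + V_ser - const2 c \<noteq> 0"
  "U_ser + V_ser \<noteq> 0"
proof -
  have "fls_nth (U_ser - V_ser) (- 1) = 1" "fls_nth (U_ser - V_ser - const2 c) (- 1) = 1"
    "fls_nth (U_ser + V_ser - const2 c) (- 1) = 1" "fls_nth (U_ser + V_ser) (- 1) = 1"
    by (simp_all add: U_ser_def V_ser_def const2_def)
  then show "U_ser - V_ser \<noteq> 0" "U_ser - V_ser - const2 c \<noteq> 0" "U_ser + V_ser - const2 c \<noteq> 0"
    "U_ser + V_ser \<noteq> 0"
    by force+
qed

section \<open>The R-matrix in coordinates\<close>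

lemma finite_idx [simp]: "finite (idx ty n)"
  by (simp add: idx_def)

lemma uminus_in_idx [simp]: "- i \<in> idx ty n \<longleftrightarrow> i \<in> idx ty n"
  by (auto simp: idx_def)

lemma sum_idx_uminus: "(\<Sum>a\<in>idx ty n. f (- a)) = (\<Sum>a\<in>idx ty n. f a)"
  by (rule sum.reindex_bij_witness[of _ uminus uminus]) auto

text \<open>
  The factorization \<open>\<theta>\<^sub>i\<^sub>j = \<epsilon>\<^sub>i \<epsilon>\<^sub>j\<close>. The number \<open>sign_flip\<close> is the \<open>\<epsilon>\<close> with \<open>\<epsilon>\<^sub>-\<^sub>i = \<epsilon> \<epsilon>\<^sub>i\<close>, equivalently
  \<open>P Q = Q P = \<epsilon> Q\<close>.
\<close>

definition sign_of :: "pair_type \<Rightarrow> int \<Rightarrow> 'a::ring_1"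
  where "sign_of ty i = (if symplectic ty then of_int (sgn i) else 1)"

definition sign_flip :: "pair_type \<Rightarrow> 'a::ring_1"
  where "sign_flip ty = (if symplectic ty then - 1 else 1)"

lemma of_int_theta: "of_int (theta ty i j) = (sign_of ty i * sign_of ty j :: 'a::ring_1)"
  by (simp add: theta_def sign_of_def)

lemma sign_of_uminus: "sign_of ty (- i) = sign_flip ty * sign_of ty i"
  by (simp add: sign_of_def sign_flip_def sgn_if)

lemma sign_flip_flip: "sign_flip ty * sign_flip ty = 1" "sign_flip ty * (sign_flip ty * x) = x"
  by (simp_all add: sign_flip_def)

lemma sign_flip_commute: "x * sign_flip ty = sign_flip ty * x" "x * (sign_flip ty * y) = sign_flip ty * (x * y)"
  by (simp_all add: sign_flip_def)

lemma sign_of_sq: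
  assumes "i \<in> idx ty n"
  shows "sign_of ty i * sign_of ty i = 1" "sign_of ty i * (sign_of ty i * x) = x"
proof -
  have "symplectic ty \<Longrightarrow> i \<noteq> 0"
    using assms by (auto simp: idx_def symplectic_def odd_N_def)
  then show "sign_of ty i * sign_of ty i = 1" "sign_of ty i * (sign_of ty i * x) = x"
    by (auto simp: sign_of_def sgn_if)
qed

lemma sign_of_commute: "x * sign_of ty i = sign_of ty i * x" "x * (sign_of ty i * y) = sign_of ty i * (x * y)"
  by (simp_all add: sign_of_def sgn_if)

lemma ring_map_sign_of: "ring_map h \<Longrightarrow> h (sign_of ty i) = sign_of ty i"
  by (simp add: sign_of_def sgn_if ring_map_simps)

text \<open>
  The matrix \<open>I - s P + t Q\<close>. With free coefficients it covers \<open>R(x)\<close> over the field of scalars, its image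
  over the free algebra, and the partial transposes of both.
\<close>

definition R_of :: "pair_type \<Rightarrow> 'a \<Rightarrow> 'a \<Rightarrow> (int \<times> int, 'a::ring_1) mtx"
  where "R_of ty s t = (\<lambda>(i, k) (j, l). (if i = j \<and> k = l then 1 else 0)
    - s * (if i = l \<and> k = j then 1 else 0)
    + t * (if k = - i \<and> l = - j then sign_of ty i * sign_of ty j else 0))"

lemma ring_map_R_of:
  assumes "ring_map h"
  shows "h (R_of ty s t x y) = R_of ty (h s) (h t) x y"
proof -
  obtain i k j l where xy: "x = (i, k)" "y = (j, l)" by (cases x; cases y)
  have if01: "h (if b then c else 0) = (if b then h c else 0)" for b c
    by (simp add: ring_map_simps(1)[OF assms])
  show ?thesis
    by (simp only: xy R_of_def prod.case if01 ring_map_simps(1-6)[OF assms] ring_map_sign_of[OF assms])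
qed

lemma perm_P_eq:
  assumes "finite I" "i \<in> I" "k \<in> I" "j \<in> I" "l \<in> I"
  shows "perm_P I (i, k) (j, l) = (if i = l \<and> k = j then 1 else 0)"
proof -
  have "perm_P I (i, k) (j, l) =
      (\<Sum>a\<in>I. \<Sum>b\<in>I. if b = j then if a = i then (if i = l \<and> k = j then 1 else 0) else 0 else 0)"
    unfolding perm_P_def kron_def munit_def by (intro sum.cong) auto
  then show ?thesis
    using assms by simp
qed

lemma R_mat_eq:
  assumes "x \<in> idx ty n \<times> idx ty n" "y \<in> idx ty n \<times> idx ty n"
  shows "R_mat ty n z x y = R_of ty (inverse z) (inverse (z - const2 (kappa ty n))) x y"
proof -
  obtain i k j l where xy: "x = (i, k)" "y = (j, l)" by (cases x; cases y)
  let ?I = "idx ty n"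
  have P: "(perm_P ?I x y :: complex fls fls) = (if i = l \<and> k = j then 1 else 0)"
    using assms by (simp add: xy perm_P_eq)
  have "Q_mat ty n x y = (\<Sum>a\<in>?I. \<Sum>b\<in>?I. if b = j then if a = i then
      (if k = - i \<and> l = - j then of_int (theta ty i j) else 0) else 0 else 0)"
    unfolding Q_mat_def xy kron_def munit_def by (intro sum.cong) auto
  then have Q: "Q_mat ty n x y = (if k = - i \<and> l = - j then sign_of ty i * sign_of ty j else 0)"
    using assms xy by (simp add: of_int_theta)
  show ?thesis
    unfolding R_mat_def P Q by (simp add: xy R_of_def mone_def divide_inverse mult.commute)
qed

lemma R_of_mmul:
  assumes "i \<in> idx ty n" "k \<in> idx ty n"
  shows "mmul (idx ty n \<times> idx ty n) (R_of ty s t) M (i, k) y =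
    M (i, k) y - s * M (k, i) y
    + (if k = - i then t * (\<Sum>a\<in>idx ty n. sign_of ty i * sign_of ty a * M (a, - a) y) else 0)"
proof -
  let ?I = "idx ty n"
  have "mmul (?I \<times> ?I) (R_of ty s t) M (i, k) y =
    (\<Sum>a\<in>?I. \<Sum>b\<in>?I. (if b = k then if a = i then M (a, b) y else 0 else 0)
      - s * (if b = i then if a = k then M (a, b) y else 0 else 0)
      + t * (if b = - a then if k = - i then sign_of ty i * sign_of ty a * M (a, b) y else 0 else 0))"
    unfolding mmul_def sum.cartesian_product' R_of_def
    by (intro sum.cong) (auto simp: algebra_simps)
  also have "\<dots> = M (i, k) y - s * M (k, i) y
    + (if k = - i then t * (\<Sum>a\<in>?I. sign_of ty i * sign_of ty a * M (a, - a) y) else 0)"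
    using assms by (simp add: sum.distrib sum_subtractf sum_distrib_left[symmetric])
  finally show ?thesis .
qed

lemma mmul_R_of:
  assumes "j \<in> idx ty n" "l \<in> idx ty n"
  shows "mmul (idx ty n \<times> idx ty n) M (R_of ty s t) x (j, l) =
    M x (j, l) - M x (l, j) * s
    + (if l = - j then (\<Sum>a\<in>idx ty n. M x (a, - a) * t * (sign_of ty a * sign_of ty j)) else 0)"
proof -
  let ?I = "idx ty n"
  have "mmul (?I \<times> ?I) M (R_of ty s t) x (j, l) =
    (\<Sum>a\<in>?I. \<Sum>b\<in>?I. (if b = l then if a = j then M x (a, b) else 0 else 0)
      - (if b = j then if a = l then M x (a, b) * s else 0 else 0)
      + (if b = - a then if l = - j then M x (a, b) * t * (sign_of ty a * sign_of ty j) else 0 else 0))"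
    unfolding mmul_def sum.cartesian_product' R_of_def
    by (intro sum.cong) (auto simp: algebra_simps)
  also have "\<dots> = M x (j, l) - M x (l, j) * s
    + (if l = - j then (\<Sum>a\<in>?I. M x (a, - a) * t * (sign_of ty a * sign_of ty j)) else 0)"
    using assms by (simp add: sum.distrib sum_subtractf)
  finally show ?thesis .
qed

lemma kron_R_of_kron:
  assumes "i \<in> idx ty n" "k \<in> idx ty n" "j \<in> idx ty n" "l \<in> idx ty n"
  defines "I \<equiv> idx ty n"
  shows "mmul (I \<times> I) (mmul (I \<times> I) (kron A mone) (R_of ty s t)) (kron mone B) (i, k) (j, l) =
      A i j * B k l - (if j = k then (\<Sum>a\<in>I. A i a * s * B a l) else 0)
      + A i (- k) * t * (sign_of ty (- k) * sign_of ty j) * B (- j) l"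
    and "mmul (I \<times> I) (mmul (I \<times> I) (kron mone B) (R_of ty s t)) (kron A mone) (i, k) (j, l) =
      B k l * A i j - (if i = l then (\<Sum>a\<in>I. B k a * s * A a j) else 0)
      + B k (- i) * t * (sign_of ty i * sign_of ty (- l)) * A (- l) j"
proof -
  have R: "mmul (I \<times> I) (kron A mone) (R_of ty s t) (i, k) (j, b) =
      (if k = b then A i j else 0) - (if k = j then A i b * s else 0)
      + (if b = - j then A i (- k) * t * (sign_of ty (- k) * sign_of ty j) else 0)" if "b \<in> I" for b
  proof -
    have "(\<Sum>a\<in>I. kron A mone (i, k) (a, - a) * t * (sign_of ty a * sign_of ty j)) =
       (\<Sum>a\<in>I. if a = - k then A i (- k) * t * (sign_of ty (- k) * sign_of ty j) else 0)"
      by (rule sum.cong) (auto simp: kron_def mone_def)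
    then show ?thesis
      using assms that by (auto simp: I_def mmul_R_of[of j ty n b] kron_def mone_def)
  qed
  have "mmul (I \<times> I) (mmul (I \<times> I) (kron A mone) (R_of ty s t)) (kron mone B) (i, k) (j, l) =
     (\<Sum>a\<in>I. \<Sum>b\<in>I. if a = j then mmul (I \<times> I) (kron A mone) (R_of ty s t) (i, k) (j, b) * B b l else 0)"
    unfolding mmul_def[of "I \<times> I" "mmul _ _ _"] sum.cartesian_product'
    by (intro sum.cong) (auto simp: kron_def mone_def)
  also have "\<dots> = (\<Sum>a\<in>I. if a = j then (\<Sum>b\<in>I.
      (if b = k then A i j * B b l else 0) - (if k = j then A i b * s * B b l else 0)
      + (if b = - j then A i (- k) * t * (sign_of ty (- k) * sign_of ty j) * B b l else 0)) else 0)"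
    by (intro sum.cong refl) (auto simp: R algebra_simps intro!: sum.cong)
  also have "\<dots> = A i j * B k l - (if j = k then (\<Sum>a\<in>I. A i a * s * B a l) else 0)
      + A i (- k) * t * (sign_of ty (- k) * sign_of ty j) * B (- j) l"
    using assms by (auto simp: sum.distrib sum_subtractf)
  finally show "mmul (I \<times> I) (mmul (I \<times> I) (kron A mone) (R_of ty s t)) (kron mone B) (i, k) (j, l) =
      A i j * B k l - (if j = k then (\<Sum>a\<in>I. A i a * s * B a l) else 0)
      + A i (- k) * t * (sign_of ty (- k) * sign_of ty j) * B (- j) l" .
  have R: "mmul (I \<times> I) (kron mone B) (R_of ty s t) (i, k) (a, l) =
      (if i = a then B k l else 0) - (if i = l then B k a * s else 0)
      + (if a = - l then B k (- i) * t * (sign_of ty i * sign_of ty (- l)) else 0)" if "a \<in> I" for a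
  proof -
    have "(\<Sum>c\<in>I. kron mone B (i, k) (c, - c) * t * (sign_of ty c * sign_of ty a)) =
       (\<Sum>c\<in>I. if c = i then B k (- i) * t * (sign_of ty i * sign_of ty a) else 0)"
      by (rule sum.cong) (auto simp: kron_def mone_def)
    then show ?thesis
      using assms that by (auto simp: I_def mmul_R_of[of a ty n l] kron_def mone_def)
  qed
  have "mmul (I \<times> I) (mmul (I \<times> I) (kron mone B) (R_of ty s t)) (kron A mone) (i, k) (j, l) =
     (\<Sum>a\<in>I. \<Sum>b\<in>I. if b = l then mmul (I \<times> I) (kron mone B) (R_of ty s t) (i, k) (a, l) * A a j else 0)"
    unfolding mmul_def[of "I \<times> I" "mmul _ _ _"] sum.cartesian_product'
    by (intro sum.cong) (auto simp: kron_def mone_def)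
  also have "\<dots> = (\<Sum>a\<in>I.
      (if a = i then B k l * A a j else 0) - (if i = l then B k a * s * A a j else 0)
      + (if a = - l then B k (- i) * t * (sign_of ty i * sign_of ty (- l)) * A a j else 0))"
    using \<open>l \<in> idx ty n\<close>
    by (intro sum.cong refl) (simp add: R algebra_simps finite_idx[of ty n, folded I_def] I_def[symmetric])
  also have "\<dots> = B k l * A i j - (if i = l then (\<Sum>a\<in>I. B k a * s * A a j) else 0)
      + B k (- i) * t * (sign_of ty i * sign_of ty (- l)) * A (- l) j"
    using assms by (auto simp: sum.distrib sum_subtractf)
  finally show "mmul (I \<times> I) (mmul (I \<times> I) (kron mone B) (R_of ty s t)) (kron A mone) (i, k) (j, l) =
      B k l * A i j - (if i = l then (\<Sum>a\<in>I. B k a * s * A a j) else 0)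
      + B k (- i) * t * (sign_of ty i * sign_of ty (- l)) * A (- l) j" .
qed

section \<open>The RTT relation at shifted arguments\<close>

lemma ideal_in_genideal:
  assumes "Rels \<subseteq> carrier (free_algebra G)"
  shows "ideal_in (carrier (free_algebra G)) (genideal (free_algebra G) Rels)"
proof -
  interpret ideal "genideal (free_algebra G) Rels" "free_algebra G"
    by (rule ring.genideal_ideal[OF free_algebra_ring assms])
  show ?thesis
    using fa_closed_set I_l_closed I_r_closed
      additive_subgroup.a_closed[OF is_additive_subgroup] additive_subgroup.zero_closed[OF is_additive_subgroup]
    by (auto simp: ideal_in_def left_ideal_in_def fa_sel Icarr)
qed

definition X_ideal :: "pair_type \<Rightarrow> nat \<Rightarrow> yindex free_alg set"
  where "X_ideal ty n = genideal (free_algebra (X_gens ty n)) (X_rels ty n)"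

abbreviation X_car :: "pair_type \<Rightarrow> nat \<Rightarrow> yindex free_alg set"
  where "X_car ty n \<equiv> carrier (free_algebra (X_gens ty n))"

abbreviation X_car2 :: "pair_type \<Rightarrow> nat \<Rightarrow> yindex free_alg fls fls set"
  where "X_car2 ty n \<equiv> fls_over (fls_over (X_car ty n))"

abbreviation X_ideal2 :: "pair_type \<Rightarrow> nat \<Rightarrow> yindex free_alg fls fls set"
  where "X_ideal2 ty n \<equiv> fls_over (fls_over (X_ideal ty n))"

abbreviation idx2 :: "pair_type \<Rightarrow> nat \<Rightarrow> (int \<times> int) set"
  where "idx2 ty n \<equiv> idx ty n \<times> idx ty n"

lemma X_ideal: "ideal_in (X_car ty n) (X_ideal ty n)"
  unfolding X_ideal_def by (rule ideal_in_genideal[OF X_rels_carrier])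

lemma X_ideal2: "ideal_in (X_car2 ty n) (X_ideal2 ty n)"
  by (intro ideal_in_fls_over X_ideal)

lemma X_left_ideal2: "left_ideal_in (X_car2 ty n) (X_ideal2 ty n)"
  by (rule ideal_inD[OF X_ideal2])

lemma X_car2_closed: "closed_set (X_car2 ty n)"
  by (intro closed_set_fls_over fa_closed_set)

definition R_at :: "pair_type \<Rightarrow> nat \<Rightarrow> complex fls fls \<Rightarrow> (int \<times> int, 'g free_alg fls fls) mtx"
  where "R_at ty n x = R_of ty (lift2 (inverse x)) (lift2 (inverse (x - const2 (kappa ty n))))"

lemma sign_of_over: "closed_set C \<Longrightarrow> sign_of ty i \<in> C"
  by (auto simp: sign_of_def sgn_if closed_set_def)

lemma R_of_over: "closed_set C \<Longrightarrow> s \<in> C \<Longrightarrow> t \<in> C \<Longrightarrow> R_of ty s t \<in> mtx_over I C"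
  by (auto simp: R_of_def mtx_over_def sign_of_over closed_setD
      intro!: closed_setD(4)[of C] closed_setD(5)[of C] closed_setD(6)[of C])

lemma R_at_over: "R_at ty n x \<in> mtx_over I (X_car2 ty n)"
  unfolding R_at_def by (intro R_of_over X_car2_closed lift2_over)

lemma ser_at_over:
  assumes w: "fls_subdegree w = - 1" and a: "\<And>r. a r \<in> carrier (free_algebra G)"
  shows "ser_at w a \<in> fls_over (carrier (free_algebra G))"
  unfolding ser_at_eq_subst_at[OF w] subst_at_def
  by (rule fls_subst_over[OF ideal_in_self[OF fa_closed_set] lift1_over])
    (use a fa_scalar[of 0 G] in \<open>auto simp: fls_over_def\<close>)

lemma t_gen_over: "i \<in> idx ty n \<Longrightarrow> j \<in> idx ty n \<Longrightarrow> t_gen i j r \<in> X_car ty n"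
  by (auto simp: t_gen_def X_gens_def intro: gen_over)

lemma T_at_over: "fls_subdegree w = - 1 \<Longrightarrow> T_at w \<in> mtx_over (idx ty n) (fls_over (X_car ty n))"
  by (auto simp: mtx_over_def T_at_def intro!: ser_at_over t_gen_over)

lemma Tt_at_eq:
  assumes "i \<in> idx ty n" "j \<in> idx ty n"
  shows "Tt_at ty n w i j = sign_of ty i * sign_of ty j * T_at w (- j) (- i)"
proof -
  have "Tt_at ty n w i j = (\<Sum>a\<in>idx ty n. \<Sum>b\<in>idx ty n.
      if b = - i then if a = - j then of_int (theta ty a b) * ser_at w (t_gen a b) else 0 else 0)"
    unfolding Tt_at_def munit_def by (intro sum.cong) auto
  also have "\<dots> = of_int (theta ty (- j) (- i)) * ser_at w (t_gen (- j) (- i))"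
    using assms by simp
  also have "theta ty (- j) (- i) = theta ty i j"
    by (simp add: theta_def mult.commute)
  finally show ?thesis
    by (simp add: of_int_theta T_at_def)
qed

lemma Tt_at_over: "fls_subdegree w = - 1 \<Longrightarrow> Tt_at ty n w \<in> mtx_over (idx ty n) (fls_over (X_car ty n))"
  using T_at_over[of w ty n] closed_set_fls_over[OF fa_closed_set]
  by (auto simp: mtx_over_def Tt_at_eq intro!: closed_setD(5) sign_of_over)

abbreviation at_u :: "(int, 'a::zero fls) mtx \<Rightarrow> (int, 'a fls fls) mtx"
  where "at_u A \<equiv> (\<lambda>i j. in_u (A i j))"

abbreviation at_v :: "(int, 'a::zero fls) mtx \<Rightarrow> (int, 'a fls fls) mtx"
  where "at_v A \<equiv> (\<lambda>i j. fls_const (A i j))"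

lemma in_u_over: "closed_set C \<Longrightarrow> f \<in> fls_over C \<Longrightarrow> in_u f \<in> fls_over (fls_over C)"
  by (rule fls_map_over[of _ C]) (auto intro: fls_const_over closed_setD(1))

lemma kron_at_over:
  assumes "closed_set C" "A \<in> mtx_over I (fls_over C)"
  shows "kron (at_u A) mone \<in> mtx_over (I \<times> I) (fls_over (fls_over C))"
    "kron mone (at_v A) \<in> mtx_over (I \<times> I) (fls_over (fls_over C))"
proof -
  have "at_u A \<in> mtx_over I (fls_over (fls_over C))" "at_v A \<in> mtx_over I (fls_over (fls_over C))"
    using assms closed_setD(1)[OF closed_set_fls_over[OF assms(1)]]
    by (auto simp: mtx_over_def intro: in_u_over fls_const_over)
  then show "kron (at_u A) mone \<in> mtx_over (I \<times> I) (fls_over (fls_over C))"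
    "kron mone (at_v A) \<in> mtx_over (I \<times> I) (fls_over (fls_over C))"
    by (auto intro!: kron_over mone_over closed_set_fls_over assms(1))
qed

text \<open>
  The homomorphism \<^const>\<open>subst2\<close> preserves the series with coefficients in the ideal of relations, and it
  sends the two sides of the defining relation to the two sides below.
\<close>

lemma RTT_at:
  fixes w z :: "complex fls" and ty :: pair_type and n :: nat
  assumes w: "fls_subdegree w = - 1" and z: "fls_subdegree z = - 1"
  defines "A1 \<equiv> kron (at_u (T_at w)) mone" and "A2 \<equiv> kron mone (at_v (T_at z))"
    and "R \<equiv> R_at ty n (in_u w - fls_const z)"
  shows "cong_mtx (idx2 ty n) (X_car2 ty n) (X_ideal2 ty n)
    (mmul (idx2 ty n) R (mmul (idx2 ty n) A1 A2)) (mmul (idx2 ty n) (mmul (idx2 ty n) A2 A1) R)"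
proof -
  let ?I = "idx2 ty n" and ?h = "subst2 w z :: yindex free_alg fls fls \<Rightarrow> _"
  let ?R = "\<lambda>x y. lift2 (R_mat ty n (U_ser - V_ser) x y) :: yindex free_alg fls fls"
  let ?T1 = "kron (\<lambda>i j. ser_U (t_gen i j)) mone" and ?T2 = "kron mone (\<lambda>i j. ser_V (t_gen i j))"
  note h = ring_map_subst2[OF w z]
  have rel: "mmul ?I (mmul ?I ?R ?T1) ?T2 x y - mmul ?I (mmul ?I ?T2 ?T1) ?R x y \<in> X_ideal2 ty n"
    if "x \<in> ?I" "y \<in> ?I" for x y
  proof -
    have "X_rels ty n \<subseteq> X_ideal ty n"
      unfolding X_ideal_def by (rule ring.genideal_self[OF free_algebra_ring X_rels_carrier])
    moreover have "fls_nth (fls_nth (mmul ?I (mmul ?I ?R ?T1) ?T2 x y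
        - mmul ?I (mmul ?I ?T2 ?T1) ?R x y) r) s \<in> X_rels ty n" for r s
      using that unfolding X_rels_def Let_def coeff_relators_def by blast
    ultimately show ?thesis
      by (auto simp: fls_over_def)
  qed
  have h_over: "?h f \<in> X_ideal2 ty n" if "f \<in> X_ideal2 ty n" for f
    unfolding subst2_def
  proof (rule fls_subst_over[OF ideal_in_fls_over[OF X_ideal]])
    show "in_u (lift1 (inverse w powi r)) \<in> X_car2 ty n" for r
      by (rule in_u_over[OF fa_closed_set lift1_over])
    show "fls_map (subst_at z) f \<in> X_ideal2 ty n"
    proof (rule fls_map_over[of _ "fls_over (X_ideal ty n)"])
      show "subst_at z g \<in> fls_over (X_ideal ty n)" if "g \<in> fls_over (X_ideal ty n)" for g
        unfolding subst_at_def by (rule fls_subst_over[OF X_ideal lift1_over that])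
    qed (use that in \<open>simp_all add: ring_map_simps(1)[OF ring_map_subst_at[OF z]]\<close>)
  qed
  have hR: "?h (?R x y) = R x y" if "x \<in> ?I" "y \<in> ?I" for x y
  proof -
    have hs: "?h (lift2 (U_ser - V_ser)) = lift2 (in_u w - fls_const z)"
      "?h (lift2 (U_ser - V_ser - const2 c)) = lift2 (in_u w - fls_const z - const2 c)" for c
      by (simp_all add: ring_map_simps(6)[OF ring_map_lift2] ring_map_simps(6)[OF h] subst2_U_V[OF w z])
    show ?thesis
      unfolding R_def R_at_def R_mat_eq[OF that] ring_map_R_of[OF ring_map_lift2] ring_map_R_of[OF h]
      by (simp only: ring_map_inverse_lift2[OF h hs(1) U_minus_V_nonzero(1)]
          ring_map_inverse_lift2[OF h hs(2) U_minus_V_nonzero(2)])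
  qed
  have ser: "ser_U a = in_u (fps_to_fls (Abs_fps a))" "ser_V a = fls_const (fps_to_fls (Abs_fps a))"
    for a :: "nat \<Rightarrow> yindex free_alg"
    by (auto simp: ser_U_def ser_V_def in_u_nth intro!: fls_eqI)
  have hT: "?h (?T1 x y) = A1 x y" "?h (?T2 x y) = A2 x y" for x y
    unfolding A1_def A2_def ring_map_kron_mone[OF h]
    by (simp_all add: ser subst2_in_u[OF w z] subst2_in_v[OF w z] T_at_def
        ser_at_eq_subst_at[OF w] ser_at_eq_subst_at[OF z])
  have L: "?h (mmul ?I (mmul ?I ?R ?T1) ?T2 x y) = mmul ?I R (mmul ?I A1 A2) x y"
    and M: "?h (mmul ?I (mmul ?I ?T2 ?T1) ?R x y) = mmul ?I (mmul ?I A2 A1) R x y"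
    if "x \<in> ?I" "y \<in> ?I" for x y
  proof -
    have "mmul ?I (\<lambda>x y. ?h (?R x y)) A x y = mmul ?I R A x y"
      and "mmul ?I A (\<lambda>x y. ?h (?R x y)) x y = mmul ?I A R x y"
      if "x \<in> ?I" "y \<in> ?I" for A x y
      by (rule mmul_cong; use that hR in auto)+
    note R = this[OF that]
    show "?h (mmul ?I (mmul ?I ?R ?T1) ?T2 x y) = mmul ?I R (mmul ?I A1 A2) x y"
      by (simp add: mmul_assoc ring_map_mmul[OF h] hT R)
    show "?h (mmul ?I (mmul ?I ?T2 ?T1) ?R x y) = mmul ?I (mmul ?I A2 A1) R x y"
      by (simp add: ring_map_mmul[OF h] hT R)
  qed
  have "A1 \<in> mtx_over ?I (X_car2 ty n)" "A2 \<in> mtx_over ?I (X_car2 ty n)" "R \<in> mtx_over ?I (X_car2 ty n)"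
    unfolding A1_def A2_def R_def
    by (intro kron_at_over fa_closed_set T_at_over w z R_at_over)+
  then have "mmul ?I R (mmul ?I A1 A2) \<in> mtx_over ?I (X_car2 ty n)"
    "mmul ?I (mmul ?I A2 A1) R \<in> mtx_over ?I (X_car2 ty n)"
    by (simp_all add: mmul_over X_car2_closed)
  moreover have "mmul ?I R (mmul ?I A1 A2) x y - mmul ?I (mmul ?I A2 A1) R x y \<in> X_ideal2 ty n"
    if "x \<in> ?I" "y \<in> ?I" for x y
    using h_over[OF rel[OF that]] by (simp add: ring_map_simps(6)[OF h] L[OF that] M[OF that])
  ultimately show ?thesis
    by (auto simp: cong_mtx_def mtx_over_def)
qed

section \<open>Unitarity and the exchange relations for the transposed matrix\<close>

lemma card_idx: "card (idx ty n) = dim_N ty n"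
proof -
  have "card {- int n..int n} = 2 * n + 1"
    by simp
  moreover have "card ({- int n..int n} - {0}) = 2 * n"
    by (subst card_Diff_singleton) auto
  ultimately show ?thesis
    by (simp add: idx_def dim_N_def)
qed

lemma of_nat_card_idx:
  "(of_nat (card (idx ty n)) :: complex fls fls) = 2 * const2 (kappa ty n) + 2 * sign_flip ty"
proof -
  have "fls_const (fls_const (of_nat m)) = (of_nat m :: complex fls fls)" for m
    by (simp add: fls_of_nat)
  moreover have "of_nat (card (idx ty n)) = 2 * kappa ty n + 2 * sign_flip ty"
    by (simp add: card_idx kappa_def sign_flip_def field_simps)
  ultimately have "(of_nat (card (idx ty n)) :: complex fls fls) =
      fls_const (fls_const (2 * kappa ty n + 2 * sign_flip ty))"
    by metis
  also have "\<dots> = 2 * const2 (kappa ty n) + 2 * sign_flip ty"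
    by (simp add: const2_def sign_flip_def fls_plus_const[symmetric] fls_const_mult_const[symmetric]
        del: fls_const_mult_const)
  finally show ?thesis .
qed

text \<open>
  Here \<open>P\<^sup>2 = I\<close>, \<open>P Q = Q P = \<epsilon> Q\<close> and \<open>Q\<^sup>2 = N Q\<close>, so that \<open>(I - s P + t Q)(I + s P + t' Q)\<close> is
  \<open>(1 - s\<^sup>2) I\<close> plus a multiple of \<open>Q\<close>; the assumption says that this multiple vanishes.
\<close>

lemma R_of_unitary:
  fixes s t t' :: "'a::comm_ring_1"
  assumes idx: "i \<in> idx ty n" "k \<in> idx ty n" "j \<in> idx ty n" "l \<in> idx ty n"
    and Q: "t' + t + sign_flip ty * s * t - sign_flip ty * s * t' + of_nat (card (idx ty n)) * t * t' = 0"
  shows "mmul (idx2 ty n) (R_of ty s t) (R_of ty (- s) t') (i, k) (j, l) =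
    (if i = j \<and> k = l then 1 - s * s else 0)"
proof -
  let ?I = "idx ty n"
  have "(\<Sum>a\<in>?I. sign_of ty i * sign_of ty a * R_of ty (- s) t' (a, - a) (j, l)) =
    (\<Sum>a\<in>?I. (if a = j then if l = - j then sign_of ty i * sign_of ty j else 0 else 0)
      + (if a = l then if l = - j then s * (sign_of ty i * sign_of ty (- j)) else 0 else 0)
      + (if l = - j then t' * (sign_of ty i * sign_of ty j) else 0))"
  proof (intro sum.cong refl)
    fix a assume a: "a \<in> ?I"
    have "sign_of ty i * sign_of ty a * (t' * (sign_of ty a * sign_of ty j)) = t' * (sign_of ty i * sign_of ty j)"
      by (simp add: mult_ac sign_of_sq[OF a])
    then show "sign_of ty i * sign_of ty a * R_of ty (- s) t' (a, - a) (j, l) =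
      (if a = j then if l = - j then sign_of ty i * sign_of ty j else 0 else 0)
      + (if a = l then if l = - j then s * (sign_of ty i * sign_of ty (- j)) else 0 else 0)
      + (if l = - j then t' * (sign_of ty i * sign_of ty j) else 0)"
      by (auto simp: R_of_def algebra_simps)
  qed
  also have "\<dots> = (if l = - j then (1 + s * sign_flip ty + of_nat (card ?I) * t') * (sign_of ty i * sign_of ty j) else 0)"
    using idx by (auto simp: sum.distrib sign_of_uminus algebra_simps)
  finally have T: "(\<Sum>a\<in>?I. sign_of ty i * sign_of ty a * R_of ty (- s) t' (a, - a) (j, l)) = \<dots>" .
  define ee :: 'a where "ee = sign_of ty i * sign_of ty j"
  have "t * ((1 + s * sign_flip ty + of_nat (card ?I) * t') * ee) + (t' * ee - s * (t' * (sign_flip ty * ee))) =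
     (t' + t + sign_flip ty * s * t - sign_flip ty * s * t' + of_nat (card (idx ty n)) * t * t') * ee"
    by (simp add: algebra_simps)
  then have key: "t * ((1 + s * sign_flip ty + of_nat (card ?I) * t') * ee)
      + (t' * ee - s * (t' * (sign_flip ty * ee))) = 0"
    unfolding Q by simp
  have "R_of ty (- s) t' (i, k) (j, l) - s * R_of ty (- s) t' (k, i) (j, l) =
    (if i = j \<and> k = l then 1 - s * s else 0)
    + (if k = - i \<and> l = - j then t' * ee - s * (t' * (sign_flip ty * ee)) else 0)"
  proof -
    have "k = - i \<Longrightarrow> sign_of ty k * sign_of ty j = sign_flip ty * ee"
      by (simp add: ee_def sign_of_uminus mult.assoc)
    moreover have "i = - k \<longleftrightarrow> k = - i" "k = j \<and> i = l \<longleftrightarrow> i = l \<and> k = j"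
      "k = l \<and> i = j \<longleftrightarrow> i = j \<and> k = l"
      by auto
    ultimately show ?thesis
      by (simp add: R_of_def ee_def[symmetric] right_diff_distrib distrib_left)
  qed
  then show ?thesis
    unfolding R_of_mmul[OF idx(1,2)] T ee_def[symmetric] using key
    by (auto simp: algebra_simps)
qed

text \<open>
  The coefficient of \<open>Q\<close> in \<open>R(x) R(-x)\<close>: it vanishes for \<open>N = 2 \<kappa> + 2 \<epsilon>\<close>, which is the reason for the value
  of \<open>\<kappa>\<close>.
\<close>

lemma unitarity_identity:
  fixes x k f s t t' :: "'a::idom"
  assumes "s * x = 1" "t * (x - k) = 1" "t' * (- x - k) = 1"
  shows "x * ((x - k) * (- x - k)) * (t' + t + f * s * t - f * s * t' + (2 * k + 2 * f) * t * t') = 0"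
proof -
  have "x * (a * b) * (t' + t + f * s * t - f * s * t' + (2 * k + 2 * f) * t * t') =
      x * a * (t' * b) + x * b * (t * a) + f * (s * x) * (t * a) * b - f * (s * x) * (t' * b) * a
      + (2 * k + 2 * f) * x * (t * a) * (t' * b)" for a b
    by (simp add: algebra_simps)
  note expand = this[of "x - k" "- x - k"]
  show ?thesis
    unfolding expand assms by (simp add: algebra_simps)
qed

lemma R_at_unitary:
  assumes xy: "p \<in> idx2 ty n" "q \<in> idx2 ty n"
    and x: "x \<noteq> 0" "x - const2 (kappa ty n) \<noteq> 0" "x + const2 (kappa ty n) \<noteq> 0"
  shows "mmul (idx2 ty n) (R_at ty n x) (R_at ty n (- x)) p q =
    (lift2 (1 - inverse x * inverse x) * mone p q :: 'g free_alg fls fls)"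
proof -
  let ?k = "const2 (kappa ty n)" and ?f = "sign_flip ty :: complex fls fls"
  let ?s = "inverse x" and ?t = "inverse (x - ?k)" and ?t' = "inverse (- x - ?k)"
  have x': "- x - ?k \<noteq> 0"
    using x(3) by (metis add.inverse_inverse add_uminus_conv_diff minus_add_distrib neg_equal_0_iff_equal)
  have t: "?t * (x - ?k) = 1" and t': "?t' * (- x - ?k) = 1" and s: "?s * x = 1"
    using x x' by auto
  have "?t' + ?t + ?f * ?s * ?t - ?f * ?s * ?t' + (2 * ?k + 2 * ?f) * ?t * ?t' = 0"
  proof -
    have "x * ((x - ?k) * (- x - ?k)) *
        (?t' + ?t + ?f * ?s * ?t - ?f * ?s * ?t' + (2 * ?k + 2 * ?f) * ?t * ?t') = 0"
      by (rule unitarity_identity[OF s t t'])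
    then show ?thesis
      using x x' by simp
  qed
  then have Q: "?t' + ?t + ?f * ?s * ?t - ?f * ?s * ?t' + of_nat (card (idx ty n)) * ?t * ?t' = 0"
    unfolding of_nat_card_idx .
  obtain i k j l where pq: "p = (i, k)" "q = (j, l)" by (cases p; cases q)
  have "mmul (idx2 ty n) (R_of ty ?s ?t) (R_of ty (- ?s) ?t') p q =
      (1 - inverse x * inverse x) * mone p q"
    using R_of_unitary[OF _ _ _ _ Q, of i k j l] xy by (simp add: pq mone_def)
  then have "lift2 (mmul (idx2 ty n) (R_of ty ?s ?t) (R_of ty (- ?s) ?t') p q) =
      (lift2 ((1 - inverse x * inverse x) * mone p q) :: 'g free_alg fls fls)"
    by simp
  moreover have m: "lift2 (mone p q) = (mone p q :: 'g free_alg fls fls)"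
    by (simp add: mone_def ring_map_simps(1,2)[OF ring_map_lift2])
  ultimately show ?thesis
    unfolding R_at_def ring_map_mmul[OF ring_map_lift2] ring_map_R_of[OF ring_map_lift2]
    by (simp only: ring_map_simps(4)[OF ring_map_lift2] m inverse_minus_eq)
qed

text \<open>
  Transposition of a tensor factor exchanges \<open>P\<close> and \<open>Q\<close>, hence turns \<open>I - s P + t Q\<close> into \<open>I + t P - s Q\<close>,
  which for \<open>R(x)\<close> is \<open>R(\<kappa> - x)\<close>; transposing both factors fixes \<open>P\<close> and \<open>Q\<close>. The transposed matrix product
  keeps the order of the algebra elements. Therefore the first factor alone is transposed in the RTT
  relation, whereas the second factor alone, or both, are transposed in the relation with \<open>T\<^sub>1\<close> and \<open>T\<^sub>2\<close>
  interchanged. Entry by entry, the difference of the two sides of the new relation is, up to a sign, an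
  entry of the difference for the old one.
\<close>

context
  fixes X Y :: "(int, 'a::ring_1) mtx" and s t :: 'a and ty :: pair_type and n :: nat and i k j l :: int
  assumes idx: "i \<in> idx ty n" "k \<in> idx ty n" "j \<in> idx ty n" "l \<in> idx ty n"
    and s: "\<And>q. q * s = s * q" and t: "\<And>q. q * t = t * q"
begin

private abbreviation (input) "I \<equiv> idx ty n"
private abbreviation (input) "J \<equiv> idx2 ty n"
private abbreviation (input) "e \<equiv> (sign_of ty :: int \<Rightarrow> 'a)"

private lemma commute:
  "X a b * s = s * X a b" "X a b * (s * q) = s * (X a b * q)"
  "Y a b * s = s * Y a b" "Y a b * (s * q) = s * (Y a b * q)"
  "X a b * t = t * X a b" "X a b * (t * q) = t * (X a b * q)"
  "Y a b * t = t * Y a b" "Y a b * (t * q) = t * (Y a b * q)"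
  "s * e i * q = e i * (s * q)"
  by (simp_all add: s t mult.assoc[symmetric])

private lemmas pull = sign_of_commute[of "X a b" ty for a b] sign_of_commute[of "Y a b" ty for a b]
  sign_of_commute[of s ty] sign_of_commute[of t ty] sign_of_commute[of "sign_of ty a" ty for a]
  sign_flip_commute[of "X a b" ty for a b] sign_flip_commute[of "Y a b" ty for a b]
  sign_flip_commute[of s ty] sign_flip_commute[of t ty] sign_flip_commute[of "sign_of ty a" ty for a]
  commute sign_flip_flip mult.assoc sign_of_uminus idx sign_of_sq[OF idx(1)] sign_of_sq[OF idx(2)]
  sign_of_sq[OF idx(3)] sign_of_sq[OF idx(4)]

lemma transpose_mixed:
  assumes B: "\<And>a c. a \<in> I \<Longrightarrow> c \<in> I \<Longrightarrow> B a c = e a * e c * X (- c) (- a)"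
  shows "mmul J (mmul J (kron B mone) (R_of ty (- t) (- s))) (kron mone Y) (i, k) (j, l)
      - mmul J (mmul J (kron mone Y) (R_of ty (- t) (- s))) (kron B mone) (i, k) (j, l)
    = e i * e j *
      (mmul J (R_of ty s t) (mmul J (kron X mone) (kron mone Y)) (- j, k) (- i, l)
      - mmul J (mmul J (kron mone Y) (kron X mone)) (R_of ty s t) (- j, k) (- i, l))"
proof -
  have sum1: "(\<Sum>a\<in>I. B i a * (- t) * Y a l) =
      - (e i * (e j * (t * (\<Sum>a\<in>I. e (- j) * e a * (X a (- i) * Y (- a) l)))))"
    by (subst sum_idx_uminus[symmetric])
      (simp add: sum_distrib_left B pull sum_negf cong: sum.cong)
  have sum2: "(\<Sum>a\<in>I. Y k a * (- t) * B a j) =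
      - (e i * (e j * (\<Sum>a\<in>I. Y k (- a) * X (- j) a * t * (e a * e (- i)))))"
    by (subst sum_idx_uminus[symmetric])
      (simp add: sum_distrib_left B pull sum_negf cong: sum.cong)
  show ?thesis
    unfolding kron_R_of_kron[OF idx] sum1 sum2
    by (simp add: R_of_mmul mmul_R_of kron_mone_mmul idx B)
      (simp add: pull right_diff_distrib distrib_left)
qed

lemma transpose_swapped:
  assumes B: "\<And>a c. a \<in> I \<Longrightarrow> c \<in> I \<Longrightarrow> B a c = e a * e c * Y (- c) (- a)"
  shows "mmul J (mmul J (kron X mone) (R_of ty (- t) (- s))) (kron mone B) (i, k) (j, l)
      - mmul J (mmul J (kron mone B) (R_of ty (- t) (- s))) (kron X mone) (i, k) (j, l)
    = - (e k * e l *
      (mmul J (R_of ty s t) (mmul J (kron mone Y) (kron X mone)) (i, - l) (j, - k)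
      - mmul J (mmul J (kron X mone) (kron mone Y)) (R_of ty s t) (i, - l) (j, - k)))"
proof -
  have sum1: "(\<Sum>a\<in>I. X i a * (- t) * B a l) =
      - (e k * (e l * (\<Sum>a\<in>I. X i a * Y (- l) (- a) * t * (e a * e k))))"
    by (simp add: sum_distrib_left B pull sum_negf cong: sum.cong)
  have sum2: "(\<Sum>a\<in>I. B k a * (- t) * X a j) =
      - (e k * (e l * (t * (\<Sum>a\<in>I. e l * e a * (Y (- a) (- k) * X a j)))))"
    by (simp add: sum_distrib_left B pull sum_negf cong: sum.cong)
  show ?thesis
    unfolding kron_R_of_kron[OF idx] sum1 sum2
    by (simp add: R_of_mmul mmul_R_of kron_mone_mmul idx B)
      (simp add: pull right_diff_distrib distrib_left)
qed

lemma transpose_both: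
  assumes B: "\<And>a c. a \<in> I \<Longrightarrow> c \<in> I \<Longrightarrow> B a c = e a * e c * X (- c) (- a)"
    and D: "\<And>a c. a \<in> I \<Longrightarrow> c \<in> I \<Longrightarrow> D a c = e a * e c * Y (- c) (- a)"
  shows "mmul J (R_of ty s t) (mmul J (kron B mone) (kron mone D)) (i, k) (j, l)
      - mmul J (mmul J (kron mone D) (kron B mone)) (R_of ty s t) (i, k) (j, l)
    = - (e i * e j * (e k * e l *
      (mmul J (R_of ty s t) (mmul J (kron mone Y) (kron X mone)) (- j, - l) (- i, - k)
      - mmul J (mmul J (kron X mone) (kron mone Y)) (R_of ty s t) (- j, - l) (- i, - k))))"
proof -
  have sq: "a \<in> I \<Longrightarrow> e a * e a = 1" "a \<in> I \<Longrightarrow> e a * (e a * q) = q" for a q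
    by (simp_all add: sign_of_sq)
  define P1 where "P1 = t * (\<Sum>a\<in>I. e i * e a * (B a j * D (- a) l))"
  define P2 where "P2 = (\<Sum>a\<in>I. D k (- a) * B i a * t * (e a * e j))"
  define P3 where "P3 = t * (\<Sum>a\<in>I. e (- j) * e a * (Y (- a) (- k) * X a (- i)))"
  define P4 where "P4 = (\<Sum>a\<in>I. X (- j) a * Y (- l) (- a) * t * (e a * e (- i)))"
  have sum1: "P1 = e i * (e j * (e k * (e l * P4)))" if "k = - i"
    unfolding that P1_def P4_def
    by (subst sum_idx_uminus[symmetric]) (simp add: sum_distrib_left B D pull sq cong: sum.cong)
  have sum2: "P2 = e i * (e j * (e k * (e l * P3)))" if "l = - j"
    unfolding that P2_def P3_def
    by (subst sum_idx_uminus[symmetric]) (simp add: sum_distrib_left B D pull sq cong: sum.cong)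
  have expand: "mmul J (R_of ty s t) (mmul J (kron B mone) (kron mone D)) (i, k) (j, l) =
      B i j * D k l - s * (B k j * D i l) + (if k = - i then P1 else 0)"
    "mmul J (mmul J (kron mone D) (kron B mone)) (R_of ty s t) (i, k) (j, l) =
      D k l * B i j - D k j * B i l * s + (if l = - j then P2 else 0)"
    "mmul J (R_of ty s t) (mmul J (kron mone Y) (kron X mone)) (- j, - l) (- i, - k) =
      Y (- l) (- k) * X (- j) (- i) - s * (Y (- j) (- k) * X (- l) (- i)) + (if l = - j then P3 else 0)"
    "mmul J (mmul J (kron X mone) (kron mone Y)) (R_of ty s t) (- j, - l) (- i, - k) =
      X (- j) (- i) * Y (- l) (- k) - X (- j) (- k) * Y (- l) (- i) * s + (if k = - i then P4 else 0)"
    using idx by (auto simp: P1_def P2_def P3_def P4_def R_of_mmul mmul_R_of kron_mone_mmul)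
  show ?thesis
    unfolding expand
    by (cases "k = - i"; cases "l = - j")
      (simp_all add: sum1 sum2 pull right_diff_distrib distrib_left B D)
qed

end

lemma cong_mtx_entry:
  assumes "left_ideal_in C L" "A \<in> mtx_over I C" "B \<in> mtx_over I C"
    "\<And>p q. p \<in> I \<Longrightarrow> q \<in> I \<Longrightarrow> A p q - B p q \<in> L"
  shows "cong_mtx I C L A B"
  using assms by (auto simp: cong_mtx_def mtx_over_def)

text \<open>
  The leading coefficient in \<open>u\<close> is that of \<open>w\<close>.
\<close>

lemma parameter_difference_nonzero:
  assumes w: "fls_subdegree w = - 1"
  shows "in_u w - fls_const z + const2 c \<noteq> 0"
proof
  assume "in_u w - fls_const z + const2 c = 0"
  then have "fls_nth (in_u w - fls_const z + const2 c) (- 1) = 0"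
    by simp
  then have "fls_nth w (- 1) = 0"
    by (simp add: in_u_nth const2_def)
  then show False
    using w nth_fls_subdegree_nonzero[of w] by force
qed

text \<open>
  The RTT relation is multiplied by \<open>R(-x)\<close> from both sides. By unitarity \<open>R(x) R(-x)\<close> is the scalar
  \<open>\<nu> = 1 - x\<^sup>-\<^sup>2\<close>, which is then cancelled. Exchanging the names of \<open>u\<close> and \<open>v\<close> would not do, since the two
  parameters are not on the same footing in the expansion of \<open>1/(u - v)\<close>.
\<close>

lemma RTT_swapped:
  fixes w z :: "complex fls" and ty :: pair_type and n :: nat
  assumes w: "fls_subdegree w = - 1" and z: "fls_subdegree z = - 1"
  defines "A1 \<equiv> kron (at_u (T_at w)) mone" and "A2 \<equiv> kron mone (at_v (T_at z))"
    and "R \<equiv> R_at ty n (- (in_u w - fls_const z))"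
  shows "cong_mtx (idx2 ty n) (X_car2 ty n) (X_ideal2 ty n)
    (mmul (idx2 ty n) R (mmul (idx2 ty n) A2 A1)) (mmul (idx2 ty n) (mmul (idx2 ty n) A1 A2) R)"
proof -
  define x where "x = in_u w - fls_const z"
  let ?I = "idx2 ty n" and ?R' = "R_at ty n x :: (int \<times> int, yindex free_alg fls fls) mtx"
  let ?C = "X_car2 ty n" and ?J = "X_ideal2 ty n"
  define \<nu> where "\<nu> = 1 - inverse x * inverse x"
  have R: "R = R_at ty n (- x)"
    by (simp add: R_def x_def)
  have nz: "x + const2 c \<noteq> 0" for c
    unfolding x_def by (rule parameter_difference_nonzero[OF w])
  have const2: "const2 0 = 0" "const2 (- c) = - const2 c" "const2 1 = 1" for c
    by (simp_all add: const2_def)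
  have x: "x \<noteq> 0" "x - const2 (kappa ty n) \<noteq> 0" "x + const2 (kappa ty n) \<noteq> 0"
    using nz[of 0] nz[of "- kappa ty n"] nz[of "kappa ty n"] by (simp_all add: const2)
  have x1: "x - 1 \<noteq> 0" "x + 1 \<noteq> 0"
    using nz[of "- 1"] nz[of 1] by (simp_all add: const2)
  \<comment> \<open>Cancelling \<open>\<nu>\<close> at the end requires \<open>x \<noteq> 1\<close> and \<open>x \<noteq> - 1\<close>.\<close>
  have "\<nu> \<noteq> 0"
  proof
    assume "\<nu> = 0"
    then have "(x - 1) * (x + 1) = 0"
      using x(1) by (simp add: \<nu>_def field_simps)
    with x1 show False by simp
  qed
  have x': "- x \<noteq> 0" "- x - const2 (kappa ty n) \<noteq> 0" "- x + const2 (kappa ty n) \<noteq> 0"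
  proof -
    have "- x - c = - (x + c)" "- x + c = - (x - c)" for c
      by simp_all
    then show "- x \<noteq> 0" "- x - const2 (kappa ty n) \<noteq> 0" "- x + const2 (kappa ty n) \<noteq> 0"
      using x by (simp_all only: neg_equal_0_iff_equal not_False_eq_True)
  qed
  have A: "A1 \<in> mtx_over ?I ?C" "A2 \<in> mtx_over ?I ?C"
    unfolding A1_def A2_def by (intro kron_at_over fa_closed_set T_at_over w z)+
  have Rc: "cong_mtx ?I ?C ?J R R"
    unfolding R by (intro cong_mtx_refl X_left_ideal2 R_at_over)
  have RR: "mmul ?I R (mmul ?I ?R' N) p q = lift2 \<nu> * N p q"
    and RR': "mmul ?I N (mmul ?I ?R' R) p q = lift2 \<nu> * N p q" if "p \<in> ?I" "q \<in> ?I" for N p q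
  proof -
    have u: "mmul ?I R ?R' p q = lift2 \<nu> * mone p q" if "p \<in> ?I" "q \<in> ?I" for p q
      using R_at_unitary[OF that x'] by (simp add: R \<nu>_def inverse_minus_eq)
    have u': "mmul ?I ?R' R p q = lift2 \<nu> * mone p q" if "p \<in> ?I" "q \<in> ?I" for p q
      using R_at_unitary[OF that x] by (simp add: R \<nu>_def)
    have "mmul ?I R (mmul ?I ?R' N) p q = (\<Sum>m\<in>?I. if m = p then lift2 \<nu> * N m q else 0)"
      unfolding mmul_assoc[OF finite_cartesian_product[OF finite_idx finite_idx], symmetric]
      unfolding mmul_def[of _ "mmul _ _ _"] by (rule sum.cong) (use that in \<open>auto simp: u mone_def\<close>)
    then show "mmul ?I R (mmul ?I ?R' N) p q = lift2 \<nu> * N p q"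
      using that by simp
    have "mmul ?I N (mmul ?I ?R' R) p q = (\<Sum>m\<in>?I. if m = q then N p m * lift2 \<nu> else 0)"
      unfolding mmul_def[of _ N] by (rule sum.cong) (use that in \<open>auto simp: u' mone_def\<close>)
    then show "mmul ?I N (mmul ?I ?R' R) p q = lift2 \<nu> * N p q"
      using that by (simp add: lift2_commute)
  qed
  have "cong_mtx ?I ?C ?J (mmul ?I R (mmul ?I (mmul ?I ?R' (mmul ?I A1 A2)) R))
      (mmul ?I R (mmul ?I (mmul ?I (mmul ?I A2 A1) ?R') R))"
    unfolding A1_def A2_def x_def
    by (rule cong_mtx_mmul[OF X_ideal2 Rc cong_mtx_mmul[OF X_ideal2 RTT_at[OF w z] Rc]])
  then have "cong_mtx ?I ?C ?J (mmul ?I R (mmul ?I ?R' (mmul ?I (mmul ?I A1 A2) R)))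
      (mmul ?I (mmul ?I R (mmul ?I A2 A1)) (mmul ?I ?R' R))"
    by (simp add: mmul_assoc)
  then have main: "lift2 \<nu> * mmul ?I (mmul ?I A1 A2) R p q
      - lift2 \<nu> * mmul ?I R (mmul ?I A2 A1) p q \<in> ?J" if "p \<in> ?I" "q \<in> ?I" for p q
    using that by (auto simp: cong_mtx_def RR RR')
  have "mmul ?I (mmul ?I A1 A2) R p q - mmul ?I R (mmul ?I A2 A1) p q \<in> ?J"
    if "p \<in> ?I" "q \<in> ?I" for p q
  proof -
    have "lift2 (inverse \<nu>) * lift2 \<nu> = (1 :: yindex free_alg fls fls)"
      using \<open>\<nu> \<noteq> 0\<close> by (simp add: ring_map_simps(2,4)[OF ring_map_lift2, symmetric])
    then have "lift2 (inverse \<nu>) * (lift2 \<nu> * f) = f" for f :: "yindex free_alg fls fls"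
      by (simp add: mult.assoc[symmetric])
    then show ?thesis
      using left_ideal_inD(5)[OF X_left_ideal2 lift2_over main[OF that], of "inverse \<nu>"]
      by (simp add: right_diff_distrib)
  qed
  then have "cong_mtx ?I ?C ?J (mmul ?I (mmul ?I A1 A2) R) (mmul ?I R (mmul ?I A2 A1))"
    by (intro cong_mtx_entry X_left_ideal2 mmul_over X_car2_closed A) (simp_all add: R R_at_over)
  then show ?thesis
    by (rule cong_mtx_sym[OF X_left_ideal2])
qed

lemma sign_times_in_left_ideal:
  "left_ideal_in C L \<Longrightarrow> a \<in> L \<Longrightarrow> sign_of ty i * a \<in> L"
  by (intro left_ideal_inD(5) sign_of_over left_ideal_inD(1))

lemma in_u_Tt_at:
  assumes "a \<in> idx ty n" "c \<in> idx ty n"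
  shows "in_u (Tt_at ty n w a c) = sign_of ty a * sign_of ty c * in_u (T_at w (- c) (- a))"
    and "fls_const (Tt_at ty n w a c) = sign_of ty a * sign_of ty c * fls_const (T_at w (- c) (- a))"
  unfolding Tt_at_eq[OF assms]
  by (simp_all add: ring_map_simps(4)[OF ring_map_in_u] ring_map_simps(4)[OF ring_map_fls_const]
      ring_map_sign_of[OF ring_map_in_u] ring_map_sign_of[OF ring_map_fls_const]
      del: fls_const_mult_const)

context
  fixes ty :: pair_type and n :: nat and w z :: "complex fls"
  assumes w: "fls_subdegree w = - 1" and z: "fls_subdegree z = - 1"
begin

private abbreviation "M \<equiv> mmul (idx2 ty n)"
private abbreviation "eqv \<equiv> cong_mtx (idx2 ty n) (X_car2 ty n) (X_ideal2 ty n)"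

private lemma over:
  "kron (at_u (T_at w)) mone \<in> mtx_over (idx2 ty n) (X_car2 ty n)"
  "kron mone (at_v (T_at z)) \<in> mtx_over (idx2 ty n) (X_car2 ty n)"
  "kron (at_u (Tt_at ty n w)) mone \<in> mtx_over (idx2 ty n) (X_car2 ty n)"
  "kron mone (at_v (Tt_at ty n z)) \<in> mtx_over (idx2 ty n) (X_car2 ty n)"
  by (intro kron_at_over fa_closed_set T_at_over Tt_at_over w z)+

lemma T_exchange:
  "eqv (M (M (R_at ty n (in_u w - fls_const z)) (kron (at_u (T_at w)) mone)) (kron mone (at_v (T_at z))))
    (M (M (kron mone (at_v (T_at z))) (kron (at_u (T_at w)) mone)) (R_at ty n (in_u w - fls_const z)))"
  using RTT_at[OF w z] by (simp add: mmul_assoc)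

lemma Tt_T_exchange:
  assumes x: "x = const2 (kappa ty n) - (in_u w - fls_const z)"
  shows "eqv (M (M (kron (at_u (Tt_at ty n w)) mone) (R_at ty n x)) (kron mone (at_v (T_at z))))
    (M (M (kron mone (at_v (T_at z))) (R_at ty n x)) (kron (at_u (Tt_at ty n w)) mone))"
proof (rule cong_mtx_entry[OF X_left_ideal2])
  fix p q assume "p \<in> idx2 ty n" "q \<in> idx2 ty n"
  then obtain i k j l where pq: "p = (i, k)" "q = (j, l)"
    and idx: "i \<in> idx ty n" "k \<in> idx ty n" "j \<in> idx ty n" "l \<in> idx ty n"
    by auto
  let ?y = "in_u w - fls_const z"
  have s: "lift2 (inverse x) = - lift2 (inverse (?y - const2 (kappa ty n)))"
    "lift2 (inverse (x - const2 (kappa ty n))) = - lift2 (inverse ?y)"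
    unfolding x ring_map_simps(5)[OF ring_map_lift2, symmetric] inverse_minus_eq[symmetric]
    by (simp_all add: algebra_simps)
  show "M (M (kron (at_u (Tt_at ty n w)) mone) (R_at ty n x)) (kron mone (at_v (T_at z))) p q
      - M (M (kron mone (at_v (T_at z))) (R_at ty n x)) (kron (at_u (Tt_at ty n w)) mone) p q
      \<in> X_ideal2 ty n"
    unfolding pq R_at_def s
    by (subst transpose_mixed[OF idx, where X="at_u (T_at w)"])
      (use RTT_at[OF w z, of ty n] idx in \<open>auto simp: in_u_Tt_at lift2_commute cong_mtx_def R_at_def mult.assoc
        intro!: sign_times_in_left_ideal[OF X_left_ideal2]\<close>)
qed (intro mmul_over X_car2_closed over R_at_over)+

lemma T_Tt_exchange:
  assumes x: "x = const2 (kappa ty n) + (in_u w - fls_const z)"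
  shows "eqv (M (M (kron (at_u (T_at w)) mone) (R_at ty n x)) (kron mone (at_v (Tt_at ty n z))))
    (M (M (kron mone (at_v (Tt_at ty n z))) (R_at ty n x)) (kron (at_u (T_at w)) mone))"
proof (rule cong_mtx_entry[OF X_left_ideal2])
  fix p q assume "p \<in> idx2 ty n" "q \<in> idx2 ty n"
  then obtain i k j l where pq: "p = (i, k)" "q = (j, l)"
    and idx: "i \<in> idx ty n" "k \<in> idx ty n" "j \<in> idx ty n" "l \<in> idx ty n"
    by auto
  let ?y = "- (in_u w - fls_const z)"
  have s: "lift2 (inverse x) = - lift2 (inverse (?y - const2 (kappa ty n)))"
    "lift2 (inverse (x - const2 (kappa ty n))) = - lift2 (inverse ?y)"
    unfolding x ring_map_simps(5)[OF ring_map_lift2, symmetric] inverse_minus_eq[symmetric]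
    by (simp_all add: algebra_simps)
  show "M (M (kron (at_u (T_at w)) mone) (R_at ty n x)) (kron mone (at_v (Tt_at ty n z))) p q
      - M (M (kron mone (at_v (Tt_at ty n z))) (R_at ty n x)) (kron (at_u (T_at w)) mone) p q
      \<in> X_ideal2 ty n"
    unfolding pq R_at_def s
    by (subst transpose_swapped[OF idx, where Y="at_v (T_at z)"])
      (use RTT_swapped[OF w z, of ty] idx in \<open>auto simp: in_u_Tt_at lift2_commute cong_mtx_def R_at_def mult.assoc
        intro!: sign_times_in_left_ideal[OF X_left_ideal2] left_ideal_inD(6)[OF X_left_ideal2]\<close>)
qed (intro mmul_over X_car2_closed over R_at_over)+

lemma Tt_exchange:
  assumes x: "x = - (in_u w - fls_const z)"
  shows "eqv (M (R_at ty n x) (M (kron (at_u (Tt_at ty n w)) mone) (kron mone (at_v (Tt_at ty n z)))))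
    (M (M (kron mone (at_v (Tt_at ty n z))) (kron (at_u (Tt_at ty n w)) mone)) (R_at ty n x))"
proof (rule cong_mtx_entry[OF X_left_ideal2])
  fix p q assume "p \<in> idx2 ty n" "q \<in> idx2 ty n"
  then obtain i k j l where pq: "p = (i, k)" "q = (j, l)"
    and idx: "i \<in> idx ty n" "k \<in> idx ty n" "j \<in> idx ty n" "l \<in> idx ty n"
    by auto
  show "M (R_at ty n x) (M (kron (at_u (Tt_at ty n w)) mone) (kron mone (at_v (Tt_at ty n z)))) p q
      - M (M (kron mone (at_v (Tt_at ty n z))) (kron (at_u (Tt_at ty n w)) mone)) (R_at ty n x) p q
      \<in> X_ideal2 ty n"
    unfolding pq R_at_def
    by (subst transpose_both[OF idx, where X="at_u (T_at w)" and Y="at_v (T_at z)"])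
      (use RTT_swapped[OF w z, of ty] idx in \<open>auto simp: in_u_Tt_at lift2_commute cong_mtx_def R_at_def x mult.assoc
        intro!: sign_times_in_left_ideal[OF X_left_ideal2] left_ideal_inD(6)[OF X_left_ideal2]\<close>)
qed (intro mmul_over X_car2_closed over R_at_over)+

end

section \<open>The diagonal solution of the reflection equation\<close>

text \<open>
  Both sides are expanded into multiples of \<open>I\<close>, \<open>P\<close> and \<open>Q\<close> with diagonal coefficients. The multiples of \<open>I\<close>
  agree; those of \<open>P\<close> and \<open>Q\<close> agree under the two assumptions, where the trace enters through
  \<open>Q G\<^sub>1 Q = tr(G) Q\<close>.
\<close>

lemma diagonal_reflection:
  fixes a b :: "int \<Rightarrow> 'a::comm_ring_1" and s t s' t' tr :: 'a
  assumes idx: "i \<in> idx ty n" "k \<in> idx ty n" "j \<in> idx ty n" "l \<in> idx ty n"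
    and P: "\<And>i k. i \<in> idx ty n \<Longrightarrow> k \<in> idx ty n \<Longrightarrow>
      s' * (a i * b i - a k * b k) + s * (a k * b i - a i * b k) = 0"
    and Q: "\<And>i j. i \<in> idx ty n \<Longrightarrow> j \<in> idx ty n \<Longrightarrow>
      t' * (a i * b (- j) - a j * b (- i)) - sign_flip ty * s * t' * (a (- i) * b (- j) - a (- j) * b (- i))
      + t * (a j * b (- j) - a i * b (- i)) - sign_flip ty * s' * t * (a (- j) * b (- j) - a (- i) * b (- i))
      + t * t' * (\<Sum>c\<in>idx ty n. a c) * (b (- j) - b (- i)) = 0"
  defines "G1 \<equiv> kron (\<lambda>i j. if i = j then a i else 0) mone" and "G2 \<equiv> kron mone (\<lambda>i j. if i = j then b i else 0)"
    and "J \<equiv> idx2 ty n"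
  shows "mmul J (mmul J (mmul J (R_of ty s t) G1) (R_of ty s' t')) G2 (i, k) (j, l) =
    mmul J (mmul J (mmul J G2 (R_of ty s' t')) G1) (R_of ty s t) (i, k) (j, l)"
proof -
  let ?I = "idx ty n" and ?e = "sign_of ty :: int \<Rightarrow> 'a" and ?f = "sign_flip ty :: 'a"
  have G: "G1 (i, k) (j, l) = (if i = j \<and> k = l then a i else 0)"
    "G2 (i, k) (j, l) = (if i = j \<and> k = l then b k else 0)" for i j k l
    by (auto simp: G1_def G2_def kron_def mone_def)
  have G': "G1 x y = (if x = y then a (fst y) else 0)" "G2 x y = (if x = y then b (snd y) else 0)" for x y
    by (cases x; cases y; auto simp: G)+
  have fin: "finite J" by (simp add: J_def)
  have G1l: "mmul J G1 N (c, d) y = a c * N (c, d) y" and G2l: "mmul J G2 N (c, d) y = b d * N (c, d) y"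
    and G1r: "mmul J N G1 y (c, d) = N y (c, d) * a c" and G2r: "mmul J N G2 y (c, d) = N y (c, d) * b d"
    if "c \<in> ?I" "d \<in> ?I" for N c d y
  proof -
    have "mmul J G1 N (c, d) y = (\<Sum>m\<in>J. if m = (c, d) then a c * N m y else 0)"
      "mmul J G2 N (c, d) y = (\<Sum>m\<in>J. if m = (c, d) then b d * N m y else 0)"
      "mmul J N G1 y (c, d) = (\<Sum>m\<in>J. if m = (c, d) then N y m * a c else 0)"
      "mmul J N G2 y (c, d) = (\<Sum>m\<in>J. if m = (c, d) then N y m * b d else 0)"
      unfolding mmul_def by (auto simp: G' intro!: sum.cong)
    then show "mmul J G1 N (c, d) y = a c * N (c, d) y" "mmul J G2 N (c, d) y = b d * N (c, d) y"
      "mmul J N G1 y (c, d) = N y (c, d) * a c" "mmul J N G2 y (c, d) = N y (c, d) * b d"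
      using fin that by (simp_all add: J_def)
  qed
  define ee where "ee = ?e i * ?e j"
  define tr where "tr = (\<Sum>c\<in>?I. a c)"
  \<comment> \<open>For \<open>j = 0\<close> the cases \<open>c = j\<close> and \<open>c = - j\<close> coincide, so the sign products attached to them
    keep separate names until the sum has been evaluated.\<close>
  define em where "em = ?e i * ?e (- j)"
  have em: "em = ?f * ee"
    by (simp add: em_def ee_def sign_of_uminus mult_ac)
  define em' where "em' = ?e (- i) * ?e j"
  have em': "em' = ?f * ee"
    by (simp add: em'_def ee_def sign_of_uminus mult_ac)
  have T: "(\<Sum>c\<in>?I. ?e i * ?e c * (a c * R_of ty s' t' (c, - c) (j, l) * b l)) =
      (if l = - j then ee * (a j - s' * ?f * a (- j) + t' * tr) * b (- j) else 0)"
  proof (cases "l = - j")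
    case True
    have "?e i * ?e c * (a c * R_of ty s' t' (c, - c) (j, l) * b l) =
        (if c = j then ee * a j * b l else 0) - (if c = - j then em * (s' * a (- j) * b l) else 0)
        + ee * b l * t' * a c" if c: "c \<in> ?I" for c
    proof -
      define \<delta> where "\<delta> = (if c = j then 1 else 0) - (if c = - j then s' else 0)"
      have R: "R_of ty s' t' (c, - c) (j, l) =
          \<delta> + t' * (?e c * ?e j)"
        using True by (auto simp: R_of_def \<delta>_def)
      have "?e i * ?e c * (a c * R_of ty s' t' (c, - c) (j, l) * b l) =
          ?e i * ?e c * (a c * \<delta> * b l)
          + (?e c * ?e c) * (?e i * ?e j * b l * t' * a c)"
        unfolding R by (simp add: algebra_simps)
      moreover have "?e i * ?e c * (a c * \<delta> * b l) =
          (if c = j then ?e i * ?e j * a j * b l else 0) - (if c = - j then ?e i * ?e (- j) * (s' * a (- j) * b l) else 0)"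
        by (auto simp: \<delta>_def algebra_simps)
      ultimately show ?thesis
        by (simp add: sign_of_sq(1)[OF c] ee_def em_def)
    qed
    then have "(\<Sum>c\<in>?I. ?e i * ?e c * (a c * R_of ty s' t' (c, - c) (j, l) * b l)) =
        ee * a j * b l - em * (s' * a (- j) * b l) + ee * b l * t' * tr"
      using idx by (simp add: sum.distrib sum_subtractf sum_distrib_left[symmetric] tr_def)
    then show ?thesis
      using True by (simp add: em algebra_simps)
  qed (auto simp: R_of_def intro!: sum.neutral)
  have T': "(\<Sum>c\<in>?I. b k * R_of ty s' t' (i, k) (c, - c) * a c * t * (?e c * ?e j)) =
      (if k = - i then ee * (a i - s' * ?f * a (- i) + t' * tr) * b (- i) * t else 0)"
  proof (cases "k = - i")
    case True
    have "b k * R_of ty s' t' (i, k) (c, - c) * a c * t * (?e c * ?e j) =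
        (if c = i then ee * a i * b k * t else 0) - (if c = - i then em' * (s' * a (- i) * b k * t) else 0)
        + ee * b k * t' * t * a c" if c: "c \<in> ?I" for c
    proof -
      define \<delta> where "\<delta> = (if c = i then 1 else 0) - (if c = - i then s' else 0)"
      have R: "R_of ty s' t' (i, k) (c, - c) =
          \<delta> + t' * (?e i * ?e c)"
        using True by (auto simp: R_of_def \<delta>_def)
      have "b k * R_of ty s' t' (i, k) (c, - c) * a c * t * (?e c * ?e j) =
          ?e c * ?e j * (a c * \<delta> * b k * t)
          + (?e c * ?e c) * (?e i * ?e j * b k * t' * t * a c)"
        unfolding R by (simp add: algebra_simps)
      moreover have "?e c * ?e j * (a c * \<delta> * b k * t) =
          (if c = i then ?e i * ?e j * a i * b k * t else 0) - (if c = - i then ?e (- i) * ?e j * (s' * a (- i) * b k * t) else 0)"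
        by (auto simp: \<delta>_def algebra_simps)
      ultimately show ?thesis
        by (simp add: sign_of_sq(1)[OF c] ee_def em'_def)
    qed
    then have "(\<Sum>c\<in>?I. b k * R_of ty s' t' (i, k) (c, - c) * a c * t * (?e c * ?e j)) =
        ee * a i * b k * t - em' * (s' * a (- i) * b k * t) + ee * b k * t' * t * tr"
      using idx by (simp add: sum.distrib sum_subtractf sum_distrib_left[symmetric] tr_def)
    then show ?thesis
      using True by (simp add: em' algebra_simps)
  qed (auto simp: R_of_def intro!: sum.neutral)
  have N: "mmul J G1 (mmul J (R_of ty s' t') G2) (c, d) (j, l) = a c * R_of ty s' t' (c, d) (j, l) * b l"
    if "c \<in> ?I" "d \<in> ?I" for c d
    using that idx by (simp add: G1l G2r mult.assoc)
  have N': "mmul J (mmul J G2 (R_of ty s' t')) G1 (i, k) (c, d) = b k * R_of ty s' t' (i, k) (c, d) * a c"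
    if "c \<in> ?I" "d \<in> ?I" for c d
    using that idx by (simp add: G1r G2l)
  have L: "mmul J (mmul J (mmul J (R_of ty s t) G1) (R_of ty s' t')) G2 (i, k) (j, l) =
      a i * R_of ty s' t' (i, k) (j, l) * b l - s * (a k * R_of ty s' t' (k, i) (j, l) * b l)
      + (if k = - i then t * (if l = - j then ee * (a j - s' * ?f * a (- j) + t' * tr) * b (- j) else 0) else 0)"
    unfolding mmul_assoc[OF fin] unfolding T[symmetric]
    using idx
    by (simp add: R_of_mmul[OF idx(1,2), of s t "mmul J G1 (mmul J (R_of ty s' t') G2)", folded J_def] N
        cong: sum.cong)
  have R: "mmul J (mmul J (mmul J G2 (R_of ty s' t')) G1) (R_of ty s t) (i, k) (j, l) =
      b k * R_of ty s' t' (i, k) (j, l) * a j - b k * R_of ty s' t' (i, k) (l, j) * a l * s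
      + (if l = - j then (if k = - i then ee * (a i - s' * ?f * a (- i) + t' * tr) * b (- i) * t else 0) else 0)"
    unfolding T'[symmetric]
    using idx
    by (simp add: mmul_R_of[OF idx(3,4), of "mmul J (mmul J G2 (R_of ty s' t')) G1" s t, folded J_def] N'
        cong: sum.cong)
  have main: "(a i * R_of ty s' t' (i, k) (j, l) * b l - s * (a k * R_of ty s' t' (k, i) (j, l) * b l))
      - (b k * R_of ty s' t' (i, k) (j, l) * a j - b k * R_of ty s' t' (i, k) (l, j) * a l * s) =
    - (if i = l \<and> k = j then s' * (a i * b i - a k * b k) + s * (a k * b i - a i * b k) else 0)
    + (if k = - i \<and> l = - j then ee * (t' * (a i * b (- j) - a j * b (- i))
        - ?f * s * t' * (a (- i) * b (- j) - a (- j) * b (- i))) else 0)"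
  proof -
    have e: "?e (- i) * ?e j = ?f * ee" "?e i * ?e (- j) = ?f * ee" "?e i * ?e j = ee"
      by (simp_all add: ee_def sign_of_uminus mult_ac)
    have "i = - k \<longleftrightarrow> k = - i" "j = - l \<longleftrightarrow> l = - j" "k = j \<and> i = l \<longleftrightarrow> i = l \<and> k = j"
      "k = l \<and> i = j \<longleftrightarrow> i = j \<and> k = l"
      by auto
    note c = this
    have R: "R_of ty s' t' (i, k) (j, l) = (if i = j \<and> k = l then 1 else 0) - s' * (if i = l \<and> k = j then 1 else 0)
        + (if k = - i \<and> l = - j then t' * ee else 0)"
      "R_of ty s' t' (k, i) (j, l) = (if i = l \<and> k = j then 1 else 0) - s' * (if i = j \<and> k = l then 1 else 0)
        + (if k = - i \<and> l = - j then t' * (?f * ee) else 0)"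
      "R_of ty s' t' (i, k) (l, j) = (if i = l \<and> k = j then 1 else 0) - s' * (if i = j \<and> k = l then 1 else 0)
        + (if k = - i \<and> l = - j then t' * (?f * ee) else 0)"
      by (auto simp: R_of_def e c)
    define \<alpha> \<beta> \<gamma> :: 'a where "\<alpha> = (if i = j \<and> k = l then 1 else 0)"
      and "\<beta> = (if i = l \<and> k = j then 1 else 0)" and "\<gamma> = (if k = - i \<and> l = - j then 1 else 0)"
    have R': "R_of ty s' t' (i, k) (j, l) = \<alpha> - s' * \<beta> + \<gamma> * (t' * ee)"
      "R_of ty s' t' (k, i) (j, l) = \<beta> - s' * \<alpha> + \<gamma> * (t' * (?f * ee))"
      "R_of ty s' t' (i, k) (l, j) = \<beta> - s' * \<alpha> + \<gamma> * (t' * (?f * ee))"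
      unfolding R by (simp_all add: \<alpha>_def \<beta>_def \<gamma>_def)
    have "(a i * R_of ty s' t' (i, k) (j, l) * b l - s * (a k * R_of ty s' t' (k, i) (j, l) * b l))
      - (b k * R_of ty s' t' (i, k) (j, l) * a j - b k * R_of ty s' t' (i, k) (l, j) * a l * s) =
      \<alpha> * (a i * b l - a j * b k + s * s' * (a k * b l - a l * b k))
      - \<beta> * (s' * (a i * b l - a j * b k) + s * (a k * b l - a l * b k))
      + \<gamma> * (ee * (t' * (a i * b l - a j * b k) - ?f * s * t' * (a k * b l - a l * b k)))"
      unfolding R' by (simp add: algebra_simps)
    moreover have "\<alpha> * (a i * b l - a j * b k + s * s' * (a k * b l - a l * b k)) = 0"
      by (simp add: \<alpha>_def)
    moreover have "\<beta> * (s' * (a i * b l - a j * b k) + s * (a k * b l - a l * b k)) =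
        (if i = l \<and> k = j then s' * (a i * b i - a k * b k) + s * (a k * b i - a i * b k) else 0)"
      by (simp add: \<beta>_def)
    moreover have "\<gamma> * (ee * (t' * (a i * b l - a j * b k) - ?f * s * t' * (a k * b l - a l * b k))) =
        (if k = - i \<and> l = - j then ee * (t' * (a i * b (- j) - a j * b (- i))
        - ?f * s * t' * (a (- i) * b (- j) - a (- j) * b (- i))) else 0)"
      by (simp add: \<gamma>_def)
    ultimately show ?thesis
      by (simp only: diff_0 add_0)
  qed
  have "ee * (t' * (a i * b (- j) - a j * b (- i)) - ?f * s * t' * (a (- i) * b (- j) - a (- j) * b (- i)))
     + (t * (ee * (a j - s' * ?f * a (- j) + t' * tr) * b (- j)) - ee * (a i - s' * ?f * a (- i) + t' * tr) * b (- i) * t)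
    = ee * (t' * (a i * b (- j) - a j * b (- i)) - ?f * s * t' * (a (- i) * b (- j) - a (- j) * b (- i))
      + t * (a j * b (- j) - a i * b (- i)) - ?f * s' * t * (a (- j) * b (- j) - a (- i) * b (- i))
      + t * t' * (\<Sum>c\<in>idx ty n. a c) * (b (- j) - b (- i)))"
    by (simp add: algebra_simps tr_def)
  also have "\<dots> = 0"
    using Q[OF idx(1,3)] by simp
  finally have Q': "ee * (t' * (a i * b (- j) - a j * b (- i)) - ?f * s * t' * (a (- i) * b (- j) - a (- j) * b (- i)))
     + (t * (ee * (a j - s' * ?f * a (- j) + t' * tr) * b (- j)) - ee * (a i - s' * ?f * a (- i) + t' * tr) * b (- i) * t) = 0" .
  have "mmul J (mmul J (mmul J (R_of ty s t) G1) (R_of ty s' t')) G2 (i, k) (j, l) -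
    mmul J (mmul J (mmul J G2 (R_of ty s' t')) G1) (R_of ty s t) (i, k) (j, l) =
    ((a i * R_of ty s' t' (i, k) (j, l) * b l - s * (a k * R_of ty s' t' (k, i) (j, l) * b l))
      - (b k * R_of ty s' t' (i, k) (j, l) * a j - b k * R_of ty s' t' (i, k) (l, j) * a l * s))
    + (if k = - i \<and> l = - j then t * (ee * (a j - s' * ?f * a (- j) + t' * tr) * b (- j))
      - ee * (a i - s' * ?f * a (- i) + t' * tr) * b (- i) * t else 0)"
    unfolding L R by simp
  also have "\<dots> = 0"
    unfolding main P[OF idx(1,2)] using Q' by simp
  finally show ?thesis
    by simp
qed

text \<open>
  The functions \<open>h\<close>, \<open>h'\<close> are \<open>(1 + c u)/(1 - c u)\<close> and the same in \<open>v\<close>, the entries of \<open>G(u)\<close>, \<open>G(v)\<close> at the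
  indices with \<open>g\<^sub>i\<^sub>i = - 1\<close>; the trace of \<open>G(u)\<close> is \<open>(2 k + 2 f - 4 u) d\<close>. After inserting \<open>h' - h\<close>, \<open>h h' - 1\<close> and
  \<open>h' - 1\<close>, all multiples of \<open>2 c d e\<close>, only a polynomial identity is left.
\<close>

lemma reflection_scalar_identity:
  fixes u v k f c s t s' t' d e :: "'a::idom"
  assumes s: "s * (u - v) = 1" and s': "s' * (u + v) = 1"
    and t: "t * (u - v - k) = 1" and t': "t' * (u + v - k) = 1"
    and d: "d * (1 - c * u) = 1" and e: "e * (1 - c * v) = 1"
  defines "h \<equiv> (1 + c * u) * d" and "h' \<equiv> (1 + c * v) * e"
  shows "t' * (h' - h) - f * s * t' * (h' - h) + t * (h * h' - 1) - f * s' * t * (h * h' - 1)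
    + t * t' * ((2 * k + 2 * f - 4 * u) * d) * (h' - 1) = 0"
    and "s' * (1 - h * h') + s * (h - h') = 0"
proof -
  have h1: "h' - 1 = 2 * c * v * e"
  proof -
    have "h' - 1 = (1 + c * v) * e - e * (1 - c * v)" by (simp add: h'_def e)
    then show ?thesis by (simp add: algebra_simps)
  qed
  have hh: "h' - h = - 2 * c * (u - v) * d * e"
  proof -
    have "h' - h = (1 + c * v) * e * (d * (1 - c * u)) - (1 + c * u) * d * (e * (1 - c * v))"
      by (simp add: h_def h'_def d e)
    then show ?thesis by (simp add: algebra_simps)
  qed
  have hh1: "h * h' - 1 = 2 * c * (u + v) * d * e"
  proof -
    have "h * h' - 1 = (1 + c * u) * d * ((1 + c * v) * e) - (d * (1 - c * u)) * (e * (1 - c * v))"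
      by (simp add: h_def h'_def d e)
    then show ?thesis by (simp add: algebra_simps)
  qed
  have "t' * (h' - h) - f * s * t' * (h' - h) + t * (h * h' - 1) - f * s' * t * (h * h' - 1)
    + t * t' * ((2 * k + 2 * f - 4 * u) * d) * (h' - 1) =
    2 * c * d * e * (- t' * (u - v) * (t * (u - v - k)) + f * (s * (u - v)) * t' * (t * (u - v - k))
      + t * (u + v) * (t' * (u + v - k)) - f * (s' * (u + v)) * t * (t' * (u + v - k))
      + t * t' * v * (2 * k + 2 * f - 4 * u))"
    unfolding h1 hh hh1 t t' by (simp add: algebra_simps)
  also have "\<dots> = 2 * c * d * e * (t * t' * (- (u - v) * (u - v - k) + f * (u - v - k)
      + (u + v) * (u + v - k) - f * (u + v - k) + v * (2 * k + 2 * f - 4 * u)))"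
    unfolding s s' by (simp add: algebra_simps)
  also have "- (u - v) * (u - v - k) + f * (u - v - k)
      + (u + v) * (u + v - k) - f * (u + v - k) + v * (2 * k + 2 * f - 4 * u) = 0"
    by (simp add: algebra_simps)
  finally show "t' * (h' - h) - f * s * t' * (h' - h) + t * (h * h' - 1) - f * s' * t * (h * h' - 1)
    + t * t' * ((2 * k + 2 * f - 4 * u) * d) * (h' - 1) = 0"
    by simp
  have "s' * (1 - h * h') + s * (h - h') = - s' * (h * h' - 1) - s * (h' - h)"
    by (simp add: algebra_simps)
  also have "\<dots> = 2 * c * d * e * (s * (u - v) - s' * (u + v))"
    unfolding hh hh1 by (simp add: algebra_simps)
  finally show "s' * (1 - h * h') + s * (h - h') = 0"
    by (simp add: s s')
qed

lemma gdiag_sign: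
  assumes "admissible ty n" "i \<in> idx ty n"
  shows "gdiag ty i = 1 \<or> gdiag ty i = - 1"
  using assms by (cases ty) (auto simp: idx_def odd_N_def sgn_if)

lemma gdiag_uminus:
  "gdiag ty (- i) = (if ty = CI \<or> ty = DIII then - gdiag ty i else gdiag ty i)"
  by (cases ty) (auto simp: sgn_if)

lemma card_idx_abs_le:
  assumes "m \<le> n"
  shows "card {i \<in> idx ty n. \<bar>i\<bar> \<le> int m} = (if odd_N ty then 2 * m + 1 else 2 * m)"
proof -
  have "{i \<in> idx ty n. \<bar>i\<bar> \<le> int m} = (if odd_N ty then {- int m..int m} else {- int m..int m} - {0})"
    using assms by (auto simp: idx_def)
  then show ?thesis
    by (simp add: card_Diff_singleton nat_add_distrib nat_mult_distrib)
qed

lemma sum_idx_abs_le: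
  assumes "m \<le> n"
  shows "(\<Sum>i\<in>idx ty n. if \<bar>i\<bar> \<le> int m then x else y) =
    (x - y) * of_nat (if odd_N ty then 2 * m + 1 else 2 * m) + y * (of_nat (dim_N ty n) :: complex)"
proof -
  have "(\<Sum>i\<in>idx ty n. if \<bar>i\<bar> \<le> int m then x else y) =
      (\<Sum>i\<in>idx ty n. (if \<bar>i\<bar> \<le> int m then x - y else 0) + y)"
    by (intro sum.cong) auto
  also have "\<dots> = (\<Sum>i\<in>{i \<in> idx ty n. \<bar>i\<bar> \<le> int m}. x - y) + of_nat (card (idx ty n)) * y"
    by (simp add: sum.distrib sum.inter_filter[symmetric])
  finally show ?thesis
    by (simp add: card_idx_abs_le[OF assms] card_idx mult.commute)
qed

text \<open>
  The value \<open>1\<close> is taken \<open>p\<close> times and the value \<open>- 1\<close> is taken \<open>q\<close> times.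
\<close>

lemma sum_gdiag:
  assumes "admissible ty n" "ty \<notin> {B0, C0, D0, CI, DIII}"
  shows "(\<Sum>i\<in>idx ty n. gdiag ty i) = of_nat (par_p ty) - of_nat (par_q ty)"
proof -
  have *: "(of_nat k :: complex) = of_nat p + of_nat q" if "k = p + q" for k p q
    using that by simp
  show ?thesis
  proof (cases ty)
    case (BIa p q)
    with assms obtain m where m: "p = 2 * m + 1" by (auto elim: oddE)
    have "(int p - 1) div 2 = int m" "m \<le> n" "dim_N ty n = p + q" "odd_N ty"
      using assms m BIa by (auto simp: dim_N_def odd_N_def)
    then show ?thesis
      using sum_idx_abs_le[of m n, where ty=ty and x=1 and y="- 1"] BIa *[of "dim_N ty n" p q] m by simp
  next
    case (BIb p q)
    with assms obtain m where m: "q = 2 * m + 1" by (auto elim: oddE)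
    have "(int q - 1) div 2 = int m" "m \<le> n" "dim_N ty n = p + q" "odd_N ty"
      using assms m BIb by (auto simp: dim_N_def odd_N_def)
    then show ?thesis
      using sum_idx_abs_le[of m n, where ty=ty and x="- 1" and y=1] BIb *[of "dim_N ty n" p q] m by simp
  next
    case (CII p q)
    with assms obtain m where m: "p = 2 * m" by (auto elim: evenE)
    have "int p div 2 = int m" "m \<le> n" "dim_N ty n = p + q" "\<not> odd_N ty"
      using assms m CII by (auto simp: dim_N_def odd_N_def)
    then show ?thesis
      using sum_idx_abs_le[of m n, where ty=ty and x=1 and y="- 1"] CII *[of "dim_N ty n" p q] m by simp
  next
    case (DIa p q)
    with assms obtain m where m: "p = 2 * m" by (auto elim: evenE)
    have "int p div 2 = int m" "m \<le> n" "dim_N ty n = p + q" "\<not> odd_N ty"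
      using assms m DIa by (auto simp: dim_N_def odd_N_def)
    then show ?thesis
      using sum_idx_abs_le[of m n, where ty=ty and x=1 and y="- 1"] DIa *[of "dim_N ty n" p q] m by simp
  qed (use assms in auto)
qed

lemma sum_gdiag_constant:
  assumes "admissible ty n" "constant_G ty"
  shows "(\<forall>i. gdiag ty i = 1) \<or> (\<Sum>i\<in>idx ty n. gdiag ty i) = 0"
proof (cases "ty \<in> {B0, C0, D0, CI, DIII}")
  case True
  have "(\<Sum>i\<in>idx ty n. gdiag ty i) = 0" if "ty = CI \<or> ty = DIII"
  proof -
    have "(\<Sum>i\<in>idx ty n. gdiag ty i) = - (\<Sum>i\<in>idx ty n. gdiag ty i)"
      by (subst sum_idx_uminus[symmetric]) (simp add: gdiag_uminus that sum_negf)
    then show ?thesis by (simp add: eq_neg_iff_add_eq_0)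
  qed
  with True show ?thesis by auto
next
  case False
  with assms show ?thesis
    using sum_gdiag[OF assms(1) False] by (auto simp: constant_G_def)
qed

definition g_ser :: "pair_type \<Rightarrow> int \<Rightarrow> complex fls"
  where "g_ser ty i = G_ser ty i i"

lemma G_ser_eq: "G_ser ty i j = (if i = j then g_ser ty i else 0)"
  by (simp add: g_ser_def G_ser_def G_mat_def mone_def Let_def)

lemma linear_denominator_nonzero:
  assumes "c \<noteq> 0"
  shows "1 - fls_const c * u_ser \<noteq> 0"
proof
  assume "1 - fls_const c * u_ser = 0"
  then have "fls_nth (1 - fls_const c * u_ser) (- 1) = 0" by simp
  with assms show False by (simp add: u_ser_def)
qed

lemma g_ser_nonconstant:
  assumes "\<not> constant_G ty" and i: "gdiag ty i = 1 \<or> gdiag ty i = - 1"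
  defines "c \<equiv> fls_const (4 / (of_nat (par_p ty) - of_nat (par_q ty)))"
  assumes nz: "1 - c * u_ser \<noteq> 0"
  shows "g_ser ty i = (if gdiag ty i = 1 then 1 else (1 + c * u_ser) * inverse (1 - c * u_ser))"
proof -
  have "g_ser ty i = (1 - c * u_ser * fls_const (gdiag ty i)) / (1 - c * u_ser)"
    using assms(1) by (simp add: g_ser_def G_ser_def G_mat_def mone_def Let_def c_def)
  then show ?thesis
    using i nz by (auto simp: divide_inverse fls_const_uminus[symmetric])
qed

lemma const2_hom: "ring_map const2"
  unfolding const2_def by (intro ring_map_comp[OF ring_map_fls_const ring_map_fls_const])

lemma in_u_const: "in_u (fls_const c) = const2 c"
  by (rule fls_eqI) (simp add: in_u_nth const2_def)

lemma in_u_u_ser: "in_u u_ser = U_ser"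
  by (rule fls_eqI) (simp add: in_u_nth u_ser_def U_ser_def)

lemma ring_map_inverse:
  fixes h :: "'a::field \<Rightarrow> 'b::field"
  assumes h: "ring_map h" shows "h (inverse x) = inverse (h x)"
proof (cases "x = 0")
  case False
  then have "h x * h (inverse x) = 1"
    by (simp add: ring_map_simps(2,4)[OF h, symmetric])
  then show ?thesis by (metis inverse_unique)
qed (simp add: ring_map_simps[OF h])

text \<open>
  If \<open>G(u)\<close> is constant, all terms but the one with the trace cancel in pairs, and either the trace is zero
  or \<open>G(u)\<close> is the identity. Otherwise \<open>g\<^sub>-\<^sub>i\<^sub>,\<^sub>-\<^sub>i = g\<^sub>i\<^sub>i\<close>, only indices with different signs matter, and
  the constant \<open>c = 4/(p - q)\<close> is the one for which the trace becomes \<open>(N - 4 u)/(1 - c u)\<close>.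
\<close>

lemma G_exchange_conditions:
  assumes adm: "admissible ty n"
  defines "a \<equiv> \<lambda>i. in_u (g_ser ty i)" and "b \<equiv> \<lambda>i. fls_const (g_ser ty i)"
    and "s \<equiv> inverse (U_ser - V_ser)" and "t \<equiv> inverse (U_ser - V_ser - const2 (kappa ty n))"
    and "s' \<equiv> inverse (U_ser + V_ser)" and "t' \<equiv> inverse (U_ser + V_ser - const2 (kappa ty n))"
  assumes ij: "i \<in> idx ty n" "j \<in> idx ty n"
  shows "s' * (a i * b i - a j * b j) + s * (a j * b i - a i * b j) = 0" (is ?P)
    and "t' * (a i * b (- j) - a j * b (- i)) - sign_flip ty * s * t' * (a (- i) * b (- j) - a (- j) * b (- i))
      + t * (a j * b (- j) - a i * b (- i)) - sign_flip ty * s' * t * (a (- j) * b (- j) - a (- i) * b (- i))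
      + t * t' * (\<Sum>c\<in>idx ty n. a c) * (b (- j) - b (- i)) = 0" (is ?Q)
proof -
  note pm = gdiag_sign[OF adm]
  have "?P \<and> ?Q"
  proof (cases "constant_G ty")
    case True
    have ab: "a i = const2 (gdiag ty i)" "b i = const2 (gdiag ty i)" for i
      using True by (simp_all add: a_def b_def g_ser_def G_ser_def G_mat_def in_u_const) (simp add: const2_def)
    have sum: "(\<Sum>c\<in>idx ty n. const2 (gdiag ty c)) = const2 (\<Sum>c\<in>idx ty n. gdiag ty c)"
      by (simp add: ring_map_simps(7)[OF const2_hom])
    have c: "const2 1 = 1" "const2 (- x) = - const2 x" "const2 0 = 0" for x
      by (simp_all add: ring_map_simps[OF const2_hom])
    show ?thesis
      unfolding ab unfolding sum
      using pm[OF ij(1)] pm[OF ij(2)] sum_gdiag_constant[OF adm True]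
      by (auto simp: gdiag_uminus c)
  next
    case False
    define c where "c = fls_const (4 / (of_nat (par_p ty) - of_nat (par_q ty) :: complex))"
    have nb: "ty \<notin> {B0, C0, D0, CI, DIII}" and pq: "par_p ty \<noteq> par_q ty"
      using False adm by (cases ty; auto simp: constant_G_def)+
    have nz: "1 - c * u_ser \<noteq> 0"
      unfolding c_def using pq by (intro linear_denominator_nonzero) auto
    define C where "C = in_u c"
    have C: "C = const2 (4 / (of_nat (par_p ty) - of_nat (par_q ty)))"
      by (simp add: C_def c_def in_u_const)
    have C4: "C * const2 (of_nat (par_p ty) - of_nat (par_q ty)) = 4"
    proof -
      have "C * const2 (of_nat (par_p ty) - of_nat (par_q ty)) = const2 4"
      proof -
        have "4 / x * x = 4" if "x \<noteq> 0" for x :: complex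
          using that by simp
        then show ?thesis
          unfolding C ring_map_simps(4)[OF const2_hom, symmetric] using pq
          by (metis of_nat_eq_iff right_minus_eq)
      qed
      then show ?thesis by (simp add: const2_def)
    qed
    define d where "d = inverse (1 - C * U_ser)"
    define e where "e = inverse (1 - C * V_ser)"
    note iu = ring_map_simps[OF ring_map_in_u]
    have hu: "in_u (1 - c * u_ser) = 1 - C * U_ser"
      by (simp add: iu C_def in_u_u_ser)
    have hv: "fls_const (1 - c * u_ser) = 1 - C * V_ser"
      by (simp add: ring_map_simps(6)[OF ring_map_fls_const] C const2_def c_def V_ser_def u_ser_def)
    have nzu: "1 - C * U_ser \<noteq> 0"
      using nz ring_map_inverse[OF ring_map_in_u, of "1 - c * u_ser"] unfolding hu[symmetric]
      by (metis iu(2,4) mult_zero_left right_inverse zero_neq_one)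
    have nzv: "1 - C * V_ser \<noteq> 0"
      unfolding hv[symmetric] using nz by (simp add: fls_const_nonzero)
    have d: "d * (1 - C * U_ser) = 1" and e: "e * (1 - C * V_ser) = 1"
      using nzu nzv by (simp_all add: d_def e_def)
    have s: "s * (U_ser - V_ser) = 1" "s' * (U_ser + V_ser) = 1"
      "t * (U_ser - V_ser - const2 (kappa ty n)) = 1" "t' * (U_ser + V_ser - const2 (kappa ty n)) = 1"
      unfolding s_def s'_def t_def t'_def using U_minus_V_nonzero by (simp_all del: right_minus_eq)
    define h where "h = (1 + C * U_ser) * d"
    define h' where "h' = (1 + C * V_ser) * e"
    have a: "a i = (if gdiag ty i = 1 then 1 else h)" and b: "b i = (if gdiag ty i = 1 then 1 else h')"
      if "gdiag ty i = 1 \<or> gdiag ty i = - 1" for i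
    proof -
      have "in_u ((1 + c * u_ser) * inverse (1 - c * u_ser)) = h"
        by (simp only: iu ring_map_inverse[OF ring_map_in_u] hu h_def d_def) (simp add: C_def in_u_u_ser)
      moreover have "fls_const ((1 + c * u_ser) * inverse (1 - c * u_ser)) = h'"
        by (simp only: ring_map_simps[OF ring_map_fls_const] ring_map_inverse[OF ring_map_fls_const] hv h'_def e_def)
          (simp add: C const2_def c_def V_ser_def u_ser_def)
      ultimately show "a i = (if gdiag ty i = 1 then 1 else h)" "b i = (if gdiag ty i = 1 then 1 else h')"
        unfolding a_def b_def g_ser_nonconstant[OF False that nz[unfolded c_def]] c_def[symmetric]
        by (auto simp: iu)
    qed
    have a': "a i = (1 - C * U_ser * const2 (gdiag ty i)) * d" if "i \<in> idx ty n" for i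
      using pm[OF that] d by (auto simp: a h_def mult.commute ring_map_simps[OF const2_hom])
    have "(\<Sum>i\<in>idx ty n. a i) = (of_nat (card (idx ty n)) - C * U_ser * const2 (\<Sum>i\<in>idx ty n. gdiag ty i)) * d"
      by (simp add: a' sum_distrib_right[symmetric] sum_subtractf sum_distrib_left[symmetric]
          ring_map_simps(7)[OF const2_hom])
    also have "\<dots> = (2 * const2 (kappa ty n) + 2 * sign_flip ty - 4 * U_ser) * d"
      unfolding of_nat_card_idx sum_gdiag[OF adm nb] C4[symmetric] by (simp add: mult_ac)
    finally have tr: "(\<Sum>i\<in>idx ty n. a i) = (2 * const2 (kappa ty n) + 2 * sign_flip ty - 4 * U_ser) * d" .
    note id = reflection_scalar_identity[OF s(1,2,3,4) d e, folded h_def h'_def]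
    have gm: "gdiag ty (- i) = gdiag ty i" for i
      using nb by (simp add: gdiag_uminus)
    have pm': "gdiag ty (- i) = 1 \<or> gdiag ty (- i) = - 1" if "i \<in> idx ty n" for i
      using pm[of "- i"] that by simp
    have ev: "a i = (if gdiag ty i = 1 then 1 else h)" "b i = (if gdiag ty i = 1 then 1 else h')"
      "a (- i) = (if gdiag ty i = 1 then 1 else h)" "b (- i) = (if gdiag ty i = 1 then 1 else h')"
      if "i \<in> idx ty n" for i
      using a b pm[OF that] pm'[OF that] gm by auto
    have id1: "t' * (h' - h) - sign_flip ty * s * t' * (h' - h) + t * (h * h' - 1) - sign_flip ty * s' * t * (h * h' - 1)
      + t * t' * ((2 * const2 (kappa ty n) + 2 * sign_flip ty - 4 * U_ser) * d) * (h' - 1) = 0"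
      by (rule id(1))
    then have id1': "t' * (h - h') - sign_flip ty * s * t' * (h - h') + t * (1 - h * h') - sign_flip ty * s' * t * (1 - h * h')
      + t * t' * ((2 * const2 (kappa ty n) + 2 * sign_flip ty - 4 * U_ser) * d) * (1 - h') = 0"
      by (simp add: algebra_simps)
    have id2: "s' * (1 - h * h') + s * (h - h') = 0"
      by (rule id(2))
    then have id2': "s' * (h * h' - 1) + s * (h' - h) = 0"
      by (simp add: algebra_simps)
    show ?thesis
      unfolding tr ev[OF ij(1)] ev[OF ij(2)]
      by (cases "gdiag ty i = 1"; cases "gdiag ty j = 1")
        (simp_all only: if_True if_False mult_1_left mult_1_right simp_thms id1 id1' id2 id2', simp_all)
  qed
  then show ?P ?Q by simp_all
qed

section \<open>The reflection equation in the extended Yangian\<close>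

lemma G_reflection:
  assumes adm: "admissible ty n" and pq: "p \<in> idx2 ty n" "q \<in> idx2 ty n"
  defines "M \<equiv> mmul (idx2 ty n)" and "G \<equiv> \<lambda>i j. lift1 (G_ser ty i j) :: 'g free_alg fls"
  shows "M (M (M (R_at ty n (U_ser - V_ser)) (kron (at_u G) mone)) (R_at ty n (U_ser + V_ser))) (kron mone (at_v G)) p q =
    M (M (M (kron mone (at_v G)) (R_at ty n (U_ser + V_ser))) (kron (at_u G) mone)) (R_at ty n (U_ser - V_ser)) p q"
proof -
  obtain i k j l where ijkl: "p = (i, k)" "q = (j, l)" by (cases p; cases q)
  have idx: "i \<in> idx ty n" "k \<in> idx ty n" "j \<in> idx ty n" "l \<in> idx ty n"
    using pq by (auto simp: ijkl)
  have G: "kron (at_u G) mone = (\<lambda>x y. lift2 (kron (\<lambda>i j. if i = j then in_u (g_ser ty i) else 0) mone x y))"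
    "kron mone (at_v G) = (\<lambda>x y. lift2 (kron mone (\<lambda>i j. if i = j then fls_const (g_ser ty i) else 0) x y))"
    unfolding ring_map_kron_mone[OF ring_map_lift2] G_def
    by (simp_all add: if_distrib[of lift2] lift2_in_u lift2_in_v ring_map_simps(1)[OF ring_map_lift2]
        G_ser_eq if_distrib[of lift1] ring_map_simps(1)[OF ring_map_lift1] if_distrib[of in_u]
        if_distrib[of fls_const] ring_map_simps(1)[OF ring_map_in_u] cong: if_cong)
  have R: "R_at ty n x = (\<lambda>p q. lift2 (R_of ty (inverse x) (inverse (x - const2 (kappa ty n))) p q))" for x
    unfolding R_at_def ring_map_R_of[OF ring_map_lift2] ..
  show ?thesis
    unfolding ijkl M_def G R ring_map_mmul[OF ring_map_lift2, symmetric]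
    by (subst diagonal_reflection[OF idx]) (rule G_exchange_conditions[OF adm] refl | assumption)+
qed

lemma kron_commute:
  fixes A B :: "(int, 'a::ring_1) mtx"
  assumes "\<And>i j k l. i \<in> I \<Longrightarrow> j \<in> I \<Longrightarrow> k \<in> I \<Longrightarrow> l \<in> I \<Longrightarrow> A i j * B k l = B k l * A i j"
    and "finite I" "p \<in> I \<times> I" "q \<in> I \<times> I"
  shows "mmul (I \<times> I) (kron A mone) (kron mone B) p q = mmul (I \<times> I) (kron mone B) (kron A mone) p q"
  using assms by (cases p; cases q) (simp add: kron_mone_mmul)

text \<open>
  The four exchange relations are taken at the arguments \<open>\<plusminus>(u - \<kappa>/2)\<close> and \<open>\<plusminus>(v - \<kappa>/2)\<close>. The shift by \<open>\<kappa>/2\<close> is made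
  so that the parameter of the mixed relations becomes \<open>u + v\<close>.
\<close>

lemma reflection_equation:
  assumes adm: "admissible ty n"
  defines "M \<equiv> mmul (idx2 ty n)"
    and "R \<equiv> R_at ty n (U_ser - V_ser)" and "Rp \<equiv> R_at ty n (U_ser + V_ser)"
    and "S1 \<equiv> kron (at_u (S_mat ty n)) mone" and "S2 \<equiv> kron mone (at_v (S_mat ty n))"
  shows "cong_mtx (idx2 ty n) (X_car2 ty n) (X_ideal2 ty n) (M (M (M R S1) Rp) S2) (M (M (M S2 Rp) S1) R)"
proof -
  define h where "h = fls_const (kappa ty n / 2)"
  define w where "w = u_ser - h"
  have sub: "fls_subdegree w = - 1" "fls_subdegree (- w) = - 1"
    by (auto simp: w_def h_def u_ser_def intro!: fls_subdegree_eqI)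
  have iw: "in_u w = U_ser - const2 (kappa ty n / 2)" "fls_const w = V_ser - const2 (kappa ty n / 2)"
    "in_u (- w) = - in_u w" "fls_const (- w) = - fls_const w"
    by (simp_all add: w_def h_def ring_map_simps[OF ring_map_in_u] in_u_const in_u_u_ser
        ring_map_simps(6)[OF ring_map_fls_const] ring_map_simps(5)[OF ring_map_fls_const])
      (simp_all add: const2_def V_ser_def u_ser_def)
  have k: "const2 (kappa ty n) = const2 (kappa ty n / 2) + const2 (kappa ty n / 2)"
    by (simp add: ring_map_simps(3)[OF const2_hom, symmetric])
  \<comment> \<open>The parameters of the four exchange relations, with \<open>w = u - \<kappa>/2\<close>.\<close>
  have x: "U_ser - V_ser = in_u w - fls_const w" "U_ser - V_ser = - (in_u (- w) - fls_const (- w))"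
    "U_ser + V_ser = const2 (kappa ty n) - (in_u (- w) - fls_const w)"
    "U_ser + V_ser = const2 (kappa ty n) + (in_u w - fls_const (- w))"
    by (simp_all add: iw k)
  let ?I = "idx ty n"
  let ?G = "\<lambda>i j. lift1 (G_ser ty i j) :: yindex free_alg fls"
  define A1 where "A1 = kron (at_u (T_at w :: (int, yindex free_alg fls) mtx)) mone"
  define A2 where "A2 = kron mone (at_v (T_at w :: (int, yindex free_alg fls) mtx))"
  define B1 where "B1 = kron (at_u (Tt_at ty n (- w))) mone"
  define B2 where "B2 = kron mone (at_v (Tt_at ty n (- w)))"
  define G1 where "G1 = kron (at_u ?G) mone"
  define G2 where "G2 = kron mone (at_v ?G)"
  note C = X_car2_closed[of ty n]
  have Gover: "?G \<in> mtx_over ?I (fls_over (X_car ty n))"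
    by (simp add: mtx_over_def lift1_over)
  have over: "A1 \<in> mtx_over (idx2 ty n) (X_car2 ty n)" "A2 \<in> mtx_over (idx2 ty n) (X_car2 ty n)"
    "B1 \<in> mtx_over (idx2 ty n) (X_car2 ty n)" "B2 \<in> mtx_over (idx2 ty n) (X_car2 ty n)"
    "G1 \<in> mtx_over (idx2 ty n) (X_car2 ty n)" "G2 \<in> mtx_over (idx2 ty n) (X_car2 ty n)"
    "R \<in> mtx_over (idx2 ty n) (X_car2 ty n)" "Rp \<in> mtx_over (idx2 ty n) (X_car2 ty n)"
    unfolding A1_def A2_def B1_def B2_def G1_def G2_def R_def Rp_def
    by (intro kron_at_over fa_closed_set T_at_over Tt_at_over sub Gover R_at_over)+
  note [simp] = finite_cartesian_product
  define eqv where "eqv = cong_mtx (idx2 ty n) (X_car2 ty n) (X_ideal2 ty n)"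
  have eqvI: "eqv X Y" if "X \<in> mtx_over (idx2 ty n) (X_car2 ty n)"
    "\<And>p q. p \<in> idx2 ty n \<Longrightarrow> q \<in> idx2 ty n \<Longrightarrow> X p q = Y p q" for X Y
    unfolding eqv_def using that by (rule cong_mtx_eqI[OF X_left_ideal2])
  have S: "S_mat ty n = mmul ?I (mmul ?I (T_at w) ?G) (Tt_at ty n (- w))"
    by (simp add: S_mat_def Let_def w_def h_def)
  have S1: "eqv (M (M A1 G1) B1) S1"
  proof (rule eqvI)
    show "M (M A1 G1) B1 \<in> mtx_over (idx2 ty n) (X_car2 ty n)"
      unfolding M_def by (intro mmul_over C over)
    fix p q assume "p \<in> idx2 ty n" "q \<in> idx2 ty n"
    then obtain i k j l where pq: "p = (i, k)" "q = (j, l)"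
      and idx: "i \<in> ?I" "k \<in> ?I" "j \<in> ?I" "l \<in> ?I" by auto
    have "M (M A1 G1) B1 p q = mmul (idx2 ty n) (kron (mmul ?I (at_u (T_at w)) (at_u ?G)) mone) B1 p q"
      unfolding M_def mmul_def[of _ _ B1] A1_def G1_def
      by (rule sum.cong) (use idx in \<open>auto simp: pq kron_mmul_mone\<close>)
    also have "\<dots> = kron (mmul ?I (mmul ?I (at_u (T_at w)) (at_u ?G)) (at_u (Tt_at ty n (- w)))) mone p q"
      using idx by (simp add: B1_def pq kron_mmul_mone)
    also have "\<dots> = S1 p q"
      unfolding S1_def S ring_map_mmul[OF ring_map_in_u] ..
    finally show "M (M A1 G1) B1 p q = S1 p q" .
  qed
  have S2: "eqv (M (M A2 G2) B2) S2"
  proof (rule eqvI)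
    show "M (M A2 G2) B2 \<in> mtx_over (idx2 ty n) (X_car2 ty n)"
      unfolding M_def by (intro mmul_over C over)
    fix p q assume "p \<in> idx2 ty n" "q \<in> idx2 ty n"
    then obtain i k j l where pq: "p = (i, k)" "q = (j, l)"
      and idx: "i \<in> ?I" "k \<in> ?I" "j \<in> ?I" "l \<in> ?I" by auto
    have "M (M A2 G2) B2 p q = mmul (idx2 ty n) (kron mone (mmul ?I (at_v (T_at w)) (at_v ?G))) B2 p q"
      unfolding M_def mmul_def[of _ _ B2] A2_def G2_def
      by (rule sum.cong) (use idx in \<open>auto simp: pq kron_mmul_mone\<close>)
    also have "\<dots> = kron mone (mmul ?I (mmul ?I (at_v (T_at w)) (at_v ?G)) (at_v (Tt_at ty n (- w)))) p q"
      using idx by (simp add: B2_def pq kron_mmul_mone)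
    also have "\<dots> = S2 p q"
      unfolding S2_def S ring_map_mmul[OF ring_map_fls_const] ..
    finally show "M (M A2 G2) B2 p q = S2 p q" .
  qed
  have assoc: "M (M X Y) Z = M X (M Y Z)" for X Y Z
    unfolding M_def by (simp add: mmul_assoc)
  have trans: "eqv X Y \<Longrightarrow> eqv Y Z \<Longrightarrow> eqv X Z" for X Y Z
    unfolding eqv_def by (rule cong_mtx_trans[OF X_left_ideal2])
  have sym: "eqv X Y \<Longrightarrow> eqv Y X" for X Y
    unfolding eqv_def by (rule cong_mtx_sym[OF X_left_ideal2])
  have cong: "eqv X X' \<Longrightarrow> eqv Y Y' \<Longrightarrow> eqv (M X Y) (M X' Y')" for X Y X' Y'
    unfolding eqv_def M_def by (rule cong_mtx_mmul[OF X_ideal2])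
  have refl: "eqv X X" if "X \<in> mtx_over (idx2 ty n) (X_car2 ty n)" for X
    using that by (rule eqvI) simp
  have central: "in_u (lift1 q) * f = f * in_u (lift1 q)" "fls_const (lift1 q) * f = f * fls_const (lift1 q)"
    for q and f :: "yindex free_alg fls fls"
    unfolding lift2_in_u[symmetric] lift2_in_v[symmetric] by (rule lift2_commute)+
  have "eqv (M (M (M R (M (M A1 G1) B1)) Rp) (M (M A2 G2) B2)) (M (M (M (M (M A2 G2) B2) Rp) (M (M A1 G1) B1)) R)"
  proof (rule reflection_of_exchange[of M eqv])
    show "M (M a b) c = M a (M b c)" for a b c
      by (rule assoc)
    show "eqv a c" if "eqv a b" "eqv b c" for a b c
      by (rule trans[OF that])
    show "eqv (M a b) (M a' b')" if "eqv a a'" "eqv b b'" for a a' b b'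
      by (rule cong[OF that])
    show "eqv (M (M R A1) A2) (M (M A2 A1) R)"
      unfolding eqv_def M_def R_def A1_def A2_def x(1) by (rule T_exchange[OF sub(1) sub(1)])
    show "eqv (M (M R B1) B2) (M (M B2 B1) R)"
      unfolding assoc eqv_def unfolding M_def R_def B1_def B2_def
      using Tt_exchange[OF sub(2) sub(2) x(2)] by (simp add: mmul_assoc)
    show "eqv (M (M B1 Rp) A2) (M (M A2 Rp) B1)"
      unfolding eqv_def M_def Rp_def A2_def B1_def by (rule Tt_T_exchange[OF sub(2) sub(1) x(3)])
    show "eqv (M (M A1 Rp) B2) (M (M B2 Rp) A1)"
      unfolding eqv_def M_def Rp_def A1_def B2_def by (rule T_Tt_exchange[OF sub(1) sub(2) x(4)])
    show "eqv (M G1 A2) (M A2 G1)" "eqv (M A1 G2) (M G2 A1)" "eqv (M B1 G2) (M G2 B1)" "eqv (M G1 B2) (M B2 G1)"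
      unfolding M_def
      by (intro eqvI mmul_over C over;
          unfold G1_def G2_def A1_def A2_def B1_def B2_def;
          rule kron_commute[OF _ finite_idx]; simp add: central)+
    show "eqv (M (M (M R G1) Rp) G2) (M (M (M G2 Rp) G1) R)"
    proof (rule eqvI)
      show "M (M (M R G1) Rp) G2 \<in> mtx_over (idx2 ty n) (X_car2 ty n)"
        unfolding M_def by (intro mmul_over C over)
      show "M (M (M R G1) Rp) G2 p q = M (M (M G2 Rp) G1) R p q"
        if "p \<in> idx2 ty n" "q \<in> idx2 ty n" for p q
        unfolding M_def R_def Rp_def G1_def G2_def by (rule G_reflection[OF adm that])
    qed
  qed (rule refl, rule over)+
  moreover have "eqv (M (M (M R S1) Rp) S2) (M (M (M R (M (M A1 G1) B1)) Rp) (M (M A2 G2) B2))"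
    by (intro cong refl over sym[OF S1] sym[OF S2])
  moreover have "eqv (M (M (M (M (M A2 G2) B2) Rp) (M (M A1 G1) B1)) R) (M (M (M S2 Rp) S1) R)"
    by (intro cong refl over S1 S2)
  ultimately show ?thesis
    unfolding eqv_def[symmetric] by (blast intro: trans)
qed

section \<open>Restriction to positive indices\<close>

lemma pos_idx: "{1..int n} \<subseteq> idx ty n"
  by (auto simp: idx_def)

lemma idx_le: "m \<in> idx ty n \<Longrightarrow> m \<le> int n"
  by (auto simp: idx_def split: if_splits)

text \<open>
  With \<open>s = 1/x\<close> this is the matrix \<open>R\<^sup>\<circ>(x)\<close> of the reflection algebra.
\<close>

definition R_perm :: "'a \<Rightarrow> (int \<times> int, 'a::ring_1) mtx"
  where "R_perm s = (\<lambda>(i, k) (j, l). (if i = j \<and> k = l then 1 else 0) - s * (if i = l \<and> k = j then 1 else 0))"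

lemma R_perm_mmul:
  assumes "finite I" "i \<in> I" "k \<in> I"
  shows "mmul (I \<times> I) (R_perm s) M (i, k) y = M (i, k) y - s * M (k, i) y"
proof -
  have "mmul (I \<times> I) (R_perm s) M (i, k) y =
    (\<Sum>a\<in>I. \<Sum>b\<in>I. (if b = k then if a = i then M (a, b) y else 0 else 0)
      - s * (if b = i then if a = k then M (a, b) y else 0 else 0))"
    unfolding mmul_def sum.cartesian_product' R_perm_def
    by (intro sum.cong) (auto simp: algebra_simps)
  then show ?thesis
    using assms by (simp add: sum_subtractf sum_distrib_left[symmetric])
qed

lemma mmul_R_perm:
  assumes "finite I" "j \<in> I" "l \<in> I"
  shows "mmul (I \<times> I) M (R_perm s) x (j, l) = M x (j, l) - M x (l, j) * s"
proof -
  have "mmul (I \<times> I) M (R_perm s) x (j, l) =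
    (\<Sum>a\<in>I. \<Sum>b\<in>I. (if b = l then if a = j then M x (a, b) else 0 else 0)
      - (if b = j then if a = l then M x (a, b) * s else 0 else 0))"
    unfolding mmul_def sum.cartesian_product' R_perm_def
    by (intro sum.cong) (auto simp: algebra_simps)
  then show ?thesis
    using assms by (simp add: sum_subtractf)
qed

lemma kron_R_perm_kron:
  assumes I: "finite I" and idx: "i \<in> I" "k \<in> I" "j \<in> I" "l \<in> I"
  shows "mmul (I \<times> I) (mmul (I \<times> I) (kron A mone) (R_perm s)) (kron mone B) (i, k) (j, l) =
      A i j * B k l - (if j = k then (\<Sum>a\<in>I. A i a * s * B a l) else 0)"
    and "mmul (I \<times> I) (mmul (I \<times> I) (kron mone B) (R_perm s)) (kron A mone) (i, k) (j, l) =
      B k l * A i j - (if i = l then (\<Sum>a\<in>I. B k a * s * A a j) else 0)"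
proof -
  have "mmul (I \<times> I) (mmul (I \<times> I) (kron A mone) (R_perm s)) (kron mone B) (i, k) (j, l) =
     (\<Sum>a\<in>I. \<Sum>b\<in>I. if a = j then mmul (I \<times> I) (kron A mone) (R_perm s) (i, k) (j, b) * B b l else 0)"
    unfolding mmul_def[of "I \<times> I" "mmul _ _ _"] sum.cartesian_product'
    by (intro sum.cong) (auto simp: kron_def mone_def)
  also have "\<dots> = (\<Sum>a\<in>I. if a = j then (\<Sum>b\<in>I.
      (if b = k then A i j * B b l else 0) - (if k = j then A i b * s * B b l else 0)) else 0)"
    using idx by (intro sum.cong refl) (auto simp: mmul_R_perm[OF I] kron_def mone_def algebra_simps intro!: sum.cong)
  also have "\<dots> = A i j * B k l - (if j = k then (\<Sum>a\<in>I. A i a * s * B a l) else 0)"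
    using I idx by (auto simp: sum_subtractf)
  finally show "mmul (I \<times> I) (mmul (I \<times> I) (kron A mone) (R_perm s)) (kron mone B) (i, k) (j, l) =
      A i j * B k l - (if j = k then (\<Sum>a\<in>I. A i a * s * B a l) else 0)" .
  have "mmul (I \<times> I) (mmul (I \<times> I) (kron mone B) (R_perm s)) (kron A mone) (i, k) (j, l) =
     (\<Sum>a\<in>I. \<Sum>b\<in>I. if b = l then mmul (I \<times> I) (kron mone B) (R_perm s) (i, k) (a, l) * A a j else 0)"
    unfolding mmul_def[of "I \<times> I" "mmul _ _ _"] sum.cartesian_product'
    by (intro sum.cong) (auto simp: kron_def mone_def)
  also have "\<dots> = (\<Sum>a\<in>I.
      (if a = i then B k l * A a j else 0) - (if i = l then B k a * s * A a j else 0))"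
    using I idx by (intro sum.cong refl) (auto simp: mmul_R_perm[OF I] kron_def mone_def algebra_simps)
  also have "\<dots> = B k l * A i j - (if i = l then (\<Sum>a\<in>I. B k a * s * A a j) else 0)"
    using I idx by (auto simp: sum_subtractf)
  finally show "mmul (I \<times> I) (mmul (I \<times> I) (kron mone B) (R_perm s)) (kron A mone) (i, k) (j, l) =
      B k l * A i j - (if i = l then (\<Sum>a\<in>I. B k a * s * A a j) else 0)" .
qed

lemma scalar_cancel_left_ideal:
  assumes L: "left_ideal_in C L" and q: "q \<noteq> 0" "lift2 (inverse q) \<in> C" and m: "lift2 q * f \<in> L"
  shows "f \<in> L"
proof -
  have "lift2 (inverse q) * (lift2 q * f) = lift2 (inverse q * q) * f"
    by (simp only: ring_map_simps(4)[OF ring_map_lift2] mult.assoc)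
  also have "\<dots> = f"
    using q(1) by (simp add: ring_map_simps(2)[OF ring_map_lift2])
  finally show ?thesis
    using left_ideal_inD(5)[OF L q(2) m] by simp
qed

lemma const2_of_nat: "const2 (of_nat m) = of_nat m"
  by (simp add: const2_def fls_of_nat)

lemma lift2_of_nat: "lift2 (of_nat m) = of_nat m"
  by (induction m) (simp_all add: ring_map_simps(1,2,3)[OF ring_map_lift2])

lemma left_ideal_cancel:
  assumes L: "left_ideal_in C L" and "a - b \<in> L"
  shows "a \<in> L \<longleftrightarrow> b \<in> L"
  using left_ideal_inD(4)[OF L assms(2), of b] left_ideal_inD(7)[OF L _ assms(2), of a] by auto

text \<open>
  Let \<open>J\<close> be the set of positive indices, and compare the two sides of the reflection equation, modulo the
  left ideal \<open>L\<close>, in the columns \<open>(l, j)\<close> with \<open>l, j \<in> J\<close>. An entry \<open>s\<^sub>m\<^sub>j\<close> with \<open>m \<le> 0 < j\<close> standing on the right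
  is in \<open>L\<close>. Therefore the inner sums reduce to \<open>J\<close>, and \<open>Q\<close> contributes neither between the two factors, where
  it produces \<open>s\<^sub>-\<^sub>l\<^sub>,\<^sub>j\<close>, nor on the right, where it needs \<open>j = - l\<close>.

  In a row \<open>(k, i)\<close> with \<open>k \<le> 0 < i\<close> the right side is in \<open>L\<close>, and the left one becomes
  \<open>Y\<^sub>k\<^sub>i + \<delta>\<^sub>i\<^sub>,\<^sub>-\<^sub>k W/(u - v - \<kappa>)\<close>, with \<open>Y = S\<^sub>1(u) R(u + v) S\<^sub>2(v)\<close> and \<open>W\<close> the sum of the \<open>Y\<^sub>-\<^sub>c\<^sub>,\<^sub>c\<close> over \<open>J\<close>. Summing over
  \<open>k = - i\<close> gives \<open>(1 + n/(u - v - \<kappa>)) W \<in> L\<close>, so \<open>W \<in> L\<close> and all these \<open>Y\<^sub>k\<^sub>i\<close> are in \<open>L\<close>. The same device removes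
  the \<open>P\<close> from \<open>Y\<close>: summing over \<open>l = i\<close> yields \<open>(1 - n/(u + v)) \<Sum>\<^sub>m s\<^sub>k\<^sub>m(u) s\<^sub>m\<^sub>j(v) \<in> L\<close>. This proves the first
  claim. In rows with \<open>k, i \<in> J\<close> the left \<open>Q\<close> does not contribute either, since it needs \<open>i = - k\<close>, and what
  remains is the reflection equation with \<open>P\<close> alone.
\<close>

lemma restricted_reflection:
  fixes S :: "(int, 'g free_alg fls) mtx" and C L :: "'g free_alg set"
  assumes L: "left_ideal_in C L" and scalar: "range scalar \<subseteq> C"
    and S: "\<And>i j. i \<in> idx ty n \<Longrightarrow> j \<in> idx ty n \<Longrightarrow> S i j \<in> fls_over C"
    and SL: "\<And>i j. i \<in> idx ty n \<Longrightarrow> i \<le> 0 \<Longrightarrow> j \<in> {1..int n} \<Longrightarrow> S i j \<in> fls_over L"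
  defines "M \<equiv> mmul (idx2 ty n)" and "Mp \<equiv> mmul ({1..int n} \<times> {1..int n})"
    and "R \<equiv> R_at ty n (U_ser - V_ser)" and "Rp \<equiv> R_at ty n (U_ser + V_ser)"
    and "S1 \<equiv> kron (at_u S) mone" and "S2 \<equiv> kron mone (at_v S)"
    and "s \<equiv> lift2 (inverse (U_ser - V_ser))" and "s' \<equiv> lift2 (inverse (U_ser + V_ser))"
  assumes refl: "\<And>p q. p \<in> idx2 ty n \<Longrightarrow> q \<in> idx2 ty n \<Longrightarrow>
      M (M (M R S1) Rp) S2 p q - M (M (M S2 Rp) S1) R p q \<in> fls_over (fls_over L)"
  shows "\<And>k l i j. k \<in> idx ty n \<Longrightarrow> k \<le> 0 \<Longrightarrow> l \<in> {1..int n} \<Longrightarrow> i \<in> {1..int n} \<Longrightarrow> j \<in> {1..int n} \<Longrightarrow>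
      in_u (S k l) * fls_const (S i j) \<in> fls_over (fls_over L)" (is "\<And>k l i j. _ \<Longrightarrow> _ \<Longrightarrow> _ \<Longrightarrow> _ \<Longrightarrow> _ \<Longrightarrow> ?P1 k l i j")
    and "\<And>p q. p \<in> {1..int n} \<times> {1..int n} \<Longrightarrow> q \<in> {1..int n} \<times> {1..int n} \<Longrightarrow>
      Mp (Mp (Mp (R_perm s) S1) (R_perm s')) S2 p q - Mp (Mp (Mp S2 (R_perm s')) S1) (R_perm s) p q
        \<in> fls_over (fls_over L)"
proof -
  let ?J = "{1..int n}" and ?I = "idx ty n"
  define L2 where "L2 = fls_over (fls_over L)"
  define C2 where "C2 = fls_over (fls_over C)"
  have L2: "left_ideal_in C2 L2"
    unfolding L2_def C2_def by (intro left_ideal_in_fls_over L)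
  have C2: "closed_set C2"
    by (rule left_ideal_inD(1)[OF L2])
  note ideal = left_ideal_inD[OF L2] and closed = closed_setD[OF C2]
  have lift2: "lift2 q \<in> C2" for q
    using scalar by (auto simp: C2_def fls_over_def)
  define a where "a = at_u S"
  define b where "b = at_v S"
  have C0: "0 \<in> C" "0 \<in> L" "0 \<in> fls_over L" "0 \<in> fls_over C"
    using left_ideal_inD(3)[OF L] closed_setD(1)[OF left_ideal_inD(1)[OF L]] by (auto simp: fls_over_def)
  have aC: "a i j \<in> C2" and bC: "b i j \<in> C2" if "i \<in> ?I" "j \<in> ?I" for i j
    unfolding a_def b_def C2_def
    using S[OF that] C0 left_ideal_inD(1)[OF L] by (auto intro: in_u_over fls_const_over)
  have aL: "a i j \<in> L2" and bL: "b i j \<in> L2" if "i \<in> ?I" "i \<le> 0" "j \<in> ?J" for i j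
    unfolding a_def b_def L2_def
    using SL[OF that] C0 by (auto intro: fls_const_over fls_map_over)
  have J: "\<And>j. j \<in> ?J \<Longrightarrow> j \<in> ?I"
    using pos_idx by blast
  have split: "(\<Sum>m\<in>?I. f m) = (\<Sum>m\<in>?J. f m) + (\<Sum>m\<in>?I - ?J. f m)" for f :: "int \<Rightarrow> 'g free_alg fls fls"
    using sum.subset_diff[OF pos_idx finite_idx, of f] by (simp add: add.commute)
  define t where "t = (lift2 (inverse (U_ser - V_ser - const2 (kappa ty n))) :: 'g free_alg fls fls)"
  define t' where "t' = (lift2 (inverse (U_ser + V_ser - const2 (kappa ty n))) :: 'g free_alg fls fls)"
  have st: "s \<in> C2" "t \<in> C2" "s' \<in> C2" "t' \<in> C2"
    unfolding s_def t_def s'_def t'_def by (rule lift2)+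
  have R: "R = R_of ty s t" "Rp = R_of ty s' t'"
    by (simp_all add: R_def Rp_def R_at_def s_def t_def s'_def t'_def)
  define Y where "Y = M (M S1 Rp) S2"
  define N where "N = M (M S2 Rp) S1"
  define X where "X = (\<lambda>c j. \<Sum>m\<in>?J. a c m * s' * b m j)"
  define Z where "Z = (\<lambda>d p. \<Sum>m\<in>?J. b d m * s' * a m p)"
  define Y0 where "Y0 = (\<lambda>c d l j. a c l * b d j - (if l = d then X c j else 0))"
  define N0 where "N0 = (\<lambda>c d p q. b d q * a c p - (if c = q then Z d p else 0))"
  have sgn: "sign_of ty m \<in> C2" for m
    by (rule sign_of_over[OF C2])
  have YY0: "Y (c, d) (l, j) - Y0 c d l j \<in> L2"
    if "c \<in> ?I" "d \<in> ?I" "l \<in> ?J" "j \<in> ?J" for c d l j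
  proof -
    have "Y (c, d) (l, j) - Y0 c d l j = - (if l = d then (\<Sum>m\<in>?I - ?J. a c m * s' * b m j) else 0)
        + a c (- d) * t' * (sign_of ty (- d) * sign_of ty l) * b (- l) j"
      unfolding Y_def M_def S1_def S2_def R a_def[symmetric] b_def[symmetric]
      using that J by (auto simp: kron_R_of_kron Y0_def X_def split)
    moreover have "(\<Sum>m\<in>?I - ?J. a c m * s' * b m j) \<in> L2"
      using that by (intro left_ideal_sum[OF L2] ideal(5) closed(5) st aC bL) (auto dest: idx_le)
    moreover have "a c (- d) * t' * (sign_of ty (- d) * sign_of ty l) * b (- l) j \<in> L2"
      using that J by (intro ideal(5) closed(5) st aC bL sgn) auto
    ultimately show ?thesis
      by (auto intro: ideal(3,4,6,7))
  qed
  have NN0: "N (c, d) (p, q) - N0 c d p q \<in> L2"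
    if "c \<in> ?I" "d \<in> ?I" "p \<in> ?J" "q \<in> ?J" for c d p q
  proof -
    have "N (c, d) (p, q) - N0 c d p q = - (if c = q then (\<Sum>m\<in>?I - ?J. b d m * s' * a m p) else 0)
        + b d (- c) * t' * (sign_of ty c * sign_of ty (- q)) * a (- q) p"
      unfolding N_def M_def S1_def S2_def R a_def[symmetric] b_def[symmetric]
      using that J by (auto simp: kron_R_of_kron N0_def Z_def split)
    moreover have "(\<Sum>m\<in>?I - ?J. b d m * s' * a m p) \<in> L2"
      using that by (intro left_ideal_sum[OF L2] ideal(5) closed(5) st bC aL) (auto dest: idx_le)
    moreover have "b d (- c) * t' * (sign_of ty c * sign_of ty (- q)) * a (- q) p \<in> L2"
      using that J by (intro ideal(5) closed(5) st bC aL sgn) auto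
    ultimately show ?thesis
      by (auto intro: ideal(3,4,6,7))
  qed
  have Y_right: "Y (c, d) (l, j) \<in> L2" if "c \<in> ?I" "d \<in> ?I" "d \<le> 0" "l \<in> ?J" "j \<in> ?J" for c d l j
  proof -
    have "Y0 c d l j \<in> L2"
      using that J by (auto simp: Y0_def intro!: ideal(5) aC bL)
    then show ?thesis
      using left_ideal_cancel[OF L2 YY0[OF that(1,2,4,5)]] by simp
  qed
  have N_left: "N (c, d) (p, q) \<in> L2" if "c \<in> ?I" "d \<in> ?I" "c \<le> 0" "p \<in> ?J" "q \<in> ?J" for c d p q
  proof -
    have "N0 c d p q \<in> L2"
      using that J by (auto simp: N0_def intro!: ideal(5) aL bC)
    then show ?thesis
      using left_ideal_cancel[OF L2 NN0[OF that(1,2,4,5)]] by simp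
  qed
  have exp: "(Y (k, i) (l, j) - s * Y (i, k) (l, j)
      + (if i = - k then t * (\<Sum>c\<in>?I. sign_of ty k * sign_of ty c * Y (c, - c) (l, j)) else 0))
      - (N (k, i) (l, j) - N (k, i) (j, l) * s) \<in> L2"
    if "k \<in> ?I" "i \<in> ?I" "l \<in> ?J" "j \<in> ?J" for k i l j
  proof -
    have "M (M (M R S1) Rp) S2 = M R Y"
      by (simp add: Y_def M_def mmul_assoc)
    moreover have "j \<noteq> - l" using that by auto
    ultimately show ?thesis
      using refl[of "(k, i)" "(l, j)"] that J
      by (simp add: L2_def N_def[symmetric] R(1))
        (simp add: M_def R_of_mmul mmul_R_of split: if_splits)
  qed
  have comm: "N x y * s = s * N x y" for x y
    unfolding s_def by (rule lift2_commute[symmetric])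
  define W where "W = (\<lambda>l j. \<Sum>c\<in>?J. Y (- c, c) (l, j))"
  \<comment> \<open>In the term of \<open>Q\<close> the summand with second index \<open>c \<in> J\<close> carries the sign \<open>1\<close>, because \<open>k\<close> and \<open>- c\<close>
    are both negative; the other summands are in \<open>L\<close>.\<close>
  have YtW: "Y (k, i) (l, j) + (if i = - k then t * W l j else 0) \<in> L2"
    if "k \<in> ?I" "k \<le> 0" "i \<in> ?J" "l \<in> ?J" "j \<in> ?J" for k i l j
  proof -
    have sumW: "t * (\<Sum>c\<in>?I. sign_of ty k * sign_of ty c * Y (c, - c) (l, j)) - t * W l j \<in> L2" if "i = - k"
    proof -
      have "(\<Sum>c\<in>?I. sign_of ty k * sign_of ty c * Y (c, - c) (l, j)) =
          (\<Sum>c\<in>?I. sign_of ty k * sign_of ty (- c) * Y (- c, c) (l, j))"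
        by (subst sum_idx_uminus[symmetric]) simp
      also have "\<dots> = (\<Sum>c\<in>?J. sign_of ty k * sign_of ty (- c) * Y (- c, c) (l, j))
          + (\<Sum>c\<in>?I - ?J. sign_of ty k * sign_of ty (- c) * Y (- c, c) (l, j))"
        by (rule split)
      also have "(\<Sum>c\<in>?J. sign_of ty k * sign_of ty (- c) * Y (- c, c) (l, j)) = W l j"
        unfolding W_def
        using \<open>i \<in> ?J\<close> that by (intro sum.cong) (auto simp: sign_of_def sgn_if)
      finally have "t * (\<Sum>c\<in>?I. sign_of ty k * sign_of ty c * Y (c, - c) (l, j)) - t * W l j =
          t * (\<Sum>c\<in>?I - ?J. sign_of ty k * sign_of ty (- c) * Y (- c, c) (l, j))"
        by (simp add: distrib_left)
      also have "\<dots> \<in> L2"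
        using \<open>l \<in> ?J\<close> \<open>j \<in> ?J\<close>
        by (intro ideal(5) st left_ideal_sum[OF L2] closed(5) sgn Y_right) (auto dest: idx_le)
      finally show ?thesis .
    qed
    have "s * Y (i, k) (l, j) \<in> L2" "N (k, i) (l, j) \<in> L2" "N (k, i) (j, l) * s \<in> L2"
      unfolding comm using that J by (auto intro!: ideal(5) st Y_right N_left)
    define Q where "Q = t * (\<Sum>c\<in>?I. sign_of ty k * sign_of ty c * Y (c, - c) (l, j))"
    have rearrange: "(y - y' + q - (m - m')) + (y' + (m - m')) = y + q" for y y' q m m' :: "'g free_alg fls fls"
      by simp
    have "(Y (k, i) (l, j) - s * Y (i, k) (l, j) + (if i = - k then Q else 0) - (N (k, i) (l, j) - N (k, i) (j, l) * s))
        + (s * Y (i, k) (l, j) + (N (k, i) (l, j) - N (k, i) (j, l) * s)) \<in> L2"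
      unfolding Q_def
      by (intro ideal(4)[OF exp[OF that(1) J[OF that(3)] that(4,5)]] ideal(4) ideal(7)) fact+
    then have YQ: "Y (k, i) (l, j) + (if i = - k then Q else 0) \<in> L2"
      unfolding rearrange .
    show ?thesis
    proof (cases "i = - k")
      case True
      have "(Y (k, i) (l, j) + Q) - (Q - t * W l j) \<in> L2"
        by (rule ideal(7)) (use YQ sumW[OF True] True in \<open>simp_all add: Q_def\<close>)
      with True show ?thesis by simp
    qed (use YQ in simp)
  qed
  have W: "W l j \<in> L2" if "l \<in> ?J" "j \<in> ?J" for l j
  proof (rule scalar_cancel_left_ideal[OF L2 _ lift2])
    let ?x = "U_ser - V_ser - const2 (kappa ty n)"
    have nz: "?x \<noteq> 0" "U_ser - V_ser - const2 (kappa ty n - of_nat n) \<noteq> 0"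
      by (rule U_minus_V_nonzero)+
    have "const2 (kappa ty n - of_nat n) = const2 (kappa ty n) - of_nat n"
      by (simp only: ring_map_simps(6)[OF const2_hom] const2_of_nat)
    \<comment> \<open>The factor \<open>1 + n/(u - v - \<kappa>)\<close> is invertible because \<open>u - v - \<kappa> + n\<close> is not zero.\<close>
    with nz(2) have "?x + of_nat n \<noteq> 0"
      by (simp add: algebra_simps)
    then show "1 + of_nat n * inverse ?x \<noteq> 0"
      using nz(1) by (simp add: field_simps)
    have Wlj: "(\<Sum>i\<in>?J. Y (- i, i) (l, j)) = W l j"
      by (simp add: W_def)
    have "(\<Sum>i\<in>?J. Y (- i, i) (l, j) + t * W l j) \<in> L2"
    proof (rule left_ideal_sum[OF L2])
      fix i assume i: "i \<in> ?J"
      then show "Y (- i, i) (l, j) + t * W l j \<in> L2"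
        using YtW[of "- i" i l j] that J[OF i] by simp
    qed
    also have "(\<Sum>i\<in>?J. Y (- i, i) (l, j) + t * W l j) = lift2 (1 + of_nat n * inverse ?x) * W l j"
      by (simp add: sum.distrib Wlj ring_map_simps(2,3,4)[OF ring_map_lift2] lift2_of_nat t_def
          distrib_right mult.assoc)
    finally show "lift2 (1 + of_nat n * inverse ?x) * W l j \<in> L2" .
  qed
  have Y_left: "Y0 k i l j \<in> L2" if "k \<in> ?I" "k \<le> 0" "i \<in> ?J" "l \<in> ?J" "j \<in> ?J" for k i l j
  proof -
    have "Y (k, i) (l, j) \<in> L2"
      using YtW[OF that] ideal(7)[OF _ ideal(5)[OF st(2) W[OF that(4,5)]], of "Y (k, i) (l, j) + t * W l j"]
      by (cases "i = - k") auto
    then show ?thesis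
      using left_ideal_cancel[OF L2 YY0[OF that(1) J[OF that(3)] that(4,5)]] by simp
  qed
  have X: "X k j \<in> L2" if "k \<in> ?I" "k \<le> 0" "j \<in> ?J" for k j
  proof -
    define X' where "X' = (\<Sum>m\<in>?J. a k m * b m j)"
    have comm': "q * s' = s' * q" for q
      unfolding s'_def by (rule lift2_commute[symmetric])
    have X': "X k j = s' * X'"
      by (simp add: X_def X'_def sum_distrib_left comm' mult.assoc)
    have "X' \<in> L2"
    proof (rule scalar_cancel_left_ideal[OF L2 _ lift2])
      \<comment> \<open>The factor \<open>1 - n/(u + v)\<close> is invertible because \<open>u + v - n\<close> is not zero.\<close>
      have "U_ser + V_ser - of_nat n \<noteq> 0"
        using U_minus_V_nonzero(3)[of "of_nat n"] by (simp add: const2_of_nat)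
      then show "1 - of_nat n * inverse (U_ser + V_ser) \<noteq> 0"
        using U_minus_V_nonzero(4) by (simp add: field_simps)
      have "(\<Sum>m\<in>?J. Y0 k m m j) \<in> L2"
        by (intro left_ideal_sum[OF L2] Y_left that)
      also have "(\<Sum>m\<in>?J. Y0 k m m j) = lift2 (1 - of_nat n * inverse (U_ser + V_ser)) * X'"
        by (simp add: Y0_def X' sum_subtractf X'_def[symmetric] ring_map_simps(2,4,6)[OF ring_map_lift2] lift2_of_nat
            s'_def left_diff_distrib mult.assoc)
      finally show "lift2 (1 - of_nat n * inverse (U_ser + V_ser)) * X' \<in> L2" .
    qed
    then show ?thesis
      unfolding X' by (intro ideal(5) st)
  qed
  show "in_u (S k l) * fls_const (S i j) \<in> fls_over (fls_over L)"
    if "k \<in> ?I" "k \<le> 0" "l \<in> ?J" "i \<in> ?J" "j \<in> ?J" for k l i j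
    using ideal(4)[OF Y_left[OF that(1,2,4,3,5)], of "if l = i then X k j else 0"] X[OF that(1,2,5)] ideal(3)
    by (auto simp: Y0_def a_def b_def L2_def split: if_splits)
  show "Mp (Mp (Mp (R_perm s) S1) (R_perm s')) S2 p q - Mp (Mp (Mp S2 (R_perm s')) S1) (R_perm s) p q
        \<in> fls_over (fls_over L)" if "p \<in> ?J \<times> ?J" "q \<in> ?J \<times> ?J" for p q
  proof -
    obtain k i l j where pq: "p = (k, i)" "q = (l, j)" by (cases p; cases q)
    with that have idx: "k \<in> ?J" "i \<in> ?J" "l \<in> ?J" "j \<in> ?J" by auto
    have fin: "finite ?J" by simp
    have Y0: "Mp (Mp S1 (R_perm s')) S2 (c, d) (l, j) = Y0 c d l j"
      if "c \<in> ?J" "d \<in> ?J" "l \<in> ?J" "j \<in> ?J" for c d l j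
      unfolding Mp_def S1_def S2_def a_def[symmetric] b_def[symmetric]
      using that by (auto simp: kron_R_perm_kron[OF fin] Y0_def X_def)
    have N0: "Mp (Mp S2 (R_perm s')) S1 (c, d) (l, j) = N0 c d l j"
      if "c \<in> ?J" "d \<in> ?J" "l \<in> ?J" "j \<in> ?J" for c d l j
      unfolding Mp_def S1_def S2_def a_def[symmetric] b_def[symmetric]
      using that by (auto simp: kron_R_perm_kron[OF fin] N0_def Z_def)
    have "Mp (Mp (Mp (R_perm s) S1) (R_perm s')) S2 p q = Mp (R_perm s) (Mp (Mp S1 (R_perm s')) S2) p q"
      by (simp add: Mp_def mmul_assoc)
    also have "\<dots> = Y0 k i l j - s * Y0 i k l j"
      unfolding pq Mp_def R_perm_mmul[OF fin idx(1,2)] unfolding Mp_def[symmetric] using idx by (simp add: Y0)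
    finally have l: "Mp (Mp (Mp (R_perm s) S1) (R_perm s')) S2 p q = Y0 k i l j - s * Y0 i k l j" .
    have "Mp (Mp (Mp S2 (R_perm s')) S1) (R_perm s) p q = N0 k i l j - N0 k i j l * s"
      unfolding pq Mp_def mmul_R_perm[OF fin idx(3,4)] unfolding Mp_def[symmetric] using idx by (simp add: N0)
    then have r: "Mp (Mp (Mp S2 (R_perm s')) S1) (R_perm s) p q = N0 k i l j - s * N0 k i j l"
      unfolding s_def by (simp add: lift2_commute)
    have ki: "i \<noteq> - k" using idx by auto
    have "(Y (k, i) (l, j) - s * Y (i, k) (l, j)) - (N (k, i) (l, j) - s * N (k, i) (j, l)) \<in> L2"
      using exp[OF J[OF idx(1)] J[OF idx(2)] idx(3,4)] ki by (simp add: comm)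
    moreover have "(Y (k, i) (l, j) - Y0 k i l j) - s * (Y (i, k) (l, j) - Y0 i k l j)
       - ((N (k, i) (l, j) - N0 k i l j) - s * (N (k, i) (j, l) - N0 k i j l)) \<in> L2"
      using YY0[OF J[OF idx(1)] J[OF idx(2)] idx(3,4)] YY0[OF J[OF idx(2)] J[OF idx(1)] idx(3,4)]
        NN0[OF J[OF idx(1)] J[OF idx(2)] idx(3,4)] NN0[OF J[OF idx(1)] J[OF idx(2)] idx(4,3)]
      by (rule ideal(7)[OF ideal(7)[OF _ ideal(5)[OF st(1)]] ideal(7)[OF _ ideal(5)[OF st(1)]]])
    ultimately have "((Y (k, i) (l, j) - s * Y (i, k) (l, j)) - (N (k, i) (l, j) - s * N (k, i) (j, l)))
      - ((Y (k, i) (l, j) - Y0 k i l j) - s * (Y (i, k) (l, j) - Y0 i k l j)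
       - ((N (k, i) (l, j) - N0 k i l j) - s * (N (k, i) (j, l) - N0 k i j l))) \<in> L2"
      by (rule ideal(7))
    then show ?thesis
      unfolding l r by (simp add: L2_def algebra_simps)
  qed
qed

section \<open>Homomorphisms of presented algebras and constant terms\<close>

text \<open>
  The quotient by the generated ideal is described in terms of the ring operations of the type.
\<close>

lemma pclass_ring_map:
  assumes Rels: "Rels \<subseteq> carrier (free_algebra G)"
  defines "A \<equiv> presented_algebra G Rels" and "cls \<equiv> pclass G Rels"
  shows "ring A" and "carrier A = cls ` carrier (free_algebra G)"
    and "cls 1 = \<one>\<^bsub>A\<^esub>"
    and "\<And>f g. f \<in> carrier (free_algebra G) \<Longrightarrow> g \<in> carrier (free_algebra G) \<Longrightarrow> cls (f + g) = cls f \<oplus>\<^bsub>A\<^esub> cls g"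
    and "\<And>f g. f \<in> carrier (free_algebra G) \<Longrightarrow> g \<in> carrier (free_algebra G) \<Longrightarrow> cls (f * g) = cls f \<otimes>\<^bsub>A\<^esub> cls g"
    and "\<And>f. f \<in> genideal (free_algebra G) Rels \<Longrightarrow> cls f = \<zero>\<^bsub>A\<^esub>"
    and "\<And>f g. f \<in> carrier (free_algebra G) \<Longrightarrow> g \<in> carrier (free_algebra G) \<Longrightarrow> cls f = cls g
      \<Longrightarrow> f - g \<in> genideal (free_algebra G) Rels"
proof -
  let ?F = "free_algebra G"
  interpret F: ring ?F by (rule free_algebra_ring)
  interpret ideal "genideal ?F Rels" ?F
    by (rule F.genideal_ideal[OF Rels])
  have hom: "cls \<in> ring_hom ?F A"
    using rcos_ring_hom by (simp add: cls_def A_def pclass_def[abs_def] presented_algebra_def)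
  show "ring A"
    unfolding A_def presented_algebra_def by (rule quotient_is_ring)
  show "carrier A = cls ` carrier ?F"
    by (auto simp: A_def presented_algebra_def cls_def pclass_def FactRing_def A_RCOSETS_def')
  show "cls 1 = \<one>\<^bsub>A\<^esub>"
    using ring_hom_one[OF hom] by (simp add: fa_sel)
  show "cls (f + g) = cls f \<oplus>\<^bsub>A\<^esub> cls g" "cls (f * g) = cls f \<otimes>\<^bsub>A\<^esub> cls g"
    if "f \<in> carrier ?F" "g \<in> carrier ?F" for f g
    using ring_hom_add[OF hom that] ring_hom_mult[OF hom that] by (simp_all add: fa_sel)
  show "cls f = \<zero>\<^bsub>A\<^esub>" if "f \<in> genideal ?F Rels" for f
    using a_rcos_const[OF that]
    by (simp add: A_def presented_algebra_def cls_def pclass_def FactRing_def)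
  show "f - g \<in> genideal ?F Rels" if "f \<in> carrier ?F" "g \<in> carrier ?F" "cls f = cls g" for f g
  proof -
    have "f \<in> genideal ?F Rels +>\<^bsub>?F\<^esub> g"
      using a_rcos_self[OF that(1)] that(3) by (simp add: cls_def pclass_def)
    then obtain h where "h \<in> genideal ?F Rels" "f = h + g"
      by (auto simp: a_r_coset_def' fa_sel)
    then show ?thesis by simp
  qed
qed

text \<open>
  The homomorphism of free algebras given by the images of the generators.
\<close>

definition alg_hom :: "('g \<Rightarrow> 'h free_alg) \<Rightarrow> 'g free_alg \<Rightarrow> 'h free_alg"
  where "alg_hom x f = (\<Sum>w\<in>Poly_Mapping.keys f. scalar (Poly_Mapping.lookup f w) * prod_list (map x (letters w)))"

lemma alg_hom_superset:
  assumes "finite K" "Poly_Mapping.keys f \<subseteq> K"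
  shows "alg_hom x f = (\<Sum>w\<in>K. scalar (Poly_Mapping.lookup f w) * prod_list (map x (letters w)))"
  unfolding alg_hom_def using assms by (intro sum.mono_neutral_left) (auto simp: in_keys_iff)

lemma alg_hom_single: "alg_hom x (Poly_Mapping.single w c) = scalar c * prod_list (map x (letters w))"
  by (subst alg_hom_superset[of "{w}"]) auto

lemma alg_hom_add: "alg_hom x (f + g) = alg_hom x f + alg_hom x g"
proof -
  let ?K = "Poly_Mapping.keys f \<union> Poly_Mapping.keys g"
  have "Poly_Mapping.keys (f + g) \<subseteq> ?K" by (rule Poly_Mapping.keys_add)
  then show ?thesis
    by (subst (1 2 3) alg_hom_superset[of ?K])
      (auto simp: lookup_add ring_map_simps(3)[OF ring_map_scalar] distrib_right sum.distrib)
qed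

lemma ring_map_alg_hom:
  fixes x :: "'g \<Rightarrow> 'h free_alg"
  shows "ring_map (alg_hom x)"
proof -
  have one: "alg_hom x 1 = 1"
  proof -
    have "alg_hom x (Poly_Mapping.single 0 1) = 1"
      unfolding alg_hom_single by (simp add: zero_free_word_def ring_map_simps(2)[OF ring_map_scalar])
    then show ?thesis by (simp only: single_one)
  qed
  have zero: "alg_hom x 0 = 0"
    by (simp add: alg_hom_def)
  have single: "alg_hom x (Poly_Mapping.single v c * Poly_Mapping.single w d) =
      alg_hom x (Poly_Mapping.single v c) * alg_hom x (Poly_Mapping.single w d)" for v w c d
  proof -
    have "a * (scalar d * b) = scalar d * (a * b)" for a b :: "'h free_alg"
      by (simp only: mult.assoc[symmetric] scalar_commute[of d a])
    then have "scalar c * scalar d * (a * b) = scalar c * a * (scalar d * b)" for a b :: "'h free_alg"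
      by (simp add: mult.assoc)
    then show ?thesis
      by (simp add: mult_single alg_hom_single plus_free_word_def ring_map_simps(4)[OF ring_map_scalar])
  qed
  have "alg_hom x (Poly_Mapping.single v c * g) = alg_hom x (Poly_Mapping.single v c) * alg_hom x g" for v c g
    by (induction g rule: poly_mapping_single_induct) (simp_all add: zero single alg_hom_add distrib_left)
  then have "alg_hom x (f * g) = alg_hom x f * alg_hom x g" for f g
    by (induction f rule: poly_mapping_single_induct) (simp_all add: zero alg_hom_add distrib_right)
  then show ?thesis
    by (simp add: ring_map_def one alg_hom_add)
qed

lemma alg_hom_gen: "alg_hom x (gen g) = x g"
  unfolding gen_def by (simp add: alg_hom_single ring_map_simps(2)[OF ring_map_scalar])

lemma alg_hom_scalar: "alg_hom x (scalar c) = scalar c"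
  unfolding scalar_def alg_hom_single by (simp add: zero_free_word_def scalar_def)

text \<open>
  The elements of \<open>A[[u\<^sup>-\<^sup>1]]\<close> among the Laurent series in \<open>u\<^sup>-\<^sup>1\<close>.
\<close>

definition power_series :: "'a::zero fls \<Rightarrow> bool"
  where "power_series f \<longleftrightarrow> (\<forall>r<0. fls_nth f r = 0)"

lemma power_series_mult:
  assumes "power_series f" "power_series g"
  shows "power_series (f * g)" and "fls_nth (f * g :: 'a::ring_1 fls) 0 = fls_nth f 0 * fls_nth g 0"
  using fls_times_nth_bounds[of 0 f 0 g] assms by (auto simp: power_series_def)

lemma power_series_sum: "(\<And>i. i \<in> I \<Longrightarrow> power_series (f i)) \<Longrightarrow> power_series (sum f I :: 'a::ring_1 fls)"
  by (induction I rule: infinite_finite_induct) (auto simp: power_series_def)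

lemma mmul_power_series:
  assumes "\<And>i j. i \<in> I \<Longrightarrow> j \<in> I \<Longrightarrow> power_series (A i j)" "\<And>i j. i \<in> I \<Longrightarrow> j \<in> I \<Longrightarrow> power_series (B i j)" "i \<in> I" "j \<in> I"
  shows "power_series (mmul I A B i j)"
    and "fls_nth (mmul I A B i j :: 'a::ring_1 fls) 0 = mmul I (\<lambda>i j. fls_nth (A i j) 0) (\<lambda>i j. fls_nth (B i j) 0) i j"
  using assms by (auto simp: mmul_def fls_nth_sum power_series_mult intro!: power_series_sum sum.cong)

text \<open>
  From \<open>1 - c u g = g (1 - c u) + (1 - g)\<close> the quotient by \<open>1 - c u\<close> is \<open>g\<close> up to a series of positive order.
\<close>

lemma g_ser_low:
  assumes "admissible ty n"
  shows "power_series (g_ser ty i)" "fls_nth (g_ser ty i) 0 = gdiag ty i"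
proof -
  have "power_series (g_ser ty i) \<and> fls_nth (g_ser ty i) 0 = gdiag ty i"
  proof (cases "constant_G ty")
    case True
    then show ?thesis by (simp add: g_ser_def G_ser_def G_mat_def power_series_def)
  next
    case False
    define c where "c = (4 / (of_nat (par_p ty) - of_nat (par_q ty)) :: complex)"
    have "par_p ty \<noteq> par_q ty"
      using False assms by (cases ty) (auto simp: constant_G_def)
    then have "c \<noteq> 0" by (simp add: c_def)
    let ?d = "1 - fls_const c * u_ser"
    note nz = linear_denominator_nonzero[OF \<open>c \<noteq> 0\<close>]
    have "fls_subdegree ?d = - 1"
      by (rule fls_subdegree_eqI) (use \<open>c \<noteq> 0\<close> in \<open>auto simp: u_ser_def\<close>)
    then have inv: "fls_nth (inverse ?d) r = 0" if "r \<le> 0" for r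
      using that by simp
    have "g_ser ty i = (1 - fls_const c * u_ser * fls_const (gdiag ty i)) / ?d"
      using False by (simp add: g_ser_def G_ser_def G_mat_def mone_def Let_def c_def)
    also have "1 - fls_const c * u_ser * fls_const (gdiag ty i) =
        fls_const (gdiag ty i) * ?d + fls_const (1 - gdiag ty i)"
      by (simp add: algebra_simps fls_minus_const[symmetric])
    also have "\<dots> / ?d = fls_const (gdiag ty i) + fls_const (1 - gdiag ty i) * inverse ?d"
      using nz by (simp add: divide_inverse distrib_right mult.assoc)
    finally show ?thesis
      by (simp add: power_series_def inv)
  qed
  then show "power_series (g_ser ty i)" "fls_nth (g_ser ty i) 0 = gdiag ty i" by simp_all
qed

text \<open>
  The constant term of a product of power series is the product of the constant terms, and those of \<open>T\<close>
  and its transpose are the identity modulo the relations \<open>t\<^sub>i\<^sub>j\<^sup>(\<^sup>0\<^sup>) = \<delta>\<^sub>i\<^sub>j\<close>.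
\<close>

lemma S_mat_low:
  assumes adm: "admissible ty n" and ij: "i \<in> idx ty n" "j \<in> idx ty n"
  shows "power_series (S_mat ty n i j)"
    and "fls_nth (S_mat ty n i j) 0 - (if i = j then scalar (gdiag ty i) else 0) \<in> X_ideal ty n"
proof -
  let ?I = "idx ty n" and ?C = "X_car ty n" and ?J = "X_ideal ty n"
  have ser: "power_series (ser_at w a)" "fls_nth (ser_at w a) 0 = a 0" for w and a :: "nat \<Rightarrow> yindex free_alg"
    by (simp_all add: ser_at_def power_series_def)
  define h where "h = fls_const (kappa ty n / 2)"
  define T where "T = (T_at (u_ser - h) :: (int, yindex free_alg fls) mtx)"
  define G where "G = (\<lambda>i j. lift1 (G_ser ty i j) :: yindex free_alg fls)"
  define T' where "T' = Tt_at ty n (- u_ser + h)"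
  have S: "S_mat ty n = mmul ?I (mmul ?I T G) T'"
    by (simp add: S_mat_def Let_def h_def T_def G_def T'_def)
  have T: "power_series (T i j)" "fls_nth (T i j) 0 = t_gen i j 0" for i j
    by (simp_all add: T_def T_at_def ser)
  have sign: "fls_nth (sign_of ty i * f) r = sign_of ty i * fls_nth f r" for i r and f :: "yindex free_alg fls"
    by (auto simp: sign_of_def sgn_if)
  have T': "power_series (T' i j)" "fls_nth (T' i j) 0 = sign_of ty i * sign_of ty j * t_gen (- j) (- i) 0"
    if "i \<in> ?I" "j \<in> ?I" for i j
    using ser by (simp_all add: T'_def Tt_at_eq that T_at_def mult.assoc sign power_series_def)
  have G: "power_series (G i j)" "fls_nth (G i j) 0 = (if i = j then scalar (gdiag ty i) else 0)" for i j
    using g_ser_low[OF adm, of i] by (auto simp: G_def G_ser_eq power_series_def)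
  have TG: "power_series (mmul ?I T G i j)"
    "fls_nth (mmul ?I T G i j) 0 = mmul ?I (\<lambda>i j. fls_nth (T i j) 0) (\<lambda>i j. fls_nth (G i j) 0) i j"
    if "i \<in> ?I" "j \<in> ?I" for i j
    by (rule mmul_power_series; simp add: T G that)+
  show "power_series (S_mat ty n i j)"
    unfolding S by (rule mmul_power_series; simp add: TG T' ij)
  have S0: "fls_nth (S_mat ty n i j) 0 =
      mmul ?I (\<lambda>i j. fls_nth (mmul ?I T G i j) 0) (\<lambda>i j. fls_nth (T' i j) 0) i j"
    unfolding S by (rule mmul_power_series; simp add: TG T' ij)
  note L = ideal_inD(1)[OF X_ideal] and C = fa_closed_set[of "X_gens ty n"]
  have rel: "t_gen i j 0 - mone i j \<in> ?J" if "i \<in> ?I" "j \<in> ?I" for i j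
    using ring.genideal_self[OF free_algebra_ring X_rels_carrier[of ty n]] that
    unfolding X_ideal_def X_rels_def by blast
  have T0: "cong_mtx ?I ?C ?J (\<lambda>i j. fls_nth (T i j) 0) mone"
    using rel mone_over[OF C, of ?I] by (auto simp: cong_mtx_def T t_gen_over mtx_over_def)
  have T'0: "cong_mtx ?I ?C ?J (\<lambda>i j. fls_nth (T' i j) 0) mone"
  proof (rule cong_mtx_entry[OF L])
    show "(\<lambda>i j. fls_nth (T' i j) 0) \<in> mtx_over ?I ?C"
      by (auto simp: mtx_over_def T' intro!: closed_setD(5)[OF C] sign_of_over[OF C] t_gen_over)
    show "mone \<in> mtx_over ?I ?C" by (rule mone_over[OF C])
    fix i j assume ij: "i \<in> ?I" "j \<in> ?I"
    have "sign_of ty i * sign_of ty j * (t_gen (- j) (- i) 0 - mone (- j) (- i)) \<in> ?J"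
      using ij by (intro left_ideal_inD(5)[OF L] closed_setD(5)[OF C] sign_of_over[OF C] rel) auto
    also have "sign_of ty i * sign_of ty j * (t_gen (- j) (- i) 0 - mone (- j) (- i)) =
        fls_nth (T' i j) 0 - mone i j"
      using sign_of_sq(1)[OF ij(1)] by (auto simp: T' ij mone_def right_diff_distrib)
    finally show "fls_nth (T' i j) 0 - mone i j \<in> ?J" .
  qed
  have G0: "cong_mtx ?I ?C ?J (\<lambda>i j. fls_nth (G i j) 0) (\<lambda>i j. fls_nth (G i j) 0)"
    using C by (intro cong_mtx_refl[OF L]) (auto simp: mtx_over_def G fa_scalar closed_set_def)
  have "cong_mtx ?I ?C ?J
      (mmul ?I (mmul ?I (\<lambda>i j. fls_nth (T i j) 0) (\<lambda>i j. fls_nth (G i j) 0)) (\<lambda>i j. fls_nth (T' i j) 0))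
      (mmul ?I (mmul ?I mone (\<lambda>i j. fls_nth (G i j) 0)) mone)"
    by (intro cong_mtx_mmul[OF X_ideal] T0 T'0 G0)
  then have main: "mmul ?I (mmul ?I (\<lambda>i j. fls_nth (T i j) 0) (\<lambda>i j. fls_nth (G i j) 0)) (\<lambda>i j. fls_nth (T' i j) 0) i j
      - mmul ?I (mmul ?I mone (\<lambda>i j. fls_nth (G i j) 0)) mone i j \<in> ?J"
    using ij unfolding cong_mtx_def by blast
  have unit: "mmul ?I (mmul ?I mone N) mone i j = N i j" for N :: "(int, yindex free_alg) mtx"
    using ij by (simp add: mmul_def mone_def if_distrib[of "\<lambda>x. x * _"] if_distrib[of "\<lambda>x. _ * x"] cong: if_cong)
  have "fls_nth (S_mat ty n i j) 0 =
      mmul ?I (mmul ?I (\<lambda>i j. fls_nth (T i j) 0) (\<lambda>i j. fls_nth (G i j) 0)) (\<lambda>i j. fls_nth (T' i j) 0) i j"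
    unfolding S0 using ij by (auto simp: mmul_def[of _ _ "\<lambda>i j. fls_nth (T' i j) 0"] TG intro!: sum.cong)
  with main show "fls_nth (S_mat ty n i j) 0 - (if i = j then scalar (gdiag ty i) else 0) \<in> X_ideal ty n"
    by (simp only: unit G(2))
qed

section \<open>The action on the annihilated subspace\<close>

text \<open>
  A module is given over the twisted Yangian only, so an element of the free algebra acts on it when its
  class lies in that subalgebra.
\<close>

definition Xtw_lift :: "pair_type \<Rightarrow> nat \<Rightarrow> yindex free_alg set"
  where "Xtw_lift ty n = {f \<in> X_car ty n. X_class ty n f \<in> carrier (Xtw_alg ty n)}"

definition annihilator ::
  "pair_type \<Rightarrow> nat \<Rightarrow> (yindex free_alg set \<Rightarrow> 'v \<Rightarrow> 'v::ab_group_add) \<Rightarrow> 'v \<Rightarrow> yindex free_alg set"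
  where "annihilator ty n \<rho> v = {f \<in> Xtw_lift ty n. \<rho> (X_class ty n f) v = 0}"

lemma X_class_facts:
  shows "ring (X_alg ty n)" and "carrier (X_alg ty n) = X_class ty n ` X_car ty n"
    and "X_class ty n 1 = \<one>\<^bsub>X_alg ty n\<^esub>"
    and "f \<in> X_car ty n \<Longrightarrow> g \<in> X_car ty n \<Longrightarrow> X_class ty n (f + g) = X_class ty n f \<oplus>\<^bsub>X_alg ty n\<^esub> X_class ty n g"
    and "f \<in> X_car ty n \<Longrightarrow> g \<in> X_car ty n \<Longrightarrow> X_class ty n (f * g) = X_class ty n f \<otimes>\<^bsub>X_alg ty n\<^esub> X_class ty n g"
    and "f \<in> X_ideal ty n \<Longrightarrow> X_class ty n f = \<zero>\<^bsub>X_alg ty n\<^esub>"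
  unfolding X_alg_def X_class_def X_ideal_def
  by (rule pclass_ring_map[OF X_rels_carrier]; assumption)+

lemma S_mat_over: "S_mat ty n \<in> mtx_over (idx ty n) (fls_over (X_car ty n))"
proof -
  have "fls_subdegree (u_ser - fls_const (kappa ty n / 2)) = - 1"
    "fls_subdegree (- u_ser + fls_const (kappa ty n / 2)) = - 1"
    by (auto simp: u_ser_def intro!: fls_subdegree_eqI)
  then show ?thesis
    unfolding S_mat_def Let_def
    by (intro mmul_over closed_set_fls_over fa_closed_set T_at_over Tt_at_over) (auto simp: mtx_over_def lift1_over)
qed

lemma Xtw_lift_facts:
  shows "closed_set (Xtw_lift ty n)" and "range scalar \<subseteq> Xtw_lift ty n"
    and "i \<in> idx ty n \<Longrightarrow> j \<in> idx ty n \<Longrightarrow> fls_nth (S_mat ty n i j) r \<in> Xtw_lift ty n"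
    and "X_ideal ty n \<subseteq> Xtw_lift ty n"
proof -
  let ?A = "X_alg ty n" and ?cls = "X_class ty n" and ?C = "X_car ty n"
  let ?H = "range (X_scalar ty n) \<union> {s_coeff ty n i j r | i j r. i \<in> idx ty n \<and> j \<in> idx ty n}"
  interpret ring ?A by (rule X_class_facts)
  have tw: "carrier (Xtw_alg ty n) = generate_ring ?A ?H"
    by (simp add: Xtw_alg_def)
  have S: "fls_nth (S_mat ty n i j) r \<in> ?C" if "i \<in> idx ty n" "j \<in> idx ty n" for i j r
    using S_mat_over that by (auto simp: mtx_over_def fls_over_def)
  have H: "?H \<subseteq> carrier ?A"
    using S unfolding X_class_facts(2) by (auto simp: X_scalar_def s_coeff_def fa_scalar)
  note sub = subringE[OF generate_ring_is_subring[OF H]]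
  note C = closed_setD[OF fa_closed_set[of "X_gens ty n"]]
  show scalar: "range scalar \<subseteq> Xtw_lift ty n"
    unfolding Xtw_lift_def tw
    by (auto simp: fa_scalar intro!: generate_ring.incl) (auto simp: X_scalar_def)
  show "fls_nth (S_mat ty n i j) r \<in> Xtw_lift ty n" if "i \<in> idx ty n" "j \<in> idx ty n"
    unfolding Xtw_lift_def tw using S[OF that] that
    by (auto intro!: generate_ring.incl) (auto simp: s_coeff_def)
  show "X_ideal ty n \<subseteq> Xtw_lift ty n"
    unfolding Xtw_lift_def tw using sub(2) left_ideal_inD(2)[OF ideal_inD(1)[OF X_ideal]]
    by (auto simp: X_class_facts(6))
  have "scalar 0 \<in> Xtw_lift ty n" "scalar 1 \<in> Xtw_lift ty n" "scalar (- 1) \<in> Xtw_lift ty n"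
    using scalar by blast+
  moreover have "f + g \<in> Xtw_lift ty n" "f * g \<in> Xtw_lift ty n"
    if "f \<in> Xtw_lift ty n" "g \<in> Xtw_lift ty n" for f g
    using that sub C by (auto simp: Xtw_lift_def tw X_class_facts(4,5))
  moreover have "scalar (- 1) * f = - f" for f :: "yindex free_alg"
    by (simp add: ring_map_simps(2,5)[OF ring_map_scalar])
  ultimately show "closed_set (Xtw_lift ty n)"
    unfolding closed_set_def by (metis ring_map_simps(1,2)[OF ring_map_scalar])
qed

lemma Xtw_action:
  assumes rep: "Xtw_rep ty n scale \<rho>"
  defines "act \<equiv> \<lambda>f. \<rho> (X_class ty n f)"
  shows "vector_space scale"
    and "f \<in> Xtw_lift ty n \<Longrightarrow> g \<in> Xtw_lift ty n \<Longrightarrow> act (f + g) v = act f v + act g v"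
    and "f \<in> Xtw_lift ty n \<Longrightarrow> g \<in> Xtw_lift ty n \<Longrightarrow> act (f * g) v = act f (act g v)"
    and "f \<in> Xtw_lift ty n \<Longrightarrow> act f (v + w) = act f v + act f w"
    and "f \<in> Xtw_lift ty n \<Longrightarrow> act f (scale c v) = scale c (act f v)"
    and "act (scalar c) v = scale c v"
    and "f \<in> X_ideal ty n \<Longrightarrow> act f v = 0"
proof -
  note r = rep[unfolded Xtw_rep_def algebra_representation_def]
  have ops: "mult (Xtw_alg ty n) = mult (X_alg ty n)" "add (Xtw_alg ty n) = add (X_alg ty n)"
    by (simp_all add: Xtw_alg_def)
  have mem: "f \<in> X_car ty n" "X_class ty n f \<in> carrier (Xtw_alg ty n)" if "f \<in> Xtw_lift ty n" for f
    using that by (simp_all add: Xtw_lift_def)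
  show "vector_space scale" using r by simp
  show add: "act (f + g) v = act f v + act g v" if "f \<in> Xtw_lift ty n" "g \<in> Xtw_lift ty n" for f g v
    using r mem[OF that(1)] mem[OF that(2)] by (simp add: act_def X_class_facts(4) ops)
  show "act (f * g) v = act f (act g v)" if "f \<in> Xtw_lift ty n" "g \<in> Xtw_lift ty n"
    using r mem[OF that(1)] mem[OF that(2)] by (simp add: act_def X_class_facts(5) ops)
  show "act f (v + w) = act f v + act f w" "act f (scale c v) = scale c (act f v)" if "f \<in> Xtw_lift ty n"
    using r mem[OF that] by (simp_all add: act_def)
  show "act (scalar c) v = scale c v"
    using r by (simp add: act_def X_scalar_def)
  show "act f v = 0" if "f \<in> X_ideal ty n"
  proof -
    have 0: "0 \<in> X_ideal ty n"
      by (rule left_ideal_inD(3)[OF ideal_inD(1)[OF X_ideal]])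
    have "act 0 v = act 0 v + act 0 v"
      using add[of 0 0 v] 0 Xtw_lift_facts(4) by auto
    moreover have "act f = act 0"
      using that 0 by (simp add: act_def X_class_facts(6))
    ultimately show ?thesis by simp
  qed
qed

text \<open>
  This is what makes it possible to compute with vectors inside the free algebra: \<open>f v = 0\<close> reads as membership of \<open>f\<close>
  in a left ideal that contains all relations.
\<close>

lemma left_ideal_annihilator:
  assumes rep: "Xtw_rep ty n scale \<rho>"
  shows "left_ideal_in (Xtw_lift ty n) (annihilator ty n \<rho> v)"
    and "X_ideal ty n \<subseteq> annihilator ty n \<rho> v"
proof -
  note act = Xtw_action[OF rep]
  show ideal: "X_ideal ty n \<subseteq> annihilator ty n \<rho> v"
    using Xtw_lift_facts(4) by (auto simp: annihilator_def act(7))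
  interpret vector_space scale by (rule act)
  have 0: "0 \<in> annihilator ty n \<rho> v"
    using ideal left_ideal_inD(3)[OF ideal_inD(1)[OF X_ideal]] by blast
  have "\<rho> (X_class ty n c) 0 = 0" if "c \<in> Xtw_lift ty n" for c
    using act(5)[OF that, of 0 0] by simp
  then show "left_ideal_in (Xtw_lift ty n) (annihilator ty n \<rho> v)"
    using 0 closed_setD[OF Xtw_lift_facts(1)]
    by (auto simp: left_ideal_in_def Xtw_lift_facts(1) annihilator_def act(2,3))
qed

lemma V_J_iff:
  "v \<in> V_J ty n \<rho> \<longleftrightarrow>
    (\<forall>i\<in>idx ty n. i \<le> 0 \<longrightarrow> (\<forall>j\<in>{1..int n}. S_mat ty n i j \<in> fls_over (annihilator ty n \<rho> v)))"
proof -
  have mem: "S_mat ty n i j \<in> fls_over (annihilator ty n \<rho> v) \<longleftrightarrow> (\<forall>r. \<rho> (s_coeff ty n i j r) v = 0)"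
    if "i \<in> idx ty n" "j \<in> {1..int n}" for i j
    using that pos_idx[of n ty] Xtw_lift_facts(3)[of i ty n j]
    by (auto simp: fls_over_def annihilator_def s_coeff_def)
  \<comment> \<open>The nonpositive indices are the negatives of the positive ones and, for odd \<open>N\<close>, zero.\<close>
  have nonpos: "(\<forall>i\<in>idx ty n. i \<le> 0 \<longrightarrow> P i) \<longleftrightarrow> (\<forall>m\<in>{1..int n}. P (- m)) \<and> (odd_N ty \<longrightarrow> P 0)" for P
  proof
    assume *: "\<forall>i\<in>idx ty n. i \<le> 0 \<longrightarrow> P i"
    then have "P (- m)" if "m \<in> {1..int n}" for m
      using that pos_idx[of n ty] by (auto intro!: bspec[OF *, THEN mp])
    moreover have "P 0" if "odd_N ty"
      using that * by (auto simp: idx_def)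
    ultimately show "(\<forall>m\<in>{1..int n}. P (- m)) \<and> (odd_N ty \<longrightarrow> P 0)" by blast
  next
    assume *: "(\<forall>m\<in>{1..int n}. P (- m)) \<and> (odd_N ty \<longrightarrow> P 0)"
    show "\<forall>i\<in>idx ty n. i \<le> 0 \<longrightarrow> P i"
    proof (intro ballI impI)
      fix i assume i: "i \<in> idx ty n" "i \<le> 0"
      then have "i = 0 \<and> odd_N ty \<or> - i \<in> {1..int n}"
        by (auto simp: idx_def split: if_splits)
      then show "P i"
        using * bspec[of "{1..int n}" "\<lambda>m. P (- m)" "- i"] by auto
    qed
  qed
  have "v \<in> V_J ty n \<rho> \<longleftrightarrow> (\<forall>m\<in>{1..int n}. \<forall>j\<in>{1..int n}. \<forall>r. \<rho> (s_coeff ty n (- m) j r) v = 0)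
      \<and> (odd_N ty \<longrightarrow> (\<forall>j\<in>{1..int n}. \<forall>r. \<rho> (s_coeff ty n 0 j r) v = 0))"
    unfolding V_J_def by blast
  also have "\<dots> \<longleftrightarrow> (\<forall>i\<in>idx ty n. i \<le> 0 \<longrightarrow> (\<forall>j\<in>{1..int n}. \<forall>r. \<rho> (s_coeff ty n i j r) v = 0))"
    by (rule nonpos[symmetric])
  also have "\<dots> \<longleftrightarrow> (\<forall>i\<in>idx ty n. i \<le> 0 \<longrightarrow> (\<forall>j\<in>{1..int n}. S_mat ty n i j \<in> fls_over (annihilator ty n \<rho> v)))"
    using mem by blast
  finally show ?thesis .
qed

lemma mmul_scale:
  assumes "\<And>x :: 'a::ring_1. c * x = x * c"
  shows "mmul I (\<lambda>x y. c * A x y) B = (\<lambda>x y. c * mmul I A B x y)"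
    and "mmul I A (\<lambda>x y. c * B x y) = (\<lambda>x y. c * mmul I A B x y)"
proof -
  have "a * (c * b) = c * (a * b)" for a b
    by (metis assms mult.assoc)
  then show "mmul I (\<lambda>x y. c * A x y) B = (\<lambda>x y. c * mmul I A B x y)"
    and "mmul I A (\<lambda>x y. c * B x y) = (\<lambda>x y. c * mmul I A B x y)"
    by (simp_all add: mmul_def sum_distrib_left mult.assoc)
qed

text \<open>
  The series \<open>[\<plusminus>] s\<^sub>i\<^sub>j(u)\<close>. The sign is built in from the start, since the reflection equation is quadratic and
  hence does not notice it.
\<close>

definition S_signed :: "pair_type \<Rightarrow> nat \<Rightarrow> (int, yindex free_alg fls) mtx"
  where "S_signed ty n = (\<lambda>i j. fls_const (scalar (pm_sign ty)) * S_mat ty n i j)"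

lemma S_signed_reflection:
  assumes adm: "admissible ty n" and rep: "Xtw_rep ty n scale \<rho>" and v: "v \<in> V_J ty n \<rho>"
  defines "Mp \<equiv> mmul ({1..int n} \<times> {1..int n})" and "L2 \<equiv> fls_over (fls_over (annihilator ty n \<rho> v))"
    and "S1 \<equiv> kron (at_u (S_signed ty n)) mone" and "S2 \<equiv> kron mone (at_v (S_signed ty n))"
    and "Rm \<equiv> R_perm (lift2 (inverse (U_ser - V_ser)))" and "Rp \<equiv> R_perm (lift2 (inverse (U_ser + V_ser)))"
  shows "\<And>k l i j. k \<in> idx ty n \<Longrightarrow> k \<le> 0 \<Longrightarrow> l \<in> {1..int n} \<Longrightarrow> i \<in> {1..int n} \<Longrightarrow> j \<in> {1..int n} \<Longrightarrow>
      in_u (S_signed ty n k l) * fls_const (S_signed ty n i j) \<in> L2"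
    and "\<And>p q. p \<in> {1..int n} \<times> {1..int n} \<Longrightarrow> q \<in> {1..int n} \<times> {1..int n} \<Longrightarrow>
      Mp (Mp (Mp Rm S1) Rp) S2 p q - Mp (Mp (Mp S2 Rp) S1) Rm p q \<in> L2"
proof -
  let ?L = "annihilator ty n \<rho> v" and ?C = "Xtw_lift ty n"
  let ?c = "lift2 (const2 (pm_sign ty)) :: yindex free_alg fls fls"
  note L = left_ideal_annihilator[OF rep, of v]
  have scalar: "scalar c \<in> ?C" for c
    using Xtw_lift_facts(2) by blast
  have S: "S_signed ty n i j \<in> fls_over ?C" if "i \<in> idx ty n" "j \<in> idx ty n" for i j
    using Xtw_lift_facts(3)[OF that] scalar
    by (auto simp: S_signed_def fls_over_def intro!: closed_setD(5)[OF Xtw_lift_facts(1)])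
  have SL: "S_signed ty n i j \<in> fls_over ?L" if "i \<in> idx ty n" "i \<le> 0" "j \<in> {1..int n}" for i j
    using v[unfolded V_J_iff] that scalar
    by (auto simp: S_signed_def fls_over_def intro!: left_ideal_inD(5)[OF L(1)])
  \<comment> \<open>The sign occurs once with each of the two parameters.\<close>
  have cc: "?c * ?c = 1"
    by (auto simp: pm_sign_def const2_def lift2_in_v lift1_const ring_map_simps[OF ring_map_scalar])
  have c: "in_u (S_signed ty n i j) = ?c * in_u (S_mat ty n i j)"
    "fls_const (S_signed ty n i j) = ?c * fls_const (S_mat ty n i j)" for i j
    unfolding S_signed_def ring_map_simps(4)[OF ring_map_in_u] ring_map_simps(4)[OF ring_map_fls_const]
    by (simp_all add: const2_def lift2_in_v lift1_const)
      (simp add: lift1_const[symmetric] lift2_in_u[symmetric] in_u_const const2_def lift2_in_v)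
  have kron: "kron (at_u (S_signed ty n)) mone = (\<lambda>x y. ?c * kron (at_u (S_mat ty n)) mone x y)"
    "kron mone (at_v (S_signed ty n)) = (\<lambda>x y. ?c * kron mone (at_v (S_mat ty n)) x y)"
    by (auto simp: fun_eq_iff c kron_def mone_def mult.assoc)
  note scale = mmul_scale[of ?c, OF lift2_commute]
  have refl: "mmul (idx2 ty n) (mmul (idx2 ty n) (mmul (idx2 ty n) (R_at ty n (U_ser - V_ser))
        (kron (at_u (S_signed ty n)) mone)) (R_at ty n (U_ser + V_ser))) (kron mone (at_v (S_signed ty n))) p q
    - mmul (idx2 ty n) (mmul (idx2 ty n) (mmul (idx2 ty n) (kron mone (at_v (S_signed ty n)))
        (R_at ty n (U_ser + V_ser))) (kron (at_u (S_signed ty n)) mone)) (R_at ty n (U_ser - V_ser)) p q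
    \<in> fls_over (fls_over ?L)" if "p \<in> idx2 ty n" "q \<in> idx2 ty n" for p q
  proof -
    have "X_ideal2 ty n \<subseteq> fls_over (fls_over ?L)"
      using L(2) by (auto simp: fls_over_def)
    then show ?thesis
      using reflection_equation[OF adm] that
      unfolding kron scale by (auto simp: cong_mtx_def mult.assoc[symmetric] cc)
  qed
  show "in_u (S_signed ty n k l) * fls_const (S_signed ty n i j) \<in> L2"
    if "k \<in> idx ty n" "k \<le> 0" "l \<in> {1..int n}" "i \<in> {1..int n}" "j \<in> {1..int n}" for k l i j
    unfolding L2_def
    by (rule restricted_reflection(1)[OF L(1) Xtw_lift_facts(2) S SL refl that])
  show "Mp (Mp (Mp Rm S1) Rp) S2 p q - Mp (Mp (Mp S2 Rp) S1) Rm p q \<in> L2"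
    if "p \<in> {1..int n} \<times> {1..int n}" "q \<in> {1..int n} \<times> {1..int n}" for p q
    unfolding L2_def Mp_def S1_def S2_def Rm_def Rp_def
    by (rule restricted_reflection(2)[OF L(1) Xtw_lift_facts(2) S SL refl that])
qed

text \<open>
  On nonnegative indices the sign of \<open>g\<^sub>i\<^sub>i\<close> changes exactly once, between \<open>m\<close> and \<open>m + 1\<close>.
\<close>

lemma bold_l_eq:
  assumes "m < n" "odd_N ty \<or> 1 \<le> m"
    and g: "\<And>i. 0 \<le> i \<Longrightarrow> gdiag ty i = (if i \<le> int m then \<gamma> else - \<gamma>)" and "\<gamma> = 1 \<or> \<gamma> = - 1"
  shows "int (bold_l ty n) = int n - int m"
proof -
  have "int m + 1 \<in> half_idx ty n" "int m \<in> half_idx ty n - {int n}"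
    using assms(1,2) by (auto simp: half_idx_def)
  then have "\<not> (\<forall>i\<in>half_idx ty n. gdiag ty i = 1)"
    using g[of "int m"] g[of "int m + 1"] \<open>\<gamma> = 1 \<or> \<gamma> = - 1\<close> by force
  moreover have "(THE k. int k \<in> half_idx ty n - {int n} \<and> gdiag ty (int k) \<noteq> gdiag ty (int k + 1)) = m"
  proof (rule the_equality)
    show "int m \<in> half_idx ty n - {int n} \<and> gdiag ty (int m) \<noteq> gdiag ty (int m + 1)"
      using assms by (auto simp: half_idx_def)
    show "k = m" if "int k \<in> half_idx ty n - {int n} \<and> gdiag ty (int k) \<noteq> gdiag ty (int k + 1)" for k
      using that g[of "int k"] g[of "int k + 1"] by (auto split: if_splits)
  qed
  ultimately show ?thesis
    using assms(1) by (simp add: bold_l_def bold_k_def)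
qed

text \<open>
  In type BI(b) the value \<open>- 1\<close> comes first, in the other types with a sign change the value \<open>1\<close>; the sign
  \<open>[\<plusminus>]\<close> compensates for this.
\<close>

lemma eps_eq_gdiag:
  assumes adm: "admissible ty n" and i: "i \<in> {1..int n}"
  shows "eps n (bold_l ty n) i = pm_sign ty * gdiag ty i"
proof -
  have all_one: ?thesis if "\<And>i. i \<in> half_idx ty n \<Longrightarrow> gdiag ty i = 1" "pm_sign ty = 1"
  proof -
    have "i \<in> half_idx ty n" using i by (auto simp: half_idx_def)
    with that i show ?thesis by (simp add: eps_def bold_l_def bold_k_def)
  qed
  have jump: ?thesis if "m < n" "odd_N ty \<or> 1 \<le> m"
    "\<And>i. 0 \<le> i \<Longrightarrow> gdiag ty i = (if i \<le> int m then \<gamma> else - \<gamma>)" "\<gamma> = 1 \<or> \<gamma> = - 1" "pm_sign ty = \<gamma>" for m \<gamma>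
    using bold_l_eq[OF that(1-4)] that(3)[of i] that(4,5) i by (auto simp: eps_def)
  show ?thesis
  proof (cases ty)
    case (BIa p q)
    with adm obtain m where m: "p = 2 * m + 1" by (auto elim: oddE)
    from adm BIa obtain k where "q = 2 * k" by (auto elim: evenE)
    then show ?thesis
      using adm BIa m by (intro jump[of m 1]) (auto simp: odd_N_def pm_sign_def)
  next
    case (BIb p q)
    with adm obtain m where m: "q = 2 * m + 1" by (auto elim: oddE)
    from adm BIb obtain k where "p = 2 * k" by (auto elim: evenE)
    then show ?thesis
      using adm BIb m by (intro jump[of m "- 1"]) (auto simp: odd_N_def pm_sign_def)
  next
    case (CII p q)
    with adm obtain m where m: "p = 2 * m" by (auto elim: evenE)
    from adm CII obtain k where "q = 2 * k" by (auto elim: evenE)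
    then show ?thesis
      using adm CII m by (intro jump[of m 1]) (auto simp: odd_N_def pm_sign_def)
  next
    case (DIa p q)
    with adm obtain m where m: "p = 2 * m" by (auto elim: evenE)
    from adm DIa obtain k where "q = 2 * k" by (auto elim: evenE)
    then show ?thesis
      using adm DIa m by (intro jump[of m 1]) (auto simp: odd_N_def pm_sign_def)
  qed (intro all_one; auto simp: half_idx_def odd_N_def pm_sign_def)+
qed

text \<open>
  The assignment \<open>b\<^sub>i\<^sub>j\<^sup>(\<^sup>r\<^sup>) \<mapsto> [\<plusminus>] s\<^sub>i\<^sub>j\<^sup>(\<^sup>r\<^sup>)\<close> on the level of free algebras.
\<close>

definition B_to_X :: "pair_type \<Rightarrow> nat \<Rightarrow> yindex free_alg \<Rightarrow> yindex free_alg"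
  where "B_to_X ty n = alg_hom (\<lambda>(i, j, r). fls_nth (S_signed ty n i j) (int r))"

lemma ring_map_B_to_X: "ring_map (B_to_X ty n)"
  unfolding B_to_X_def by (rule ring_map_alg_hom)

lemma B_to_X_b_gen: "B_to_X ty n (b_gen i j r) = fls_nth (S_signed ty n i j) (int r)"
  by (simp add: B_to_X_def b_gen_def alg_hom_gen)

lemma B_to_X_scalar: "B_to_X ty n (scalar c) = scalar c"
  by (simp add: B_to_X_def alg_hom_scalar)

lemma pm_sign_sq: "pm_sign ty * pm_sign ty = 1"
  by (simp add: pm_sign_def)

lemma S_signed_nth: "fls_nth (S_signed ty n i j) r = scalar (pm_sign ty) * fls_nth (S_mat ty n i j) r"
  by (simp add: S_signed_def)

lemma S_mat_of_signed: "fls_nth (S_mat ty n i j) r = scalar (pm_sign ty) * fls_nth (S_signed ty n i j) r"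
proof -
  have "scalar (pm_sign ty) * (scalar (pm_sign ty) * f) = f" for f :: "yindex free_alg"
    by (simp add: mult.assoc[symmetric] ring_map_simps(4)[OF ring_map_scalar, symmetric] pm_sign_sq
        ring_map_simps(2)[OF ring_map_scalar])
  then show ?thesis by (simp add: S_signed_nth)
qed

lemma S_signed_lift:
  assumes "i \<in> idx ty n" "j \<in> idx ty n"
  shows "fls_nth (S_signed ty n i j) r \<in> Xtw_lift ty n"
  unfolding S_signed_nth using Xtw_lift_facts(2)[of ty n] Xtw_lift_facts(3)[OF assms]
  by (intro closed_setD(5)[OF Xtw_lift_facts(1)]) auto

lemma V_J_subspace:
  assumes rep: "Xtw_rep ty n scale \<rho>"
  shows "module.subspace scale (V_J ty n \<rho>)"
proof -
  note act = Xtw_action[OF rep]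
  interpret vector_space scale by (rule act)
  have lift: "fls_nth (S_mat ty n i j) r \<in> Xtw_lift ty n"
    if "i \<in> {1..int n} \<or> - i \<in> {1..int n} \<or> odd_N ty \<and> i = 0" "j \<in> {1..int n}" for i j r
    using that by (intro Xtw_lift_facts(3)) (auto simp: idx_def)
  have zero: "\<rho> (X_class ty n f) 0 = 0" if "f \<in> Xtw_lift ty n" for f
    using act(5)[OF that, of 0 0] by simp
  show ?thesis
    by (rule subspaceI) (auto simp: V_J_def s_coeff_def act(4,5) zero lift)
qed

lemma V_J_stable:
  assumes adm: "admissible ty n" and rep: "Xtw_rep ty n scale \<rho>" and v: "v \<in> V_J ty n \<rho>"
    and ij: "i \<in> {1..int n}" "j \<in> {1..int n}"
  shows "\<rho> (X_class ty n (fls_nth (S_signed ty n i j) r)) v \<in> V_J ty n \<rho>"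
  unfolding V_J_iff
proof (intro ballI impI)
  note L = left_ideal_annihilator[OF rep, of v] and act = Xtw_action[OF rep]
  fix k l assume kl: "k \<in> idx ty n" "k \<le> 0" "l \<in> {1..int n}"
  let ?x = "fls_nth (S_signed ty n i j) r"
  have idx: "i \<in> idx ty n" "j \<in> idx ty n" "l \<in> idx ty n"
    using ij kl pos_idx[of n ty] by auto
  have "fls_nth (S_mat ty n k l) r' \<in> annihilator ty n \<rho> (\<rho> (X_class ty n ?x) v)" for r'
  proof -
    have "fls_nth (fls_nth (in_u (S_signed ty n k l) * fls_const (S_signed ty n i j)) r') r \<in> annihilator ty n \<rho> v"
      using S_signed_reflection(1)[OF adm rep v kl ij] by (simp add: fls_over_def)
    then have "fls_nth (S_signed ty n k l) r' * ?x \<in> annihilator ty n \<rho> v"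
      by (simp add: in_u_nth)
    then have "scalar (pm_sign ty) * (fls_nth (S_signed ty n k l) r' * ?x) \<in> annihilator ty n \<rho> v"
      using Xtw_lift_facts(2)[of ty n] by (rule_tac left_ideal_inD(5)[OF L(1)]) auto
    then have "fls_nth (S_mat ty n k l) r' * ?x \<in> annihilator ty n \<rho> v"
      by (simp add: S_mat_of_signed mult.assoc)
    then show ?thesis
      using act(3)[OF Xtw_lift_facts(3)[OF kl(1) idx(3)] S_signed_lift[OF idx(1,2)]]
        Xtw_lift_facts(3)[OF kl(1) idx(3)]
      by (simp add: annihilator_def)
  qed
  then show "S_mat ty n k l \<in> fls_over (annihilator ty n \<rho> (\<rho> (X_class ty n ?x) v))"
    by (simp add: fls_over_def)
qed

lemma B_to_X_stable:
  assumes adm: "admissible ty n" and rep: "Xtw_rep ty n scale \<rho>"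
    and f: "f \<in> carrier (free_algebra (B_gens n))"
  shows "B_to_X ty n f \<in> Xtw_lift ty n"
    and "v \<in> V_J ty n \<rho> \<Longrightarrow> \<rho> (X_class ty n (B_to_X ty n f)) v \<in> V_J ty n \<rho>"
proof -
  note act = Xtw_action[OF rep] and C = closed_setD[OF Xtw_lift_facts(1)[of ty n]]
  interpret vector_space scale by (rule act)
  note sub = subspace_0[OF V_J_subspace[OF rep]] subspace_add[OF V_J_subspace[OF rep]]
    subspace_scale[OF V_J_subspace[OF rep]]
  \<comment> \<open>The elements that act and preserve the subspace form a subalgebra.\<close>
  define K where "K = {f \<in> Xtw_lift ty n. \<forall>v\<in>V_J ty n \<rho>. \<rho> (X_class ty n f) v \<in> V_J ty n \<rho>}"
  have scalar: "scalar c \<in> K" for c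
    using Xtw_lift_facts(2)[of ty n] sub by (auto simp: K_def act(6))
  have "1 \<in> K" "0 \<in> K"
    using scalar[of 1] scalar[of 0] by (simp_all add: ring_map_simps(2)[OF ring_map_scalar])
  moreover have add: "f + g \<in> K" and mult: "f * g \<in> K" if "f \<in> K" "g \<in> K" for f g
    using that C sub by (auto simp: K_def act(2,3))
  moreover have "prod_list (map (\<lambda>(i, j, r). fls_nth (S_signed ty n i j) (int r)) w) \<in> K"
    if "set w \<subseteq> B_gens n" for w
    using that
  proof (induction w)
    case (Cons g w)
    obtain i j r where g: "g = (i, j, r)" by (cases g)
    with Cons.prems have "i \<in> {1..int n}" "j \<in> {1..int n}" by (auto simp: B_gens_def)
    moreover from this have "i \<in> idx ty n" "j \<in> idx ty n" using pos_idx[of n ty] by auto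
    ultimately have "fls_nth (S_signed ty n i j) (int r) \<in> K"
      using S_signed_lift V_J_stable[OF adm rep] by (simp add: K_def)
    then show ?case
      using Cons g mult by simp
  qed (simp add: \<open>1 \<in> K\<close>)
  moreover have "sum x W \<in> K" if "\<And>w. w \<in> W \<Longrightarrow> x w \<in> K" for x and W :: "yindex free_word set"
    using that by (induction W rule: infinite_finite_induct) (auto simp: \<open>0 \<in> K\<close> add)
  ultimately have "B_to_X ty n f \<in> K"
    unfolding B_to_X_def alg_hom_def using f scalar by (simp add: fa_carrier)
  then show "B_to_X ty n f \<in> Xtw_lift ty n"
    and "v \<in> V_J ty n \<rho> \<Longrightarrow> \<rho> (X_class ty n (B_to_X ty n f)) v \<in> V_J ty n \<rho>"
    by (auto simp: K_def)
qed

text \<open>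
  The image of a relation of the reflection algebra is either a constant term, which is zero modulo the
  relations of the Yangian, or a coefficient of the restricted reflection equation.
\<close>

lemma B_to_X_rels:
  assumes adm: "admissible ty n" and rep: "Xtw_rep ty n scale \<rho>" and v: "v \<in> V_J ty n \<rho>"
    and f: "f \<in> B_rels n (bold_l ty n)"
  shows "B_to_X ty n f \<in> annihilator ty n \<rho> v"
proof -
  let ?J = "{1..int n}" and ?J2 = "{1..int n} \<times> {1..int n}"
  let ?B1 = "kron (\<lambda>i j. ser_U (b_gen i j)) mone" and ?B2 = "kron mone (\<lambda>i j. ser_V (b_gen i j))"
  let ?R = "\<lambda>z x y. lift2 (R0_mat n z x y) :: yindex free_alg fls fls"
  let ?L = "mmul ?J2 (mmul ?J2 (mmul ?J2 (?R (U_ser - V_ser)) ?B1) (?R (U_ser + V_ser))) ?B2"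
  let ?L' = "mmul ?J2 (mmul ?J2 (mmul ?J2 ?B2 (?R (U_ser + V_ser))) ?B1) (?R (U_ser - V_ser))"
  note h = ring_map_B_to_X[of ty n]
  consider (const) i j where "i \<in> ?J" "j \<in> ?J" "f = b_gen i j 0 - mone i j * scalar (eps n (bold_l ty n) i)"
    | (refl) x y r s where "x \<in> ?J2" "y \<in> ?J2" "f = fls_nth (fls_nth (?L x y - ?L' x y) r) s"
    using f unfolding B_rels_def Let_def coeff_relators_def
    by (elim UnE CollectE exE conjE) blast+
  then show ?thesis
  proof cases
    case const
    have idx: "i \<in> idx ty n" "j \<in> idx ty n"
      using const pos_idx[of n ty] by auto
    have "scalar (pm_sign ty) * (fls_nth (S_mat ty n i j) 0 - (if i = j then scalar (gdiag ty i) else 0)) \<in> X_ideal ty n"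
      by (intro left_ideal_inD(5)[OF ideal_inD(1)[OF X_ideal]] S_mat_low[OF adm idx] fa_scalar)
    also have "scalar (pm_sign ty) * (fls_nth (S_mat ty n i j) 0 - (if i = j then scalar (gdiag ty i) else 0)) = B_to_X ty n f"
      by (simp add: const(3) ring_map_simps[OF h] B_to_X_b_gen B_to_X_scalar S_signed_nth mone_def right_diff_distrib
          eps_eq_gdiag[OF adm const(1)] ring_map_simps(4)[OF ring_map_scalar])
    finally show ?thesis
      using left_ideal_annihilator(2)[OF rep] by blast
  next
    case refl
    let ?h = "fls_map (fls_map (B_to_X ty n))"
    note h1 = ring_map_fls_map[OF h] and h2 = ring_map_fls_map[OF ring_map_fls_map[OF h]]
    note h0 = ring_map_simps(1)[OF h] ring_map_simps(1)[OF h1]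
    define S1 where "S1 = kron (at_u (S_signed ty n)) mone"
    define S2 where "S2 = kron mone (at_v (S_signed ty n))"
    have R: "?h (?R z x y) = R_perm (lift2 (inverse z)) x y" if xy: "x \<in> ?J2" "y \<in> ?J2" for z x y
    proof -
      have lift: "?h (lift2 q) = lift2 q" for q
        by (intro fls_eqI) (simp add: fls_map_nth h0 B_to_X_scalar)
      obtain i k j l where ijkl: "x = (i, k)" "y = (j, l)" by (cases x; cases y)
      have if01: "lift2 (if b then 1 else 0) = (if b then 1 else 0)" for b
        by (simp add: ring_map_simps(1,2)[OF ring_map_lift2])
      have R0: "R0_mat n z x y = (if i = j \<and> k = l then 1 else 0) - inverse z * (if i = l \<and> k = j then 1 else 0)"
        using xy by (simp add: ijkl R0_mat_def perm_P_eq mone_def)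
      show ?thesis
        unfolding lift unfolding R0 ring_map_simps(4,6)[OF ring_map_lift2] if01
        unfolding ijkl R_perm_def prod.case ..
    qed
    \<comment> \<open>The generators are indexed by natural numbers, the coefficients of \<open>s\<^sub>i\<^sub>j(u)\<close> by integers.\<close>
    have nonneg: "fls_nth (S_signed ty n i j) r = 0" if "i \<in> ?J" "j \<in> ?J" "r < 0" for i j r
    proof -
      have "i \<in> idx ty n" "j \<in> idx ty n" using that pos_idx[of n ty] by auto
      then show ?thesis
        using S_mat_low(1)[OF adm, of i j] that(3) by (simp add: power_series_def S_signed_nth)
    qed
    have ser: "?h (ser_U (b_gen i j)) = in_u (S_signed ty n i j)" "?h (ser_V (b_gen i j)) = fls_const (S_signed ty n i j)"
      if "i \<in> ?J" "j \<in> ?J" for i j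
      using nonneg[OF that]
      by (auto intro!: fls_eqI simp: fls_map_nth h0 ser_U_def ser_V_def in_u_nth B_to_X_b_gen not_less)
    have B: "?h (?B1 x y) = S1 x y" "?h (?B2 x y) = S2 x y" if "x \<in> ?J2" "y \<in> ?J2" for x y
      unfolding ring_map_kron_mone[OF h2] S1_def S2_def
      using that by (auto simp: kron_def ser)
    have L: "?h (?L x y) = mmul ?J2 (mmul ?J2 (mmul ?J2 (R_perm (lift2 (inverse (U_ser - V_ser)))) S1)
        (R_perm (lift2 (inverse (U_ser + V_ser))))) S2 x y"
      unfolding ring_map_mmul[OF h2] by (intro mmul_cong R B refl)
    have L': "?h (?L' x y) = mmul ?J2 (mmul ?J2 (mmul ?J2 S2 (R_perm (lift2 (inverse (U_ser + V_ser))))) S1)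
        (R_perm (lift2 (inverse (U_ser - V_ser)))) x y"
      unfolding ring_map_mmul[OF h2] by (intro mmul_cong R B refl)
    have "?h (?L x y - ?L' x y) \<in> fls_over (fls_over (annihilator ty n \<rho> v))"
      unfolding ring_map_simps(6)[OF h2] L L' S1_def S2_def
      by (rule S_signed_reflection(2)[OF adm rep v refl(1,2)])
    then show ?thesis
      by (simp add: fls_over_def fls_map_nth h0 refl(3))
  qed
qed

text \<open>
  The elements of the free algebra whose image annihilates the subspace form an ideal, because the image of
  the free algebra preserves the subspace. It contains the relations and thus the ideal generated by
  them, so the action descends to classes.
\<close>

lemma reflection_algebra_rep:
  assumes adm: "admissible ty n" and rep: "Xtw_rep ty n scale \<rho>"
  defines "l \<equiv> bold_l ty n"
  shows "\<exists>\<sigma>. B_rep n l scale (V_J ty n \<rho>) \<sigma> \<and>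
    (\<forall>f\<in>carrier (free_algebra (B_gens n)). \<forall>v\<in>V_J ty n \<rho>.
      \<sigma> (B_class n l f) v = \<rho> (X_class ty n (B_to_X ty n f)) v)"
proof -
  let ?F = "free_algebra (B_gens n)" and ?V = "V_J ty n \<rho>"
  define act where "act = (\<lambda>f. \<rho> (X_class ty n (B_to_X ty n f)))"
  note X = Xtw_action[OF rep] and h = ring_map_simps[OF ring_map_B_to_X[of ty n]]
  note lift = B_to_X_stable(1)[OF adm rep] and stable = B_to_X_stable(2)[OF adm rep]
  note cls = pclass_ring_map[OF B_rels_carrier[of n l], folded B_class_def B_alg_def]
  interpret vector_space scale by (rule X)
  have kernel: "act f v = 0" if "f \<in> genideal ?F (B_rels n l)" "v \<in> ?V" for f v
  proof -
    define K where "K = {f \<in> carrier ?F. \<forall>v\<in>?V. act f v = 0}"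
    have zero: "\<rho> (X_class ty n g) 0 = 0" if "g \<in> Xtw_lift ty n" for g
      using X(5)[OF that, of 0 0] by simp
    interpret F: ring ?F by (rule free_algebra_ring)
    have "ideal K ?F"
    proof (rule idealI[OF free_algebra_ring])
      show "subgroup K (add_monoid ?F)"
      proof (rule group.subgroupI)
        show "Group.group (add_monoid ?F)" by (rule F.a_group)
        show "K \<subseteq> carrier (add_monoid ?F)" by (auto simp: K_def)
        have "0 \<in> K"
          using X(6)[of 0] by (auto simp: K_def act_def h fa_carrier)
        then show "K \<noteq> {}" by blast
        fix f assume f: "f \<in> K"
        then have fc: "f \<in> carrier ?F" by (simp add: K_def)
        have "act (- f) v = - act f v" for v
        proof -
          have "act (- f) v + act f v = 0"
            using X(2)[OF lift[OF fa_neg[OF fc]] lift[OF fc], of v] X(6)[of 0 v] by (simp add: act_def h(5))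
          then show ?thesis by (simp add: eq_neg_iff_add_eq_0)
        qed
        then have neg: "- f \<in> K"
          using f fa_neg[OF fc] by (simp add: K_def)
        have "inv\<^bsub>add_monoid ?F\<^esub> f = - f"
          using F.add.inv_equality[of "- f" f] fc fa_neg[OF fc] by (simp add: fa_sel a_inv_def)
        with neg show "inv\<^bsub>add_monoid ?F\<^esub> f \<in> K" by simp
        fix g assume "g \<in> K"
        with f show "f \<otimes>\<^bsub>add_monoid ?F\<^esub> g \<in> K"
          by (auto simp: K_def act_def fa_sel fa_add h(3) X(2) lift)
      qed
      fix f g assume f: "f \<in> K" and g: "g \<in> carrier ?F"
      then show "g \<otimes>\<^bsub>?F\<^esub> f \<in> K" "f \<otimes>\<^bsub>?F\<^esub> g \<in> K"
        by (auto simp: K_def act_def fa_sel fa_mult h(4) X(3) lift stable zero)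
    qed
    moreover have "B_rels n l \<subseteq> K"
      using B_rels_carrier[of n l] B_to_X_rels[OF adm rep]
      by (auto simp: K_def act_def annihilator_def l_def)
    ultimately have "genideal ?F (B_rels n l) \<subseteq> K"
      by (rule F.genideal_minimal)
    with that show ?thesis by (auto simp: K_def)
  qed
  \<comment> \<open>A class acts through any of its representatives.\<close>
  define \<sigma> where "\<sigma> = (\<lambda>a. act (SOME f. f \<in> carrier ?F \<and> B_class n l f = a))"
  have \<sigma>: "\<sigma> (B_class n l f) v = act f v" if f: "f \<in> carrier ?F" and v: "v \<in> ?V" for f v
  proof -
    define g where "g = (SOME g. g \<in> carrier ?F \<and> B_class n l g = B_class n l f)"
    have g: "g \<in> carrier ?F" "B_class n l g = B_class n l f"
      using someI[of "\<lambda>g. g \<in> carrier ?F \<and> B_class n l g = B_class n l f" f] f by (auto simp: g_def)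
    have "act (g - f) v = 0"
      by (rule kernel[OF cls(7)[OF g(1) f g(2)] v])
    moreover have "act g v = act (g - f) v + act f v"
      using X(2)[OF lift[OF fa_diff[OF g(1) f]] lift[OF f], of v] by (simp add: act_def h(3)[symmetric])
    ultimately show ?thesis
      by (simp add: \<sigma>_def g_def)
  qed
  have "B_rep n l scale ?V \<sigma>"
    unfolding B_rep_def algebra_representation_def cls(2)
  proof (intro conjI ballI allI)
    show "vector_space scale" by (rule X)
    show "module.subspace scale ?V" by (rule V_J_subspace[OF rep])
    show "\<sigma> \<one>\<^bsub>B_alg n l\<^esub> v = v" if "v \<in> ?V" for v
      unfolding cls(3)[symmetric] using \<sigma>[OF fa_one that] X(6)[of 1 v]
      by (simp add: act_def h(2) ring_map_simps(2)[OF ring_map_scalar])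
    show "\<sigma> (B_scalar n l c) v = scale c v" if "v \<in> ?V" for c v
      unfolding B_scalar_def using \<sigma>[OF fa_scalar that] by (simp add: act_def B_to_X_scalar X(6))
    fix a assume "a \<in> B_class n l ` carrier ?F"
    then obtain f where a: "a = B_class n l f" and f: "f \<in> carrier ?F" by blast
    show "\<sigma> a v \<in> ?V" if "v \<in> ?V" for v
      using stable[OF f that] by (simp add: a \<sigma>[OF f that] act_def)
    show "\<sigma> a (v + w) = \<sigma> a v + \<sigma> a w" if "v \<in> ?V" "w \<in> ?V" for v w
      using subspace_add[OF V_J_subspace[OF rep] that]
      by (simp add: a \<sigma>[OF f] that act_def X(4)[OF lift[OF f]])
    show "\<sigma> a (scale c v) = scale c (\<sigma> a v)" if "v \<in> ?V" for c v
      using subspace_scale[OF V_J_subspace[OF rep] that]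
      by (simp add: a \<sigma>[OF f] that act_def X(5)[OF lift[OF f]])
    fix b assume "b \<in> B_class n l ` carrier ?F"
    then obtain g where b: "b = B_class n l g" and g: "g \<in> carrier ?F" by blast
    show "\<sigma> (a \<oplus>\<^bsub>B_alg n l\<^esub> b) v = \<sigma> a v + \<sigma> b v" if "v \<in> ?V" for v
      unfolding a b cls(4)[OF f g, symmetric]
      by (simp add: \<sigma> f g fa_add that) (simp add: act_def h(3) X(2) lift f g)
    show "\<sigma> (a \<otimes>\<^bsub>B_alg n l\<^esub> b) v = \<sigma> a (\<sigma> b v)" if "v \<in> ?V" for v
      unfolding a b cls(5)[OF f g, symmetric]
      using stable[OF g that] by (simp add: \<sigma> f g fa_mult that act_def h(4) X(3) lift)
  qed
  then show ?thesis
    using \<sigma> by (auto simp: act_def)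
qed

theorem proposition4p14:
  fixes ty :: pair_type and n :: nat
    and scale :: "complex \<Rightarrow> 'v \<Rightarrow> 'v::ab_group_add"
    and \<rho> :: "yindex free_alg set \<Rightarrow> 'v \<Rightarrow> 'v"
  assumes "admissible ty n"
    and "highest_weight_rep ty n scale \<rho>"
    and "\<exists>v :: 'v. v \<noteq> 0"
  shows
    "(\<forall>i\<in>{1..int n}. \<forall>j\<in>{1..int n}. \<forall>r. \<forall>v\<in>V_J ty n \<rho>.
        \<rho> (s_coeff ty n i j r) v \<in> V_J ty n \<rho>) \<and>
     (\<exists>\<sigma>. B_rep n (bold_l ty n) scale (V_J ty n \<rho>) \<sigma> \<and>
        (\<forall>i\<in>{1..int n}. \<forall>j\<in>{1..int n}. \<forall>r. \<forall>v\<in>V_J ty n \<rho>.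
          \<sigma> (b_coeff n (bold_l ty n) i j r) v =
            scale (pm_sign ty) (\<rho> (s_coeff ty n i j (int r)) v)))"
proof (intro conjI ballI allI)
  note adm = assms(1)
  have rep: "Xtw_rep ty n scale \<rho>"
    using assms(2) by (simp add: highest_weight_rep_def)
  note X = Xtw_action[OF rep]
  interpret vector_space scale by (rule X)
  have scalar: "scalar c \<in> Xtw_lift ty n" for c
    using Xtw_lift_facts(2) by blast
  have signed: "\<rho> (X_class ty n (fls_nth (S_signed ty n i j) r)) v = scale (pm_sign ty) (\<rho> (s_coeff ty n i j r) v)"
    and unsigned: "\<rho> (s_coeff ty n i j r) v = scale (pm_sign ty) (\<rho> (X_class ty n (fls_nth (S_signed ty n i j) r)) v)"
    if "i \<in> {1..int n}" "j \<in> {1..int n}" for i j r v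
  proof -
    have "i \<in> idx ty n" "j \<in> idx ty n" using that pos_idx[of n ty] by auto
    then show signed: "\<rho> (X_class ty n (fls_nth (S_signed ty n i j) r)) v = scale (pm_sign ty) (\<rho> (s_coeff ty n i j r) v)"
      using X(3)[OF scalar Xtw_lift_facts(3)] by (simp add: S_signed_nth s_coeff_def X(6))
    show "\<rho> (s_coeff ty n i j r) v = scale (pm_sign ty) (\<rho> (X_class ty n (fls_nth (S_signed ty n i j) r)) v)"
      unfolding signed by (simp add: pm_sign_sq)
  qed
  show "\<rho> (s_coeff ty n i j r) v \<in> V_J ty n \<rho>"
    if "i \<in> {1..int n}" "j \<in> {1..int n}" "v \<in> V_J ty n \<rho>" for i j r v
    unfolding unsigned[OF that(1,2)]
    by (intro subspace_scale[OF V_J_subspace[OF rep]] V_J_stable[OF adm rep that(3,1,2)])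
  obtain \<sigma> where \<sigma>: "B_rep n (bold_l ty n) scale (V_J ty n \<rho>) \<sigma>"
    "\<And>f v. f \<in> carrier (free_algebra (B_gens n)) \<Longrightarrow> v \<in> V_J ty n \<rho> \<Longrightarrow>
      \<sigma> (B_class n (bold_l ty n) f) v = \<rho> (X_class ty n (B_to_X ty n f)) v"
    using reflection_algebra_rep[OF adm rep] by blast
  have "\<sigma> (b_coeff n (bold_l ty n) i j r) v = scale (pm_sign ty) (\<rho> (s_coeff ty n i j (int r)) v)"
    if "i \<in> {1..int n}" "j \<in> {1..int n}" "v \<in> V_J ty n \<rho>" for i j r v
  proof -
    have "b_gen i j r \<in> carrier (free_algebra (B_gens n))"
      using that by (auto simp: b_gen_def B_gens_def intro: gen_over)
    then show ?thesis
      using \<sigma>(2) that by (simp add: b_coeff_def B_to_X_b_gen signed)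
  qed
  with \<sigma>(1) show "\<exists>\<sigma>. B_rep n (bold_l ty n) scale (V_J ty n \<rho>) \<sigma> \<and>
        (\<forall>i\<in>{1..int n}. \<forall>j\<in>{1..int n}. \<forall>r. \<forall>v\<in>V_J ty n \<rho>.
          \<sigma> (b_coeff n (bold_l ty n) i j r) v =
            scale (pm_sign ty) (\<rho> (s_coeff ty n i j (int r)) v))"
    by blast
qed

end
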